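(* Let $n\ge2$, $\gamma\in\mathbb{C}\setminus\{0\}$, $f_0\in\mathbb{C}$ a constant, $\sigma=\sum_{k=1}^n\lambda_k$, and let $A_{12}(u,v;\lambda)$, $B_{12}(v;\lambda)$, $C_{12}(u;\lambda)$, $D_{12}(u-v;\lambda)$ be the rational non-constant Arutyunov-Chekhov-Frolov structure matrices defined in the context. Define $b(u;\lambda)$ by $$b_{ij}=\frac{\lambda_j^{\,i-1}}{\prod_{a\neq j}\lambda_{ja}}\ (1\le i\le n-1),\qquad b_{nj}=\frac{\lambda_j^{\,n-1}(\sigma-\lambda_j+u+\gamma)}{(\sigma+u+f_0)\prod_{a\neq j}\lambda_{ja}},\qquad j=1,\dots,n.$$ With $U=\sigma+u$, $V=\sigma+v$, define $$\begin{aligned}R_{12}(u,v;\lambda)=&\left(1+\tfrac{\gamma}{u-v}\right)\sum_{i=1}^{n-1}e_{ii}\otimes e_{ii}+\left(1+\tfrac{\gamma}{u-v}\right)\frac{(V+f_0)(U-\gamma+f_0)}{(U+f_0)(V-\gamma+f_0)}\,e_{nn}\otimes e_{nn}\\ &+\sum_{i\neq j=1}^{n-1}e_{ii}\otimes e_{jj}+\frac{V+f_0}{V-\gamma+f_0}\sum_{i=1}^{n-1}e_{ii}\otimes e_{nn}+\frac{U-\gamma+f_0}{U+f_0}\sum_{i=1}^{n-1}e_{nn}\otimes e_{ii}\\ &+\gamma\frac{U+\gamma}{U+f_0}\sum_{k=1}^{n-1}\sum_{j=1}^{n-k}e_{n,n-k}\otimes e_{j,j+k-1}-\gamma\frac{V}{V-\gamma+f_0}\sum_{k=1}^{n-1}\sum_{j=1}^{n-k}e_{j,j+k-1}\otimes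 e_{n,n-k}\\ &+\gamma\sum_{i=1}^{n-1}\sum_{k=1}^{i-1}\sum_{j=1}^{i-k}(e_{i,i-k}\otimes e_{j,j+k-1}-e_{j,j+k-1}\otimes e_{i,i-k})+\tfrac{\gamma}{u-v}\sum_{i\neq j=1}^{n-1}e_{ij}\otimes e_{ji}\\ &+\tfrac{\gamma}{u-v}\frac{U-\gamma+f_0}{V-\gamma+f_0}\sum_{i=1}^{n-1}e_{in}\otimes e_{ni}+\tfrac{\gamma}{u-v}\frac{V+f_0}{U+f_0}\sum_{i=1}^{n-1}e_{ni}\otimes e_{in}\\ &-\frac{\gamma}{U+f_0}\sum_{i=1}^{n-1}\sum_{k=1}^{n-1-i}e_{n,n-i}\otimes e_{k,k+i}+\frac{\gamma}{V-\gamma+f_0}\sum_{i=1}^{n-1}\sum_{k=1}^{n-1-i}e_{k,k+i}\otimes e_{n,n-i}.\end{aligned}$$ Write $b^g(u;\lambda)=b(u-\gamma;\lambda)$, with spectral parameter $u$ for space $1$ and $v$ for space $2$. Then: 1. $B_{12}(v;\lambda)=b_2(v;\lambda)^{-1}\,b^g_2(v;\lambda+\gamma h_1)$ and $C_{12}(u;\lambda)=b_1(u;\lambda)^{-1}\,b^g_1(u;\lambda+\gamma h_2)$. 2. $A_{12}(u,v;\lambda)=b_1(u;\lambda)^{-1}\,b^g_2(v;\lambda)^{-1}\,R_{12}(u,v;\lambda)\,b^g_1(u;\lambda)\,b_2(v;\lambda)$. 3. $D_{12}(u-v;\lambda)=(b^g_1)^{-1}(u;\lambda+\gamma h_2)\,b^g_2(v;\lambda)^{-1}\,R_{12}(u,v;\lambda)\,b^g_1(u;\lambda)\,b^g_2(v;\lambda+\gamma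 h_1)$. 4. For $f_0=\gamma$, one has $R_{12}(u,v;\lambda)=R^0_{12}(u+\sigma,v+\sigma)$, where $$\begin{aligned}R^0_{12}(u,v)=&\left(1+\tfrac{\gamma}{u-v}\right)\sum_{i=1}^{n-1}e_{ii}\otimes e_{ii}+\left(1+\tfrac{\gamma}{u-v}\right)\frac{u(v+\gamma)}{v(u+\gamma)}\,e_{nn}\otimes e_{nn}\\ &+\sum_{i\neq j=1}^{n-1}e_{ii}\otimes e_{jj}+\frac{v+\gamma}{v}\sum_{i=1}^{n-1}e_{ii}\otimes e_{nn}+\frac{u}{u+\gamma}\sum_{i=1}^{n-1}e_{nn}\otimes e_{ii}\\ &+\gamma\sum_{i=1}^{n}\sum_{k=1}^{i-1}\sum_{j=1}^{i-k}(e_{i,i-k}\otimes e_{j,j+k-1}-e_{j,j+k-1}\otimes e_{i,i-k})+\tfrac{\gamma}{u-v}\sum_{i\neq j=1}^{n-1}e_{ij}\otimes e_{ji}\\ &+\tfrac{\gamma}{u-v}\,\frac{u}{v}\sum_{i=1}^{n-1}e_{in}\otimes e_{ni}+\tfrac{\gamma}{u-v}\,\frac{v+\gamma}{u+\gamma}\sum_{i=1}^{n-1}e_{ni}\otimes e_{in}\\ &-\frac{\gamma}{u+\gamma}\sum_{i=1}^{n-1}\sum_{k=1}^{n-1-i}e_{n,n-i}\otimes e_{k,k+i}+\frac{\gamma}{v}\sum_{i=1}^{n-1}\sum_{k=1}^{n-1-i}e_{k,k+i}\otimes e_{n,n-i},\end{aligned}$$ and $R^0$ satisfies the shifted Yang-Baxter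 equation $$R^0_{12}(u_1,u_2)\,R^0_{13}(u_1-\gamma,u_3-\gamma)\,R^0_{23}(u_2,u_3)=R^0_{23}(u_2-\gamma,u_3-\gamma)\,R^0_{13}(u_1,u_3)\,R^0_{12}(u_1-\gamma,u_2-\gamma).$$
   Context: Notation: $\lambda=(\lambda_1,\dots,\lambda_n)$ complex variables, $\lambda_{ij}=\lambda_i-\lambda_j$; $u,v,u_1,u_2,u_3$ complex spectral parameters; $e_{ij}$ (also written $e_{i,j}$) standard $n\times n$ matrix units, $h_j=e_{jj}$; empty sums are zero. For an $n\times n$ matrix $M(u;\lambda)$: $M_1=M\otimes1$, $M_2=1\otimes M$, $M_2(v;\lambda+\gamma h_1)=\sum_j e_{jj}\otimes M(v;\lambda+\gamma\varepsilon_j)$, $M_1(u;\lambda+\gamma h_2)=\sum_j M(u;\lambda+\gamma\varepsilon_j)\otimes e_{jj}$, where $\lambda+\gamma\varepsilon_j$ is $\lambda$ with $\lambda_j$ replaced by $\lambda_j+\gamma$ (so $\sigma$ is also shifted to $\sigma+\gamma$). $M_{21}$ denotes $M_{12}$ with tensor factors exchanged. Identities hold as identities of meromorphic functions. The rational non-constant ACF structure matrices are $$A_{12}(u,v;\lambda)=A^\infty_{12}(\lambda)+\frac{\gamma}{u-v}d_{12}+\frac{\gamma}{v}\beta_{12}-\frac{\gamma}{u+\gamma}\beta_{21},$$ $$B_{12}(v;\lambda)=B^\infty_{12}(\lambda)-\frac{\gamma}{v+\gamma}\beta_{12},\qquad C_{12}(u;\lambda)=B_{21}(u;\lambda)=B^\infty_{21}(\lambda)-\frac{\gamma}{u+\gamma}\beta_{21},$$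 $$D_{12}(u-v;\lambda)=D^\infty_{12}(\lambda)+\frac{\gamma}{u-v}d_{12},$$ where $d_{12}=\sum_{i,j}e_{ij}\otimes e_{ji}$, $\beta_{12}=\sum_{i,j}e_{ii}\otimes e_{ji}$ and $$A^\infty_{12}=1\otimes1+\sum_{i\neq j}\frac{\gamma}{\lambda_{ij}}(e_{ii}-e_{ij})\otimes(e_{jj}-e_{ji}),$$ $$B^\infty_{12}=1\otimes1+\sum_{i\neq j}\frac{\gamma}{\lambda_{ij}-\gamma}\,e_{jj}\otimes(e_{ii}-e_{ij}),$$ $$D^\infty_{12}=1\otimes1+\sum_{i\neq j}\frac{\gamma}{\lambda_{ij}}(e_{ij}\otimes e_{ji}-e_{ii}\otimes e_{jj}).$$ It is known that $A$ satisfies $A_{12}(u_1,u_2)A_{13}(u_1-\gamma,u_3-\gamma)A_{23}(u_2,u_3)=A_{23}(u_2-\gamma,u_3-\gamma)A_{13}(u_1,u_3)A_{12}(u_1-\gamma,u_2-\gamma)$ (all at the same $\lambda$). *)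

theory Defs
  imports "HOL-Analysis.Analysis"
begin

text \<open>
  An \<open>n \<times> n\<close> matrix has type \<^typ>\<open>complex^'n^'n\<close>. The formulas below do arithmetic on indices,
  so the index type is labelled by a map \<open>\<iota>\<close> that is assumed to be a bijection from \<open>{1..n}\<close>
  onto \<^term>\<open>UNIV :: 'n set\<close>; all indices in formulas are numbers in \<open>{1..n}\<close>.
  The variables \<open>\<lambda>\<^sub>1, \<dots>, \<lambda>\<^sub>n\<close> are the values \<open>lam 1, \<dots>, lam n\<close>; other values of \<open>lam\<close> are
  never used. Operators on the tensor square and cube are matrices indexed by
  \<^typ>\<open>'n \<times> 'n\<close> and \<^typ>\<open>'n \<times> 'n \<times> 'n\<close>.
\<close>

definition cmul :: "complex \<Rightarrow> complex^'n^'m \<Rightarrow> complex^'n^'m"  (infixr "\<cdot>" 75) where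
  "c \<cdot> M = (\<chi> i j. c * M $ i $ j)"

definition tensor :: "complex^'n::finite^'n \<Rightarrow> complex^'m::finite^'m \<Rightarrow> complex^('n \<times> 'm)^('n \<times> 'm)"
    (infixr "\<otimes>" 78) where
  "M \<otimes> N = (\<chi> p q. M $ fst p $ fst q * N $ snd p $ snd q)"

definition flip :: "complex^('n::finite \<times> 'n)^('n \<times> 'n) \<Rightarrow> complex^('n \<times> 'n)^('n \<times> 'n)" where
  "flip M = (\<chi> p q. M $ (snd p, fst p) $ (snd q, fst q))"

definition in1 :: "complex^'n::finite^'n \<Rightarrow> complex^('n \<times> 'n)^('n \<times> 'n)" where
  "in1 M = M \<otimes> mat 1"

definition in2 :: "complex^'n::finite^'n \<Rightarrow> complex^('n \<times> 'n)^('n \<times> 'n)" where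
  "in2 M = mat 1 \<otimes> M"

definition leg12 ::
    "complex^('n::finite \<times> 'n)^('n \<times> 'n) \<Rightarrow> complex^('n \<times> 'n \<times> 'n)^('n \<times> 'n \<times> 'n)" where
  "leg12 M = (\<chi> p q. case (p, q) of ((a, b, c), (a', b', c')) \<Rightarrow>
      if c = c' then M $ (a, b) $ (a', b') else 0)"

definition leg13 ::
    "complex^('n::finite \<times> 'n)^('n \<times> 'n) \<Rightarrow> complex^('n \<times> 'n \<times> 'n)^('n \<times> 'n \<times> 'n)" where
  "leg13 M = (\<chi> p q. case (p, q) of ((a, b, c), (a', b', c')) \<Rightarrow>
      if b = b' then M $ (a, c) $ (a', c') else 0)"

definition leg23 ::
    "complex^('n::finite \<times> 'n)^('n \<times> 'n) \<Rightarrow> complex^('n \<times> 'n \<times> 'n)^('n \<times> 'n \<times> 'n)" where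
  "leg23 M = (\<chi> p q. case (p, q) of ((a, b, c), (a', b', c')) \<Rightarrow>
      if a = a' then M $ (b, c) $ (b', c') else 0)"

definition munit :: "(nat \<Rightarrow> 'n) \<Rightarrow> nat \<Rightarrow> nat \<Rightarrow> complex^'n^'n" where
  "munit \<iota> i j = (\<chi> a b. if a = \<iota> i \<and> b = \<iota> j then 1 else 0)"

definition lamsum :: "nat \<Rightarrow> (nat \<Rightarrow> complex) \<Rightarrow> complex" where
  "lamsum n lam = (\<Sum>k=1..n. lam k)"

definition lamshift :: "complex \<Rightarrow> (nat \<Rightarrow> complex) \<Rightarrow> nat \<Rightarrow> (nat \<Rightarrow> complex)" where
  "lamshift \<gamma> lam j = lam(j := lam j + \<gamma>)"

context
  fixes n :: nat and \<iota> :: "nat \<Rightarrow> 'n::finite" and \<gamma> :: complex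
begin

private abbreviation (input) e :: "nat \<Rightarrow> nat \<Rightarrow> complex^'n^'n" where
  "e i j \<equiv> munit \<iota> i j"

text \<open>\<open>M\<^sub>1(\<lambda> + \<gamma> h\<^sub>2)\<close> and \<open>M\<^sub>2(\<lambda> + \<gamma> h\<^sub>1)\<close> for a matrix-valued function \<open>M\<close> of \<open>\<lambda>\<close>.\<close>

definition dyn1 :: "((nat \<Rightarrow> complex) \<Rightarrow> complex^'n^'n) \<Rightarrow> (nat \<Rightarrow> complex)
    \<Rightarrow> complex^('n \<times> 'n)^('n \<times> 'n)" where
  "dyn1 M lam = (\<Sum>j=1..n. M (lamshift \<gamma> lam j) \<otimes> e j j)"

definition dyn2 :: "((nat \<Rightarrow> complex) \<Rightarrow> complex^'n^'n) \<Rightarrow> (nat \<Rightarrow> complex)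
    \<Rightarrow> complex^('n \<times> 'n)^('n \<times> 'n)" where
  "dyn2 M lam = (\<Sum>j=1..n. e j j \<otimes> M (lamshift \<gamma> lam j))"

definition acf_d :: "complex^('n \<times> 'n)^('n \<times> 'n)" where
  "acf_d = (\<Sum>i=1..n. \<Sum>j=1..n. e i j \<otimes> e j i)"

definition acf_beta :: "complex^('n \<times> 'n)^('n \<times> 'n)" where
  "acf_beta = (\<Sum>i=1..n. \<Sum>j=1..n. e i i \<otimes> e j i)"

definition acf_Ainf :: "(nat \<Rightarrow> complex) \<Rightarrow> complex^('n \<times> 'n)^('n \<times> 'n)" where
  "acf_Ainf lam = mat 1 + (\<Sum>i=1..n. \<Sum>j\<in>{1..n}-{i}.
      (\<gamma> / (lam i - lam j)) \<cdot> ((e i i - e i j) \<otimes> (e j j - e j i)))"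

definition acf_Binf :: "(nat \<Rightarrow> complex) \<Rightarrow> complex^('n \<times> 'n)^('n \<times> 'n)" where
  "acf_Binf lam = mat 1 + (\<Sum>i=1..n. \<Sum>j\<in>{1..n}-{i}.
      (\<gamma> / (lam i - lam j - \<gamma>)) \<cdot> (e j j \<otimes> (e i i - e i j)))"

definition acf_Dinf :: "(nat \<Rightarrow> complex) \<Rightarrow> complex^('n \<times> 'n)^('n \<times> 'n)" where
  "acf_Dinf lam = mat 1 + (\<Sum>i=1..n. \<Sum>j\<in>{1..n}-{i}.
      (\<gamma> / (lam i - lam j)) \<cdot> (e i j \<otimes> e j i - e i i \<otimes> e j j))"

definition acf_A :: "complex \<Rightarrow> complex \<Rightarrow> (nat \<Rightarrow> complex) \<Rightarrow> complex^('n \<times> 'n)^('n \<times> 'n)" where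
  "acf_A u v lam = acf_Ainf lam + (\<gamma> / (u - v)) \<cdot> acf_d + (\<gamma> / v) \<cdot> acf_beta
      - (\<gamma> / (u + \<gamma>)) \<cdot> flip acf_beta"

definition acf_B :: "complex \<Rightarrow> (nat \<Rightarrow> complex) \<Rightarrow> complex^('n \<times> 'n)^('n \<times> 'n)" where
  "acf_B v lam = acf_Binf lam - (\<gamma> / (v + \<gamma>)) \<cdot> acf_beta"

definition acf_C :: "complex \<Rightarrow> (nat \<Rightarrow> complex) \<Rightarrow> complex^('n \<times> 'n)^('n \<times> 'n)" where
  "acf_C u lam = flip (acf_B u lam)"

definition acf_D :: "complex \<Rightarrow> (nat \<Rightarrow> complex) \<Rightarrow> complex^('n \<times> 'n)^('n \<times> 'n)" where
  "acf_D w lam = acf_Dinf lam + (\<gamma> / w) \<cdot> acf_d"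

definition acf_b :: "complex \<Rightarrow> complex \<Rightarrow> (nat \<Rightarrow> complex) \<Rightarrow> complex^'n^'n" where
  "acf_b f0 u lam =
     (\<Sum>i=1..n-1. \<Sum>j=1..n. (lam j ^ (i - 1) / (\<Prod>a\<in>{1..n}-{j}. lam j - lam a)) \<cdot> e i j)
   + (\<Sum>j=1..n. (lam j ^ (n - 1) * (lamsum n lam - lam j + u + \<gamma>)
        / ((lamsum n lam + u + f0) * (\<Prod>a\<in>{1..n}-{j}. lam j - lam a))) \<cdot> e n j)"

definition acf_bg :: "complex \<Rightarrow> complex \<Rightarrow> (nat \<Rightarrow> complex) \<Rightarrow> complex^'n^'n" where
  "acf_bg f0 u lam = acf_b f0 (u - \<gamma>) lam"

definition acf_R :: "complex \<Rightarrow> complex \<Rightarrow> complex \<Rightarrow> (nat \<Rightarrow> complex)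
    \<Rightarrow> complex^('n \<times> 'n)^('n \<times> 'n)" where
  "acf_R f0 u v lam = (let U = lamsum n lam + u; V = lamsum n lam + v in
     (1 + \<gamma> / (u - v)) \<cdot> (\<Sum>i=1..n-1. e i i \<otimes> e i i)
   + ((1 + \<gamma> / (u - v)) * (((V + f0) * (U - \<gamma> + f0)) / ((U + f0) * (V - \<gamma> + f0))))
       \<cdot> (e n n \<otimes> e n n)
   + (\<Sum>i=1..n-1. \<Sum>j\<in>{1..n-1}-{i}. e i i \<otimes> e j j)
   + ((V + f0) / (V - \<gamma> + f0)) \<cdot> (\<Sum>i=1..n-1. e i i \<otimes> e n n)
   + ((U - \<gamma> + f0) / (U + f0)) \<cdot> (\<Sum>i=1..n-1. e n n \<otimes> e i i)
   + (\<gamma> * ((U + \<gamma>) / (U + f0)))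
       \<cdot> (\<Sum>k=1..n-1. \<Sum>j=1..n-k. e n (n - k) \<otimes> e j (j + k - 1))
   - (\<gamma> * (V / (V - \<gamma> + f0)))
       \<cdot> (\<Sum>k=1..n-1. \<Sum>j=1..n-k. e j (j + k - 1) \<otimes> e n (n - k))
   + \<gamma> \<cdot> (\<Sum>i=1..n-1. \<Sum>k=1..i-1. \<Sum>j=1..i-k.
       e i (i - k) \<otimes> e j (j + k - 1) - e j (j + k - 1) \<otimes> e i (i - k))
   + (\<gamma> / (u - v)) \<cdot> (\<Sum>i=1..n-1. \<Sum>j\<in>{1..n-1}-{i}. e i j \<otimes> e j i)
   + ((\<gamma> / (u - v)) * ((U - \<gamma> + f0) / (V - \<gamma> + f0))) \<cdot> (\<Sum>i=1..n-1. e i n \<otimes> e n i)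
   + ((\<gamma> / (u - v)) * ((V + f0) / (U + f0))) \<cdot> (\<Sum>i=1..n-1. e n i \<otimes> e i n)
   - (\<gamma> / (U + f0)) \<cdot> (\<Sum>i=1..n-1. \<Sum>k=1..n-1-i. e n (n - i) \<otimes> e k (k + i))
   + (\<gamma> / (V - \<gamma> + f0)) \<cdot> (\<Sum>i=1..n-1. \<Sum>k=1..n-1-i. e k (k + i) \<otimes> e n (n - i)))"

definition acf_R0 :: "complex \<Rightarrow> complex \<Rightarrow> complex^('n \<times> 'n)^('n \<times> 'n)" where
  "acf_R0 u v =
     (1 + \<gamma> / (u - v)) \<cdot> (\<Sum>i=1..n-1. e i i \<otimes> e i i)
   + ((1 + \<gamma> / (u - v)) * ((u * (v + \<gamma>)) / (v * (u + \<gamma>)))) \<cdot> (e n n \<otimes> e n n)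
   + (\<Sum>i=1..n-1. \<Sum>j\<in>{1..n-1}-{i}. e i i \<otimes> e j j)
   + ((v + \<gamma>) / v) \<cdot> (\<Sum>i=1..n-1. e i i \<otimes> e n n)
   + (u / (u + \<gamma>)) \<cdot> (\<Sum>i=1..n-1. e n n \<otimes> e i i)
   + \<gamma> \<cdot> (\<Sum>i=1..n. \<Sum>k=1..i-1. \<Sum>j=1..i-k.
       e i (i - k) \<otimes> e j (j + k - 1) - e j (j + k - 1) \<otimes> e i (i - k))
   + (\<gamma> / (u - v)) \<cdot> (\<Sum>i=1..n-1. \<Sum>j\<in>{1..n-1}-{i}. e i j \<otimes> e j i)
   + ((\<gamma> / (u - v)) * (u / v)) \<cdot> (\<Sum>i=1..n-1. e i n \<otimes> e n i)
   + ((\<gamma> / (u - v)) * ((v + \<gamma>) / (u + \<gamma>))) \<cdot> (\<Sum>i=1..n-1. e n i \<otimes> e i n)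
   - (\<gamma> / (u + \<gamma>)) \<cdot> (\<Sum>i=1..n-1. \<Sum>k=1..n-1-i. e n (n - i) \<otimes> e k (k + i))
   + (\<gamma> / v) \<cdot> (\<Sum>i=1..n-1. \<Sum>k=1..n-1-i. e k (k + i) \<otimes> e n (n - i))"

end

text \<open>Off the poles \<open>\<lambda>\<^sub>i - \<lambda>\<^sub>j = \<gamma>\<close> of \<^const>\<open>acf_Binf\<close>; for pairwise distinct \<open>\<lambda>\<^sub>i\<close> this also
  says that every shifted point \<open>\<lambda> + \<gamma>\<epsilon>\<^sub>j\<close> has pairwise distinct coordinates.\<close>

definition nonres :: "nat \<Rightarrow> complex \<Rightarrow> (nat \<Rightarrow> complex) \<Rightarrow> bool" where
  "nonres n \<gamma> lam \<longleftrightarrow> (\<forall>i\<in>{1..n}. \<forall>j\<in>{1..n}. i \<noteq> j \<longrightarrow> lam i - lam j \<noteq> \<gamma>)"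

end

(*
  Up to scalings, row i of b lists the values at lambda_1, ..., lambda_n of a function psi_i: the
  monomial x^(i-1) for i < n, and x^(n-1) (sigma + u + gamma - x) for i = n, weighted by the
  barycentric weights w_j. In these terms R is the matrix, in the basis psi_i(x) psi_k(y), of the operator
      T F(x, y) = F(x, y) + gamma (F(x, y) - F(y, x)) / (x - y) + gamma / (u - v) F(y, x).
  Evaluating T F at pairs of points lambda_p, lambda_q (or their shifts by gamma) gives A and D;
  the diagonal columns of A need in addition the identities sum_j w_j lambda_j^m = 0, 1, sigma for
  m < n - 1, m = n - 1, m = n. The formula for B is the partial fraction decomposition of psi_i / prod_j (x - lambda_j)
  at lambda_p + gamma. Finally T depends on u - v only and satisfies the Yang-Baxter equation; the
  parameter shifts in the equation for R0 are those by which R changes the parameters of the psi_i.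
*)

theory Submission
  imports Defs "HOL-Analysis.Analysis"
begin

section \<open>Barycentric weights and power sums\<close>

text \<open>One polynomial identity, \<open>rhat_\<psi>\<close>, serves both A and D, because R
  turns values of \<psi> with parameters (U, V + \<gamma>) into values with parameters (U +
  \<gamma>, V). The parameter of b(u) is U + \<gamma>, that of b^g(u) is U, and a shift of \<lambda>
  raises \<sigma> by \<gamma>, so that b^g at a shifted point has the parameter of b again. The
  obstacle is that x^(n-1) is not in the span of the \<psi>_i, while the divided difference produces
  x^(n-1) y^(k-1) and x^(k-1) y^(n-1). One of these terms is absorbed by moving a parameter by
  \<gamma>, the other by the exchange term, which forces its coefficient \<gamma> / (U - V). The
  constant f0 enters b and R only through diagonal factors, which cancel before any polynomial
  algebra begins. In the Yang-Baxter equation all points are taken distinct; then T only mixes F(x,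
  y) with F(y, x), and the equation becomes a comparison of six coefficients, one for each
  permutation of three points.\<close>

text \<open>The sum of \<open>bary I x j * f j\<close> over I is the divided difference of f at the
  nodes. The index set is arbitrary because nodes get removed in the inductions and
  \<open>w_shift_same\<close> adjoins a node with index 0.\<close>

definition bary :: "'i set \<Rightarrow> ('i \<Rightarrow> complex) \<Rightarrow> 'i \<Rightarrow> complex" where
  "bary I x j = 1 / (\<Prod>a\<in>I - {j}. x j - x a)"

lemma bary_insert:
  assumes "finite I" "j \<in> I" "z \<notin> I" "x j \<noteq> x z"
  shows "bary (insert z I) x j * (x j - x z) = bary I x j"
proof -
  have "insert z I - {j} = insert z (I - {j})" using assms by auto
  then show ?thesis using assms by (simp add: bary_def)
qed

lemma bary_cong:
  assumes "\<And>a. a \<in> I \<Longrightarrow> x a = y a" "j \<in> I"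
  shows "bary I x j = bary I y j"
  unfolding bary_def using assms by (auto intro!: prod.cong)

text \<open>The factor vanishes at the node z and cancels one factor of the weight at every other
  node: multiplying by x - x_z lowers a divided difference by one node.\<close>

lemma sum_bary_insert:
  assumes "finite I" "z \<notin> I" "inj_on x (insert z I)"
  shows "(\<Sum>j\<in>insert z I. bary (insert z I) x j * ((x j - x z) * f j)) = (\<Sum>j\<in>I. bary I x j * f j)"
proof -
  have "(\<Sum>j\<in>I. bary (insert z I) x j * ((x j - x z) * f j)) = (\<Sum>j\<in>I. bary I x j * f j)"
  proof (rule sum.cong[OF refl])
    fix j assume j: "j \<in> I"
    then have "x j \<noteq> x z" using assms by (auto simp: inj_on_def)
    then show "bary (insert z I) x j * ((x j - x z) * f j) = bary I x j * f j"
      using bary_insert[of I j z x] assms j by (simp flip: mult.assoc)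
  qed
  then show ?thesis using assms by simp
qed

text \<open>Comes from x^(m+1) = x_z x^m + (x - x_z) x^m; the second part loses the node z.\<close>

lemma sum_bary_power_Suc:
  assumes "finite I" "z \<notin> I" "inj_on x (insert z I)"
  shows "(\<Sum>j\<in>insert z I. bary (insert z I) x j * x j ^ Suc m)
    = x z * (\<Sum>j\<in>insert z I. bary (insert z I) x j * x j ^ m) + (\<Sum>j\<in>I. bary I x j * x j ^ m)"
  unfolding sum_bary_insert[OF assms, symmetric] sum_distrib_left sum.distrib[symmetric]
  by (rule sum.cong[OF refl]) (simp add: algebra_simps)

lemma sum_bary_power:
  assumes "finite I" "inj_on x I" "m < card I"
  shows "(\<Sum>j\<in>I. bary I x j * x j ^ m) = (if Suc m = card I then 1 else 0)"
  using assms
proof (induction "card I" arbitrary: I m)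
  case 0
  then show ?case by simp
next
  case (Suc N)
  show ?case
  proof (cases "N = 0")
    case True
    then obtain z where "I = {z}" using Suc by (metis One_nat_def card_1_singletonE)
    then show ?thesis using Suc.prems by (simp add: bary_def)
  next
    case False
    have step: "(\<Sum>j\<in>I. bary I x j * x j ^ Suc k)
      = x z * (\<Sum>j\<in>I. bary I x j * x j ^ k) + (if Suc k = N then 1 else 0)" if "z \<in> I" "k < N" for z k
    proof -
      have I: "insert z (I - {z}) = I" using that by auto
      have "card (I - {z}) = N" using that Suc by simp
      moreover have "inj_on x (I - {z})" using Suc.prems by (auto intro: inj_on_subset)
      ultimately show ?thesis
        using sum_bary_power_Suc[of "I - {z}" z x k] Suc.hyps(1)[of "I - {z}" k] Suc.prems that
        unfolding I by simp
    qed
    obtain z where z: "z \<in> I" using Suc by fastforce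
    have "card (I - {z}) = N" using z Suc by simp
    then obtain w where w: "w \<in> I" "w \<noteq> z" using False by (metis card.empty Diff_iff all_not_in_conv singletonI)
    have "x z \<noteq> x w" using z w Suc.prems by (auto simp: inj_on_def)
    \<comment> \<open>Splitting off z and splitting off w express the same first moment as x_z S + c
      and as x_w S + c, where S is the zeroth moment; hence S = 0.\<close>
    then have base: "(\<Sum>j\<in>I. bary I x j * x j ^ 0) = 0"
      using step[OF z, of 0] step[OF w(1), of 0] False by simp
    show ?thesis using Suc.prems(3)
    proof (induction m)
      case 0
      then show ?case using base False Suc.hyps(2) by simp
    next
      case (Suc m)
      then show ?case using step[OF z, of m] Suc.IH \<open>Suc N = card I\<close>[symmetric] by auto
    qed
  qed
qed

text \<open>By the recursion a new node z contributes x_z times the moment of order one less, which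
  is 1.\<close>

lemma sum_bary_power_card:
  assumes "finite I" "inj_on x I" "I \<noteq> {}"
  shows "(\<Sum>j\<in>I. bary I x j * x j ^ card I) = sum x I"
  using assms(1,3,2)
proof (induction I rule: finite_ne_induct)
  case (singleton z)
  then show ?case by (simp add: bary_def)
next
  case (insert z I)
  have "card I < card (insert z I)" using insert by simp
  then show ?case
    using sum_bary_power_Suc[of I z x "card I"] sum_bary_power[of "insert z I" x "card I"] insert
    by (auto intro: inj_on_subset)
qed

text \<open>Solvability of the transposed Vandermonde system. It is what allows
  \<open>\<psi>_span\<close> to write an arbitrary index function as a combination of the \<psi>_i
  at given points.\<close>

lemma moments_surjective:
  assumes "finite X"
  shows "\<exists>c. \<forall>m<card X. (\<Sum>x\<in>X. c x * x ^ m) = (\<mu> m :: complex)"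
  using assms
proof (induction X arbitrary: \<mu> rule: finite_induct)
  case empty
  then show ?case by simp
next
  case (insert z X)
  obtain c where c: "\<And>m. m < card X \<Longrightarrow> (\<Sum>x\<in>X. c x * x ^ m) = \<mu> (Suc m) - z * \<mu> m"
    using insert.IH[of "\<lambda>m. \<mu> (Suc m) - z * \<mu> m"] by auto
  \<comment> \<open>Dividing by x - z makes d applied to (x - z) p agree with c applied to p,
    whatever the weight at z. That weight is then chosen to give the zeroth moment.\<close>
  define d where "d x = (if x = z then \<mu> 0 - (\<Sum>x\<in>X. c x / (x - z)) else c x / (x - z))" for x
  have d0: "(\<Sum>x\<in>insert z X. d x * x ^ 0) = \<mu> 0"
  proof -
    have "(\<Sum>x\<in>X. d x) = (\<Sum>x\<in>X. c x / (x - z))"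
      using insert by (intro sum.cong) (auto simp: d_def)
    then show ?thesis using insert by (simp add: d_def)
  qed
  have step: "(\<Sum>x\<in>insert z X. d x * x ^ Suc m) = z * (\<Sum>x\<in>insert z X. d x * x ^ m) + (\<Sum>x\<in>X. c x * x ^ m)" for m
  proof -
    have "(\<Sum>x\<in>X. d x * x ^ Suc m) = (\<Sum>x\<in>X. z * (d x * x ^ m) + c x * x ^ m)"
    proof (rule sum.cong[OF refl])
      fix x assume "x \<in> X"
      then have "x \<noteq> z" using insert by auto
      then have "d x * (x - z) = c x" by (simp add: d_def)
      then have "c x * x ^ m = d x * (x - z) * x ^ m" by simp
      then show "d x * x ^ Suc m = z * (d x * x ^ m) + c x * x ^ m" by (simp add: algebra_simps)
    qed
    then show ?thesis using insert by (simp add: algebra_simps sum.distrib sum_distrib_left)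
  qed
  have "(\<Sum>x\<in>insert z X. d x * x ^ m) = \<mu> m" if "m \<le> card X" for m
    using that
  proof (induction m)
    case 0
    show ?case by (rule d0)
  next
    case (Suc m)
    then show ?case using step[of m] c[of m] by simp
  qed
  then show ?case using insert by (intro exI[of _ d]) auto
qed

section \<open>Labelled tensor matrices\<close>

lemma sum_if_const: "(\<Sum>x\<in>A. if P then f x else 0) = (if P then \<Sum>x\<in>A. f x else (0::complex))"
  by simp

locale labelling =
  fixes n :: nat and \<iota> :: "nat \<Rightarrow> 'n::finite"
  assumes n_ge_2: "n \<ge> 2" and bij: "bij_betw \<iota> {1..n} (UNIV :: 'n set)"
begin

abbreviation e :: "nat \<Rightarrow> nat \<Rightarrow> complex^'n^'n" where "e i j \<equiv> munit \<iota> i j"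

lemma \<iota>_eq_iff [simp]: "i \<in> {1..n} \<Longrightarrow> j \<in> {1..n} \<Longrightarrow> \<iota> i = \<iota> j \<longleftrightarrow> i = j"
  using inj_on_eq_iff[OF bij_betw_imp_inj_on[OF bij]] .

lemma sum_UNIV: "(\<Sum>x\<in>UNIV. f x) = (\<Sum>i=1..n. f (\<iota> i))"
  using sum.reindex_bij_betw[OF bij, of f] by simp

lemma sum_UNIV2: "(\<Sum>p\<in>UNIV. f p) = (\<Sum>i=1..n. \<Sum>k=1..n. f (\<iota> i, \<iota> k))"
proof -
  have "(\<Sum>p\<in>UNIV. f p) = (\<Sum>x\<in>UNIV. \<Sum>y\<in>UNIV. f (x, y))"
    by (simp add: sum.cartesian_product)
  then show ?thesis by (simp add: sum_UNIV)
qed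

lemma label_cases: obtains i where "i \<in> {1..n}" "x = \<iota> i"
  using bij by (metis UNIV_I bij_betw_imp_surj_on imageE)

lemma mat2_eqI:
  assumes "\<And>i k p q. \<lbrakk>i \<in> {1..n}; k \<in> {1..n}; p \<in> {1..n}; q \<in> {1..n}\<rbrakk>
    \<Longrightarrow> X $ (\<iota> i, \<iota> k) $ (\<iota> p, \<iota> q) = Y $ (\<iota> i, \<iota> k) $ (\<iota> p, \<iota> q)"
  shows "X = Y"
proof -
  have "X $ r $ s = Y $ r $ s" for r s
    using assms by (metis label_cases surj_pair)
  then show ?thesis by (simp add: vec_eq_iff)
qed

text \<open>A row as a functional on functions of the column index, so that products of matrices
  become compositions of functionals. R stands on the left and is handled by \<open>rowact\<close>;
  A, B and D stand on the right and are handled by \<open>colact\<close>.\<close>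

definition rowact :: "complex^('n \<times> 'n)^('n \<times> 'n) \<Rightarrow> nat \<Rightarrow> nat \<Rightarrow> (nat \<Rightarrow> nat \<Rightarrow> complex) \<Rightarrow> complex" where
  "rowact X i k f = (\<Sum>a=1..n. \<Sum>b=1..n. X $ (\<iota> i, \<iota> k) $ (\<iota> a, \<iota> b) * f a b)"

definition colact :: "complex^('n \<times> 'n)^('n \<times> 'n) \<Rightarrow> nat \<Rightarrow> nat \<Rightarrow> (nat \<Rightarrow> nat \<Rightarrow> complex) \<Rightarrow> complex" where
  "colact X p q f = (\<Sum>a=1..n. \<Sum>b=1..n. f a b * X $ (\<iota> a, \<iota> b) $ (\<iota> p, \<iota> q))"

lemma mult_nth_rowact:
  "(X ** Y) $ (\<iota> i, \<iota> k) $ s = rowact X i k (\<lambda>a b. Y $ (\<iota> a, \<iota> b) $ s)"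
  by (simp add: matrix_matrix_mult_def rowact_def sum_UNIV2)

lemma mult_nth_colact:
  "(X ** Y) $ r $ (\<iota> p, \<iota> q) = colact Y p q (\<lambda>a b. X $ r $ (\<iota> a, \<iota> b))"
  by (simp add: matrix_matrix_mult_def colact_def sum_UNIV2)

lemma rowact_cong:
  assumes "\<And>a b. a \<in> {1..n} \<Longrightarrow> b \<in> {1..n} \<Longrightarrow> f a b = g a b"
  shows "rowact X i k f = rowact X i k g"
  unfolding rowact_def using assms by (intro sum.cong) auto

lemma colact_cong:
  assumes "\<And>a b. a \<in> {1..n} \<Longrightarrow> b \<in> {1..n} \<Longrightarrow> f a b = g a b"
  shows "colact X i k f = colact X i k g"
  unfolding colact_def using assms by (intro sum.cong) auto

lemma rowact_linear:
  "rowact (X + Y) i k f = rowact X i k f + rowact Y i k f"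
  "rowact (X - Y) i k f = rowact X i k f - rowact Y i k f"
  "rowact (c \<cdot> X) i k f = c * rowact X i k f"
  "rowact 0 i k f = 0"
  by (simp_all add: rowact_def cmul_def algebra_simps sum.distrib sum_subtractf sum_distrib_left)

lemma colact_linear:
  "colact (X + Y) i k f = colact X i k f + colact Y i k f"
  "colact (X - Y) i k f = colact X i k f - colact Y i k f"
  "colact (c \<cdot> X) i k f = c * colact X i k f"
  "colact 0 i k f = 0"
  by (simp_all add: colact_def cmul_def algebra_simps sum.distrib sum_subtractf sum_distrib_left)

lemma rowact_sum: "rowact (\<Sum>t\<in>T. X t) i k f = (\<Sum>t\<in>T. rowact (X t) i k f)"
  by (induction T rule: infinite_finite_induct) (simp_all add: rowact_linear)

lemma colact_sum: "colact (\<Sum>t\<in>T. X t) i k f = (\<Sum>t\<in>T. colact (X t) i k f)"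
  by (induction T rule: infinite_finite_induct) (simp_all add: colact_linear)

text \<open>Nested conditionals instead of a conjunction let delta sums collapse one index at a
  time.\<close>

lemma rowact_e:
  assumes "{a, b, c, d} \<subseteq> {1..n}" "i \<in> {1..n}" "k \<in> {1..n}"
  shows "rowact (e a b \<otimes> e c d) i k f = (if i = a then if k = c then f b d else 0 else 0)"
proof -
  have "rowact (e a b \<otimes> e c d) i k f
      = (\<Sum>p=1..n. \<Sum>q=1..n. if q = d then if p = b then if i = a \<and> k = c then f b d else 0 else 0 else 0)"
    unfolding rowact_def tensor_def munit_def using assms by (intro sum.cong) auto
  also have "\<dots> = (if i = a \<and> k = c then f b d else 0)"
    using assms by simp
  finally show ?thesis by simp
qed

lemma colact_e:
  assumes "{a, b, c, d} \<subseteq> {1..n}" "p \<in> {1..n}" "q \<in> {1..n}"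
  shows "colact (e a b \<otimes> e c d) p q f = (if p = b then if q = d then f a c else 0 else 0)"
proof -
  have "colact (e a b \<otimes> e c d) p q f
      = (\<Sum>i=1..n. \<Sum>k=1..n. if k = c then if i = a then if p = b \<and> q = d then f a c else 0 else 0 else 0)"
    unfolding colact_def tensor_def munit_def using assms by (intro sum.cong) auto
  also have "\<dots> = (if p = b \<and> q = d then f a c else 0)"
    using assms by simp
  finally show ?thesis by simp
qed

lemma colact_mat1:
  assumes "p \<in> {1..n}" "q \<in> {1..n}"
  shows "colact (mat 1) p q f = f p q"
proof -
  have "colact (mat 1) p q f = (\<Sum>i=1..n. \<Sum>k=1..n. if k = q then if i = p then f p q else 0 else 0)"
    unfolding colact_def mat_def using assms by (intro sum.cong) auto
  then show ?thesis using assms by simp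
qed

lemma colact_flip: "colact (flip X) p q f = colact X q p (\<lambda>a b. f b a)"
  unfolding colact_def flip_def by (subst sum.swap) simp

lemma in1_nth [simp]: "\<lbrakk>b \<in> {1..n}; d \<in> {1..n}\<rbrakk> \<Longrightarrow>
  in1 M $ (\<iota> a, \<iota> b) $ (\<iota> c, \<iota> d) = (if b = d then M $ \<iota> a $ \<iota> c else 0)"
  by (simp add: in1_def tensor_def mat_def)

lemma in2_nth [simp]: "\<lbrakk>a \<in> {1..n}; c \<in> {1..n}\<rbrakk> \<Longrightarrow>
  in2 M $ (\<iota> a, \<iota> b) $ (\<iota> c, \<iota> d) = (if a = c then M $ \<iota> b $ \<iota> d else 0)"
  by (simp add: in2_def tensor_def mat_def)

lemma dyn1_nth [simp]:
  assumes "b \<in> {1..n}" "d \<in> {1..n}"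
  shows "dyn1 n \<iota> \<gamma> M lam $ (\<iota> a, \<iota> b) $ (\<iota> c, \<iota> d)
    = (if b = d then M (lamshift \<gamma> lam b) $ \<iota> a $ \<iota> c else 0)"
proof -
  have "dyn1 n \<iota> \<gamma> M lam $ (\<iota> a, \<iota> b) $ (\<iota> c, \<iota> d)
    = (\<Sum>j=1..n. if j = b then if b = d then M (lamshift \<gamma> lam b) $ \<iota> a $ \<iota> c else 0 else 0)"
    unfolding dyn1_def tensor_def munit_def sum_component using assms by (intro sum.cong) auto
  then show ?thesis using assms by simp
qed

lemma dyn2_nth [simp]:
  assumes "a \<in> {1..n}" "c \<in> {1..n}"
  shows "dyn2 n \<iota> \<gamma> M lam $ (\<iota> a, \<iota> b) $ (\<iota> c, \<iota> d)
    = (if a = c then M (lamshift \<gamma> lam a) $ \<iota> b $ \<iota> d else 0)"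
proof -
  have "dyn2 n \<iota> \<gamma> M lam $ (\<iota> a, \<iota> b) $ (\<iota> c, \<iota> d)
    = (\<Sum>j=1..n. if j = a then if a = c then M (lamshift \<gamma> lam a) $ \<iota> b $ \<iota> d else 0 else 0)"
    unfolding dyn2_def tensor_def munit_def sum_component using assms by (intro sum.cong) auto
  then show ?thesis using assms by simp
qed

lemma munit_nth: "\<lbrakk>{a, b, i, j} \<subseteq> {1..n}\<rbrakk> \<Longrightarrow> e i j $ \<iota> a $ \<iota> b = (if i = a then if j = b then 1 else 0 else 0)"
  by (auto simp: munit_def)

section \<open>The functions \<psi>_i behind the gauge matrix b\<close>

text \<open>Up to a row scaling and the barycentric weights, the entries of \<open>b\<close> are the values
  \<open>\<psi> c i (\<lambda>\<^sub>j)\<close> with \<open>c = \<sigma> + u + \<gamma>\<close>.\<close>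

definition \<psi> :: "complex \<Rightarrow> nat \<Rightarrow> complex \<Rightarrow> complex" where
  "\<psi> c i x = (if i = n then x ^ (n - 1) * (c - x) else x ^ (i - 1))"

text \<open>The diagonal matrix with last entry c and all others 1. The whole f0-dependence of b and
  R sits in such factors.\<close>

definition scale :: "complex \<Rightarrow> nat \<Rightarrow> complex" where
  "scale c i = (if i = n then c else 1)"

abbreviation w :: "(nat \<Rightarrow> complex) \<Rightarrow> nat \<Rightarrow> complex" where
  "w lam \<equiv> bary {1..n} lam"

lemma acf_b_nth:
  assumes "i \<in> {1..n}" "j \<in> {1..n}"
  shows "acf_b n \<iota> \<gamma> f0 u lam $ \<iota> i $ \<iota> j
    = scale (1 / (lamsum n lam + u + f0)) i * \<psi> (lamsum n lam + u + \<gamma>) i (lam j) * w lam j"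
proof -
  let ?c = "\<lambda>i j. lam j ^ (i - 1) / (\<Prod>a\<in>{1..n}-{j}. lam j - lam a)"
  let ?d = "\<lambda>j. lam j ^ (n - 1) * (lamsum n lam - lam j + u + \<gamma>)
        / ((lamsum n lam + u + f0) * (\<Prod>a\<in>{1..n}-{j}. lam j - lam a))"
  have "acf_b n \<iota> \<gamma> f0 u lam $ \<iota> i $ \<iota> j
    = (\<Sum>a=1..n-1. \<Sum>b=1..n. if a = i then if b = j then ?c i j else 0 else 0)
     + (\<Sum>b=1..n. if n = i then if b = j then ?d j else 0 else 0)"
    unfolding acf_b_def vector_add_component sum_component
    using assms n_ge_2 by (intro arg_cong2[where f = "(+)"] sum.cong) (auto simp: munit_nth cmul_def)
  also have "\<dots> = (if i = n then ?d j else ?c i j)"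
    using assms by (auto simp: sum_if_const)
  moreover have "lamsum n lam + u + \<gamma> - lam j = lamsum n lam - lam j + u + \<gamma>" by simp
  ultimately show ?thesis
    by (simp add: \<psi>_def scale_def bary_def)
qed

end

section \<open>The rows of R\<close>

text \<open>One row of the triangular sums in R: for fixed s the condition s \<le> M - k becomes k
  \<le> M - s, and M \<le> N + 1 keeps this range inside {1..N}.\<close>

lemma sum_triangle_row:
  fixes g :: "nat \<Rightarrow> complex"
  assumes "s \<ge> 1" "M \<le> N + 1"
  shows "(\<Sum>k=1..N. if s \<in> {1..M - k} then g k else 0) = (\<Sum>k=1..M - s. g k)"
  using assms by (intro sum.mono_neutral_cong_right) auto

context labelling begin

text \<open>Row \<open>(i, k)\<close> of \<open>R\<close> with the \<open>f0\<close>-dependent diagonal factors stripped off, as a functional of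
  the column index; \<open>q\<close> stands for \<open>\<gamma> / (u - v)\<close>.\<close>

definition rhat :: "complex \<Rightarrow> complex \<Rightarrow> complex \<Rightarrow> complex \<Rightarrow> nat \<Rightarrow> nat \<Rightarrow> (nat \<Rightarrow> nat \<Rightarrow> complex) \<Rightarrow> complex" where
  "rhat \<gamma> q U V i k f = f i k + q * f k i
    + \<gamma> * (scale (U + \<gamma>) i * (\<Sum>m=1..i-k. f (i - m) (k + m - 1))
         - scale V k * (\<Sum>m=1..k-i. f (i + m - 1) (k - m))
         - (if i = n then \<Sum>m=1..n-1-k. f (n - m) (k + m) else 0)
         + (if k = n then \<Sum>m=1..n-1-i. f (i + m) (n - m) else 0))"

lemma rhat_cong:
  assumes "i \<in> {1..n}" "k \<in> {1..n}" "\<And>a b. a \<in> {1..n} \<Longrightarrow> b \<in> {1..n} \<Longrightarrow> f a b = g a b"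
  shows "rhat \<gamma> q U V i k f = rhat \<gamma> q U V i k g"
proof -
  have "(\<Sum>m=1..i-k. f (i - m) (k + m - 1)) = (\<Sum>m=1..i-k. g (i - m) (k + m - 1))"
    using assms by (intro sum.cong refl assms) auto
  moreover have "(\<Sum>m=1..k-i. f (i + m - 1) (k - m)) = (\<Sum>m=1..k-i. g (i + m - 1) (k - m))"
    using assms by (intro sum.cong refl assms) auto
  moreover have "(\<Sum>m=1..n-1-k. f (n - m) (k + m)) = (\<Sum>m=1..n-1-k. g (n - m) (k + m))"
    using assms by (intro sum.cong refl assms) auto
  moreover have "(\<Sum>m=1..n-1-i. f (i + m) (n - m)) = (\<Sum>m=1..n-1-i. g (i + m) (n - m))"
    using assms by (intro sum.cong refl assms) auto
  ultimately show ?thesis unfolding rhat_def using assms by simp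
qed

lemma rhat_add: "rhat \<gamma> q U V i k (\<lambda>a b. f a b + g a b) = rhat \<gamma> q U V i k f + rhat \<gamma> q U V i k g"
  by (simp add: rhat_def sum.distrib algebra_simps)

lemma rhat_mult: "rhat \<gamma> q U V i k (\<lambda>a b. c * f a b) = c * rhat \<gamma> q U V i k f"
  by (simp add: rhat_def sum_distrib_left[symmetric] algebra_simps)

lemma rhat_sum: "rhat \<gamma> q U V i k (\<lambda>a b. \<Sum>t\<in>T. f t a b) = (\<Sum>t\<in>T. rhat \<gamma> q U V i k (f t))"
proof (induction T rule: infinite_finite_induct)
  case (insert t T)
  then show ?case by (simp add: rhat_add)
qed (simp_all add: rhat_def)

text \<open>R is an f0-free matrix between diagonal ones: 1 / (U + f0) and 1 / (V - \<gamma> + f0)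
  on the left, U - \<gamma> + f0 and V + f0 on the right, each acting at the index n only. All
  fractions with f0 in R arise in this way.\<close>

lemma rowact_acf_R:
  assumes r: "r \<in> {1..n}" and s: "s \<in> {1..n}"
    and "lamsum n lam + u + f0 \<noteq> 0" "lamsum n lam + v - \<gamma> + f0 \<noteq> 0"
  shows "rowact (acf_R n \<iota> \<gamma> f0 u v lam) r s f
    = scale (1 / (lamsum n lam + u + f0)) r * scale (1 / (lamsum n lam + v - \<gamma> + f0)) s
      * rhat \<gamma> (\<gamma> / (u - v)) (lamsum n lam + u) (lamsum n lam + v) r s
          (\<lambda>a b. scale (lamsum n lam + u - \<gamma> + f0) a * scale (lamsum n lam + v + f0) b * f a b)"
proof -
  have row_e: "rowact (e a b \<otimes> e c d) r s f = (if r = a then if s = c then f b d else 0 else 0)"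
    if "{a, b, c, d} \<subseteq> {1..n}" for a b c d
    using rowact_e[OF that r s] .
  \<comment> \<open>The tests in the other order, for \<open>t8b\<close>, where the outer summation
    index is compared with s.\<close>
  have row_e': "rowact (e a b \<otimes> e c d) r s f = (if s = c then if r = a then f b d else 0 else 0)"
    if "{a, b, c, d} \<subseteq> {1..n}" for a b c d
    using row_e[OF that] by simp
  \<comment> \<open>\<open>t1\<close> to \<open>t13\<close> evaluate the summands of R in the order
    of \<open>acf_R_def\<close>, the eighth in two halves.\<close>
  have t1: "rowact (\<Sum>i=1..n-1. e i i \<otimes> e i i) r s f = (if r = s \<and> r < n then f r r else 0)"
  proof -
    have "rowact (\<Sum>i=1..n-1. e i i \<otimes> e i i) r s f = (\<Sum>i=1..n-1. if r = i then if s = i then f i i else 0 else 0)"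
      unfolding rowact_sum by (intro sum.cong refl row_e) (use r s n_ge_2 in auto)
    also have "\<dots> = (if r = s \<and> r < n then f r r else 0)"
      using r s n_ge_2 by (auto simp: sum_if_const cong: if_cong)
    finally show ?thesis .
  qed
  have t2: "rowact (e n n \<otimes> e n n) r s f = (if r = n \<and> s = n then f n n else 0)"
    using row_e[of n n n n] n_ge_2 by auto
  have t3: "rowact (\<Sum>i=1..n-1. \<Sum>j\<in>{1..n-1}-{i}. e i i \<otimes> e j j) r s f = (if r \<noteq> s \<and> r < n \<and> s < n then f r s else 0)"
  proof -
    have "rowact (\<Sum>i=1..n-1. \<Sum>j\<in>{1..n-1}-{i}. e i i \<otimes> e j j) r s f = (\<Sum>i=1..n-1. \<Sum>j\<in>{1..n-1}-{i}. if r = i then if s = j then f i j else 0 else 0)"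
      unfolding rowact_sum by (intro sum.cong refl row_e) (use r s n_ge_2 in auto)
    also have "\<dots> = (if r \<noteq> s \<and> r < n \<and> s < n then f r s else 0)"
      using r s n_ge_2 by (auto simp: sum_if_const cong: if_cong)
    finally show ?thesis .
  qed
  have t4: "rowact (\<Sum>i=1..n-1. e i i \<otimes> e n n) r s f = (if r < n \<and> s = n then f r n else 0)"
  proof -
    have "rowact (\<Sum>i=1..n-1. e i i \<otimes> e n n) r s f = (\<Sum>i=1..n-1. if r = i then if s = n then f i n else 0 else 0)"
      unfolding rowact_sum by (intro sum.cong refl row_e) (use r s n_ge_2 in auto)
    also have "\<dots> = (if r < n \<and> s = n then f r n else 0)"
      using r s n_ge_2 by (auto simp: sum_if_const cong: if_cong)
    finally show ?thesis .
  qed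
  have t5: "rowact (\<Sum>i=1..n-1. e n n \<otimes> e i i) r s f = (if r = n \<and> s < n then f n s else 0)"
  proof -
    have "rowact (\<Sum>i=1..n-1. e n n \<otimes> e i i) r s f = (\<Sum>i=1..n-1. if r = n then if s = i then f n i else 0 else 0)"
      unfolding rowact_sum by (intro sum.cong refl row_e) (use r s n_ge_2 in auto)
    also have "\<dots> = (if r = n \<and> s < n then f n s else 0)"
      using r s n_ge_2 by (auto simp: sum_if_const cong: if_cong)
    finally show ?thesis .
  qed
  have t6: "rowact (\<Sum>k=1..n-1. \<Sum>j=1..n-k. e n (n - k) \<otimes> e j (j + k - 1)) r s f = (if r = n then \<Sum>m=1..n-s. f (n - m) (s + m - 1) else 0)"
  proof -
    have "rowact (\<Sum>k=1..n-1. \<Sum>j=1..n-k. e n (n - k) \<otimes> e j (j + k - 1)) r s f = (\<Sum>k=1..n-1. \<Sum>j=1..n-k. if r = n then if s = j then f (n - k) (j + k - 1) else 0 else 0)"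
      unfolding rowact_sum by (intro sum.cong refl row_e) (use r s n_ge_2 in auto)
    also have "\<dots> = (if r = n then \<Sum>k=1..n-1. if s \<in> {1..n-k} then f (n - k) (s + k - 1) else 0 else 0)"
      using r s n_ge_2 by (auto simp: sum_if_const cong: if_cong)
    also have "\<dots> = (if r = n then \<Sum>m=1..n-s. f (n - m) (s + m - 1) else 0)"
      using r s sum_triangle_row[of s n "n-1"] by simp
    finally show ?thesis .
  qed
  have t7: "rowact (\<Sum>k=1..n-1. \<Sum>j=1..n-k. e j (j + k - 1) \<otimes> e n (n - k)) r s f = (if s = n then \<Sum>m=1..n-r. f (r + m - 1) (n - m) else 0)"
  proof -
    have "rowact (\<Sum>k=1..n-1. \<Sum>j=1..n-k. e j (j + k - 1) \<otimes> e n (n - k)) r s f = (\<Sum>k=1..n-1. \<Sum>j=1..n-k. if r = j then if s = n then f (j + k - 1) (n - k) else 0 else 0)"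
      unfolding rowact_sum by (intro sum.cong refl row_e) (use r s n_ge_2 in auto)
    also have "\<dots> = (if s = n then \<Sum>k=1..n-1. if r \<in> {1..n-k} then f (r + k - 1) (n - k) else 0 else 0)"
      using r s n_ge_2 by (auto simp: sum_if_const cong: if_cong)
    also have "\<dots> = (if s = n then \<Sum>m=1..n-r. f (r + m - 1) (n - m) else 0)"
      using r s sum_triangle_row[of r n "n-1"] by simp
    finally show ?thesis .
  qed
  have t8a: "rowact (\<Sum>i=1..n-1. \<Sum>k=1..i-1. \<Sum>j=1..i-k. e i (i - k) \<otimes> e j (j + k - 1)) r s f = (if r < n then \<Sum>m=1..r-s. f (r - m) (s + m - 1) else 0)"
  proof -
    have "rowact (\<Sum>i=1..n-1. \<Sum>k=1..i-1. \<Sum>j=1..i-k. e i (i - k) \<otimes> e j (j + k - 1)) r s f = (\<Sum>i=1..n-1. \<Sum>k=1..i-1. \<Sum>j=1..i-k. if r = i then if s = j then f (i - k) (j + k - 1) else 0 else 0)"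
      unfolding rowact_sum by (intro sum.cong refl row_e) (use r s n_ge_2 in auto)
    also have "\<dots> = (if r < n then \<Sum>k=1..r-1. if s \<in> {1..r-k} then f (r - k) (s + k - 1) else 0 else 0)"
      using r s n_ge_2 by (auto simp: sum_if_const cong: if_cong)
    also have "\<dots> = (if r < n then \<Sum>m=1..r-s. f (r - m) (s + m - 1) else 0)"
      using r s sum_triangle_row[of s r "r-1"] by simp
    finally show ?thesis .
  qed
  have t8b: "rowact (\<Sum>i=1..n-1. \<Sum>k=1..i-1. \<Sum>j=1..i-k. e j (j + k - 1) \<otimes> e i (i - k)) r s f = (if s < n then \<Sum>m=1..s-r. f (r + m - 1) (s - m) else 0)"
  proof -
    have "rowact (\<Sum>i=1..n-1. \<Sum>k=1..i-1. \<Sum>j=1..i-k. e j (j + k - 1) \<otimes> e i (i - k)) r s f = (\<Sum>i=1..n-1. \<Sum>k=1..i-1. \<Sum>j=1..i-k. if s = i then if r = j then f (j + k - 1) (i - k) else 0 else 0)"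
      unfolding rowact_sum by (intro sum.cong refl row_e') (use r s n_ge_2 in auto)
    also have "\<dots> = (if s < n then \<Sum>k=1..s-1. if r \<in> {1..s-k} then f (r + k - 1) (s - k) else 0 else 0)"
      using r s n_ge_2 by (auto simp: sum_if_const cong: if_cong)
    also have "\<dots> = (if s < n then \<Sum>m=1..s-r. f (r + m - 1) (s - m) else 0)"
      using r s sum_triangle_row[of r s "s-1"] by simp
    finally show ?thesis .
  qed
  have t9: "rowact (\<Sum>i=1..n-1. \<Sum>j\<in>{1..n-1}-{i}. e i j \<otimes> e j i) r s f = (if r \<noteq> s \<and> r < n \<and> s < n then f s r else 0)"
  proof -
    have "rowact (\<Sum>i=1..n-1. \<Sum>j\<in>{1..n-1}-{i}. e i j \<otimes> e j i) r s f = (\<Sum>i=1..n-1. \<Sum>j\<in>{1..n-1}-{i}. if r = i then if s = j then f j i else 0 else 0)"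
      unfolding rowact_sum by (intro sum.cong refl row_e) (use r s n_ge_2 in auto)
    also have "\<dots> = (if r \<noteq> s \<and> r < n \<and> s < n then f s r else 0)"
      using r s n_ge_2 by (auto simp: sum_if_const cong: if_cong)
    finally show ?thesis .
  qed
  have t10: "rowact (\<Sum>i=1..n-1. e i n \<otimes> e n i) r s f = (if r < n \<and> s = n then f n r else 0)"
  proof -
    have "rowact (\<Sum>i=1..n-1. e i n \<otimes> e n i) r s f = (\<Sum>i=1..n-1. if r = i then if s = n then f n i else 0 else 0)"
      unfolding rowact_sum by (intro sum.cong refl row_e) (use r s n_ge_2 in auto)
    also have "\<dots> = (if r < n \<and> s = n then f n r else 0)"
      using r s n_ge_2 by (auto simp: sum_if_const cong: if_cong)
    finally show ?thesis .
  qed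
  have t11: "rowact (\<Sum>i=1..n-1. e n i \<otimes> e i n) r s f = (if r = n \<and> s < n then f s n else 0)"
  proof -
    have "rowact (\<Sum>i=1..n-1. e n i \<otimes> e i n) r s f = (\<Sum>i=1..n-1. if r = n then if s = i then f i n else 0 else 0)"
      unfolding rowact_sum by (intro sum.cong refl row_e) (use r s n_ge_2 in auto)
    also have "\<dots> = (if r = n \<and> s < n then f s n else 0)"
      using r s n_ge_2 by (auto simp: sum_if_const cong: if_cong)
    finally show ?thesis .
  qed
  have t12: "rowact (\<Sum>i=1..n-1. \<Sum>k=1..n-1-i. e n (n - i) \<otimes> e k (k + i)) r s f = (if r = n then \<Sum>m=1..n-1-s. f (n - m) (s + m) else 0)"
  proof -
    have "rowact (\<Sum>i=1..n-1. \<Sum>k=1..n-1-i. e n (n - i) \<otimes> e k (k + i)) r s f = (\<Sum>i=1..n-1. \<Sum>k=1..n-1-i. if r = n then if s = k then f (n - i) (k + i) else 0 else 0)"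
      unfolding rowact_sum by (intro sum.cong refl row_e) (use r s n_ge_2 in auto)
    also have "\<dots> = (if r = n then \<Sum>k=1..n-1. if s \<in> {1..n-1-k} then f (n - k) (s + k) else 0 else 0)"
      using r s n_ge_2 by (auto simp: sum_if_const cong: if_cong)
    also have "\<dots> = (if r = n then \<Sum>m=1..n-1-s. f (n - m) (s + m) else 0)"
      using r s sum_triangle_row[of s "n-1" "n-1"] by simp
    finally show ?thesis .
  qed
  have t13: "rowact (\<Sum>i=1..n-1. \<Sum>k=1..n-1-i. e k (k + i) \<otimes> e n (n - i)) r s f = (if s = n then \<Sum>m=1..n-1-r. f (r + m) (n - m) else 0)"
  proof -
    have "rowact (\<Sum>i=1..n-1. \<Sum>k=1..n-1-i. e k (k + i) \<otimes> e n (n - i)) r s f = (\<Sum>i=1..n-1. \<Sum>k=1..n-1-i. if r = k then if s = n then f (k + i) (n - i) else 0 else 0)"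
      unfolding rowact_sum by (intro sum.cong refl row_e) (use r s n_ge_2 in auto)
    also have "\<dots> = (if s = n then \<Sum>k=1..n-1. if r \<in> {1..n-1-k} then f (r + k) (n - k) else 0 else 0)"
      using r s n_ge_2 by (auto simp: sum_if_const cong: if_cong)
    also have "\<dots> = (if s = n then \<Sum>m=1..n-1-r. f (r + m) (n - m) else 0)"
      using r s sum_triangle_row[of r "n-1" "n-1"] by simp
    finally show ?thesis .
  qed
  define A where "A = lamsum n lam + u - \<gamma> + f0"
  define B where "B = lamsum n lam + v + f0"
  define C where "C = lamsum n lam + u + f0"
  define D where "D = lamsum n lam + v - \<gamma> + f0"
  define q where "q = \<gamma> / (u - v)"
  have CD: "C \<noteq> 0" "D \<noteq> 0" using assms by (auto simp: C_def D_def)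
  define s1 where "s1 = (\<Sum>m=1..r-s. f (r - m) (s + m - 1))"
  define s2 where "s2 = (\<Sum>m=1..s-r. f (r + m - 1) (s - m))"
  define s3 where "s3 = (\<Sum>m=1..n-1-s. f (n - m) (s + m))"
  define s4 where "s4 = (\<Sum>m=1..n-1-r. f (r + m) (n - m))"
  \<comment> \<open>In these four sums all column indices stay below n, so the inner scalings are 1
    there.\<close>
  have "(\<Sum>m=1..r-s. scale A (r - m) * scale B (s + m - 1) * f (r - m) (s + m - 1)) = s1"
    unfolding s1_def using r s by (intro sum.cong) (auto simp: scale_def)
  moreover have "(\<Sum>m=1..s-r. scale A (r + m - 1) * scale B (s - m) * f (r + m - 1) (s - m)) = s2"
    unfolding s2_def using r s by (intro sum.cong) (auto simp: scale_def)
  moreover have "(\<Sum>m=1..n-1-s. scale A (n - m) * scale B (s + m) * f (n - m) (s + m)) = s3"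
    unfolding s3_def using r s by (intro sum.cong) (auto simp: scale_def)
  moreover have "(\<Sum>m=1..n-1-r. scale A (r + m) * scale B (n - m) * f (r + m) (n - m)) = s4"
    unfolding s4_def using r s by (intro sum.cong) (auto simp: scale_def)
  ultimately have rhat: "rhat \<gamma> q U V r s (\<lambda>a b. scale A a * scale B b * f a b)
    = scale A r * scale B s * f r s + q * (scale A s * scale B r * f s r)
      + \<gamma> * (scale (U + \<gamma>) r * s1 - scale V s * s2
        - (if r = n then s3 else 0) + (if s = n then s4 else 0))" for U V
    by (simp only: rhat_def)
  have V: "lamsum n lam + v - \<gamma> + f0 = D" "lamsum n lam + u - \<gamma> + f0 = A"
    "lamsum n lam + v + f0 = B" "lamsum n lam + u + f0 = C" "\<gamma> / (u - v) = q"
    by (simp_all add: A_def B_def C_def D_def q_def)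
  have t8: "rowact (\<Sum>i=1..n-1. \<Sum>k=1..i-1. \<Sum>j=1..i-k.
       e i (i - k) \<otimes> e j (j + k - 1) - e j (j + k - 1) \<otimes> e i (i - k)) r s f
     = (if r < n then s1 else 0) - (if s < n then s2 else 0)"
    unfolding sum_subtractf rowact_linear t8a t8b s1_def s2_def by simp
  have t6': "rowact (\<Sum>k=1..n-1. \<Sum>j=1..n-k. e n (n - k) \<otimes> e j (j + k - 1)) r s f = (if r = n then s1 else 0)"
    unfolding t6 by (simp add: s1_def)
  have t7': "rowact (\<Sum>k=1..n-1. \<Sum>j=1..n-k. e j (j + k - 1) \<otimes> e n (n - k)) r s f = (if s = n then s2 else 0)"
    unfolding t7 by (simp add: s2_def)
  \<comment> \<open>By truncated subtraction at most one of the first two sums is nonempty, which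
    settles the case r = s = n below.\<close>
  have s12: "r \<le> s \<Longrightarrow> s1 = 0" "s \<le> r \<Longrightarrow> s2 = 0" by (simp_all add: s1_def s2_def)
  have s34: "s = n \<Longrightarrow> s3 = 0" "r = n \<Longrightarrow> s4 = 0" by (simp_all add: s3_def s4_def)
  show ?thesis
    unfolding acf_R_def Let_def rowact_linear t1 t2 t3 t4 t5 t6' t7' t8 t9 t10 t11 t12 t13
      s3_def[symmetric] s4_def[symmetric] V rhat
    using r s CD s12 s34 unfolding scale_def
    by (cases "r = n"; cases "s = n"; cases "r = s") (auto simp: field_simps)
qed

end

section \<open>Divided differences and the action of R on products of \<psi>\<close>

text \<open>\<open>pdd i k x y\<close> is the divided difference
  \<open>(x\<^sup>i\<^sup>-\<^sup>1 y\<^sup>k\<^sup>-\<^sup>1 - x\<^sup>k\<^sup>-\<^sup>1 y\<^sup>i\<^sup>-\<^sup>1) / (x - y)\<close>, written out so that it makes sense at \<open>x = y\<close>.\<close>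

definition pdd1 :: "nat \<Rightarrow> nat \<Rightarrow> complex \<Rightarrow> complex \<Rightarrow> complex" where
  "pdd1 i k x y = (\<Sum>m=1..i-k. x ^ (i - m - 1) * y ^ (k + m - 2))"

definition pdd :: "nat \<Rightarrow> nat \<Rightarrow> complex \<Rightarrow> complex \<Rightarrow> complex" where
  "pdd i k x y = pdd1 i k x y - pdd1 k i y x"

text \<open>Times x - y, consecutive terms of the geometric sum cancel. The bound M is separate from
  i - k so that the induction can keep i fixed.\<close>

lemma pdd1_telescope:
  assumes "k \<ge> 1" "M < i"
  shows "(x - y) * (\<Sum>m=1..M. x ^ (i - m - 1) * y ^ (k + m - 2))
    = x ^ (i - 1) * y ^ (k - 1) - x ^ (i - M - 1) * (y ^ (k + M - 1) :: complex)"
  using assms(2)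
proof (induction M)
  case (Suc M)
  have "x ^ (i - M - 1) = x * x ^ (i - Suc M - 1)"
    using Suc.prems by (simp flip: power_Suc add: Suc_diff_Suc)
  moreover have "y ^ (k + Suc M - 1) = y * y ^ (k + Suc M - 2)"
    using assms(1) by (cases k) (simp_all flip: power_Suc)
  moreover have "k + M - 1 = k + Suc M - 2" by simp
  ultimately show ?case
    using Suc by (simp add: distrib_left algebra_simps)
qed simp

lemma pdd1_eq:
  assumes "k \<ge> 1" "i \<ge> k"
  shows "(x - y) * pdd1 i k x y = x ^ (i - 1) * y ^ (k - 1) - x ^ (k - 1) * y ^ (i - 1)"
proof -
  have "i - (i - k) - 1 = k - 1" "k + (i - k) - 1 = i - 1" using assms by auto
  then show ?thesis
    using pdd1_telescope[of k "i - k" i x y] assms by (simp add: pdd1_def)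
qed

lemma pdd_eq:
  assumes "k \<ge> 1" "i \<ge> 1"
  shows "(x - y) * pdd i k x y = x ^ (i - 1) * y ^ (k - 1) - x ^ (k - 1) * y ^ (i - 1)"
proof (cases "i \<ge> k")
  case True
  then have "pdd1 k i y x = 0" by (simp add: pdd1_def)
  then show ?thesis using pdd1_eq[OF assms(1) True, of x y] by (simp add: pdd_def)
next
  case False
  then have "pdd1 i k x y = 0" by (simp add: pdd1_def)
  then show ?thesis using pdd1_eq[OF assms(2), of k y x] False by (simp add: pdd_def algebra_simps)
qed

lemma sum_split_ends:
  fixes f :: "nat \<Rightarrow> complex"
  shows "(\<Sum>m=1..Suc (Suc N). f m) = f 1 + (\<Sum>m=1..N. f (Suc m)) + f (Suc (Suc N))"
  by (induction N) (simp_all add: add.assoc)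

context labelling begin

text \<open>The divided difference (F(x, y) - F(y, x)) / (x - y) of F(x, y) =
  \<open>\<psi> c i x * \<psi> d k y\<close>, see \<open>\<psi>dd_eq\<close>, expanded by means of
  \<psi>_n = c x^(n-1) - x^n. Being a polynomial it also has a value at x = y, which the diagonal
  columns of A require.\<close>

definition \<psi>dd :: "complex \<Rightarrow> complex \<Rightarrow> nat \<Rightarrow> nat \<Rightarrow> complex \<Rightarrow> complex \<Rightarrow> complex" where
  "\<psi>dd c d i k x y =
    (if i < n \<and> k < n then pdd i k x y
     else if k < n then c * pdd n k x y - pdd (Suc n) k x y
     else if i < n then d * pdd i n x y - pdd i (Suc n) x y
     else (x * y) ^ (n - 1) * (c - d))"

lemma power_n: "(x::complex) ^ n = x * x ^ (n - 1)"
  using n_ge_2 by (cases n) auto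

lemma \<psi>dd_eq:
  assumes "i \<in> {1..n}" "k \<in> {1..n}"
  shows "(x - y) * \<psi>dd c d i k x y = \<psi> c i x * \<psi> d k y - \<psi> c i y * \<psi> d k x"
proof -
  consider "i < n" "k < n" | "i = n" "k < n" | "i < n" "k = n" | "i = n" "k = n"
    using assms by fastforce
  then show ?thesis
  proof cases
    case 1
    then show ?thesis using assms pdd_eq[of k i x y] by (simp add: \<psi>dd_def \<psi>_def)
  next
    case 2
    have "(x - y) * \<psi>dd c d i k x y = c * ((x - y) * pdd n k x y) - (x - y) * pdd (Suc n) k x y"
      using 2 by (simp add: \<psi>dd_def algebra_simps)
    also have "\<dots> = c * (x ^ (n - 1) * y ^ (k - 1) - x ^ (k - 1) * y ^ (n - 1))
      - (x ^ n * y ^ (k - 1) - x ^ (k - 1) * y ^ n)"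
      using 2 assms pdd_eq[of k n x y] pdd_eq[of k "Suc n" x y] by simp
    finally show ?thesis using 2 by (simp add: \<psi>_def power_n algebra_simps)
  next
    case 3
    have "(x - y) * \<psi>dd c d i k x y = d * ((x - y) * pdd i n x y) - (x - y) * pdd i (Suc n) x y"
      using 3 by (simp add: \<psi>dd_def algebra_simps)
    also have "\<dots> = d * (x ^ (i - 1) * y ^ (n - 1) - x ^ (n - 1) * y ^ (i - 1))
      - (x ^ (i - 1) * y ^ n - x ^ n * y ^ (i - 1))"
      using 3 assms pdd_eq[of n i x y] pdd_eq[of "Suc n" i x y] by simp
    finally show ?thesis using 3 by (simp add: \<psi>_def power_n algebra_simps)
  next
    case 4
    then show ?thesis by (simp add: \<psi>dd_def \<psi>_def power_mult_distrib algebra_simps)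
  qed
qed

text \<open>Take i = n and k < n. The inner monomials of the divided difference are products of
  \<psi>'s and occur in \<open>rhat\<close>. Of the two terms with exponent n - 1, x^(n-1) y^(k-1)
  is matched by \<open>\<psi> (U + \<gamma>) n x - \<psi> U n x\<close>, which is \<gamma> x^(n-1),
  and x^(k-1) y^(n-1) by the difference of the exchange terms, whose factor is q (U - V) = \<gamma>.
  The case i < n, k = n is the mirror image.\<close>

lemma rhat_\<psi>:
  assumes ik: "i \<in> {1..n}" "k \<in> {1..n}" and UV: "U \<noteq> V"
  shows "rhat \<gamma> (\<gamma> / (U - V)) U V i k (\<lambda>a b. \<psi> U a x * \<psi> (V + \<gamma>) b y)
    = \<psi> (U + \<gamma>) i x * \<psi> V k y + \<gamma> * \<psi>dd (U + \<gamma>) V i k x y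
      + \<gamma> / (U - V) * (\<psi> (U + \<gamma>) i y * \<psi> V k x)"
proof -
  define q where "q = \<gamma> / (U - V)"
  have qg: "\<gamma> = q * (U - V)" using UV by (simp add: q_def)
  have s1: "(\<Sum>m=1..i-k. \<psi> U (i - m) x * \<psi> (V + \<gamma>) (k + m - 1) y) = pdd1 i k x y"
    unfolding pdd1_def using ik by (intro sum.cong) (auto simp: \<psi>_def numeral_2_eq_2)
  have s2: "(\<Sum>m=1..k-i. \<psi> U (i + m - 1) x * \<psi> (V + \<gamma>) (k - m) y) = pdd1 k i y x"
    unfolding pdd1_def using ik by (intro sum.cong) (auto simp: \<psi>_def numeral_2_eq_2)
  have s3: "(\<Sum>m=1..n-1-k. \<psi> U (n - m) x * \<psi> (V + \<gamma>) (k + m) y)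
    = (\<Sum>m=1..n-1-k. x ^ (n - m - 1) * y ^ (k + m - 1))"
    using ik by (intro sum.cong) (auto simp: \<psi>_def)
  have s4: "(\<Sum>m=1..n-1-i. \<psi> U (i + m) x * \<psi> (V + \<gamma>) (n - m) y)
    = (\<Sum>m=1..n-1-i. x ^ (i + m - 1) * y ^ (n - m - 1))"
    using ik by (intro sum.cong) (auto simp: \<psi>_def)
  \<comment> \<open>The extreme terms are the ones with exponent n - 1; the sum between them is the
    one that \<open>rhat\<close> subtracts.\<close>
  have ends: "pdd1 (Suc n) k x y = x ^ (n - 1) * y ^ (k - 1) + (\<Sum>m=1..n-1-k. x ^ (n - m - 1) * y ^ (k + m - 1))
      + x ^ (k - 1) * y ^ (n - 1)" if "1 \<le> k" "k < n" for k x y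
  proof -
    define N where "N = n - 1 - k"
    have N: "Suc n - k = Suc (Suc N)" "Suc n - Suc (Suc N) - 1 = k - 1" "k + Suc (Suc N) - 2 = n - 1"
      using that by (auto simp: N_def)
    show ?thesis
      unfolding pdd1_def N(1) sum_split_ends N(2,3) N_def[symmetric] by (simp add: numeral_2_eq_2)
  qed
  consider "i < n" "k < n" | "i = n" "k < n" | "i < n" "k = n" | "i = n" "k = n"
    using ik by fastforce
  then show ?thesis
    unfolding rhat_def s1 s2 s3 s4 q_def[symmetric]
  proof cases
    case 1
    then show "\<psi> U i x * \<psi> (V + \<gamma>) k y + q * (\<psi> U k x * \<psi> (V + \<gamma>) i y) +
      \<gamma> * (scale (U + \<gamma>) i * pdd1 i k x y - scale V k * pdd1 k i y x
       - (if i = n then \<Sum>m=1..n-1-k. x ^ (n - m - 1) * y ^ (k + m - 1) else 0)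
       + (if k = n then \<Sum>m=1..n-1-i. x ^ (i + m - 1) * y ^ (n - m - 1) else 0)) =
      \<psi> (U + \<gamma>) i x * \<psi> V k y + \<gamma> * \<psi>dd (U + \<gamma>) V i k x y + q * (\<psi> (U + \<gamma>) i y * \<psi> V k x)"
      by (simp add: \<psi>_def \<psi>dd_def pdd_def scale_def algebra_simps)
  next
    case 2
    have "pdd1 k n y x = 0" "pdd1 k (Suc n) y x = 0" using 2 by (simp_all add: pdd1_def)
    then show "\<psi> U i x * \<psi> (V + \<gamma>) k y + q * (\<psi> U k x * \<psi> (V + \<gamma>) i y) +
      \<gamma> * (scale (U + \<gamma>) i * pdd1 i k x y - scale V k * pdd1 k i y x
       - (if i = n then \<Sum>m=1..n-1-k. x ^ (n - m - 1) * y ^ (k + m - 1) else 0)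
       + (if k = n then \<Sum>m=1..n-1-i. x ^ (i + m - 1) * y ^ (n - m - 1) else 0)) =
      \<psi> (U + \<gamma>) i x * \<psi> V k y + \<gamma> * \<psi>dd (U + \<gamma>) V i k x y + q * (\<psi> (U + \<gamma>) i y * \<psi> V k x)"
      using 2 ik ends[of k x y] by (simp add: \<psi>_def \<psi>dd_def pdd_def scale_def) (simp add: algebra_simps qg)
  next
    case 3
    have "pdd1 i n x y = 0" "pdd1 i (Suc n) x y = 0" using 3 by (simp_all add: pdd1_def)
    moreover have "(\<Sum>m=1..n-1-i. x ^ (i + m - 1) * y ^ (n - m - 1)) = (\<Sum>m=1..n-1-i. y ^ (n - m - 1) * x ^ (i + m - 1))"
      by (simp add: mult.commute)
    ultimately show "\<psi> U i x * \<psi> (V + \<gamma>) k y + q * (\<psi> U k x * \<psi> (V + \<gamma>) i y) +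
      \<gamma> * (scale (U + \<gamma>) i * pdd1 i k x y - scale V k * pdd1 k i y x
       - (if i = n then \<Sum>m=1..n-1-k. x ^ (n - m - 1) * y ^ (k + m - 1) else 0)
       + (if k = n then \<Sum>m=1..n-1-i. x ^ (i + m - 1) * y ^ (n - m - 1) else 0)) =
      \<psi> (U + \<gamma>) i x * \<psi> V k y + \<gamma> * \<psi>dd (U + \<gamma>) V i k x y + q * (\<psi> (U + \<gamma>) i y * \<psi> V k x)"
      using 3 ik ends[of i y x] by (simp add: \<psi>_def \<psi>dd_def pdd_def scale_def) (simp add: algebra_simps qg)
  next
    case 4
    then show "\<psi> U i x * \<psi> (V + \<gamma>) k y + q * (\<psi> U k x * \<psi> (V + \<gamma>) i y) +
      \<gamma> * (scale (U + \<gamma>) i * pdd1 i k x y - scale V k * pdd1 k i y x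
       - (if i = n then \<Sum>m=1..n-1-k. x ^ (n - m - 1) * y ^ (k + m - 1) else 0)
       + (if k = n then \<Sum>m=1..n-1-i. x ^ (i + m - 1) * y ^ (n - m - 1) else 0)) =
      \<psi> (U + \<gamma>) i x * \<psi> V k y + \<gamma> * \<psi>dd (U + \<gamma>) V i k x y + q * (\<psi> (U + \<gamma>) i y * \<psi> V k x)"
      by (simp add: \<psi>_def \<psi>dd_def pdd1_def scale_def) (simp add: algebra_simps power_mult_distrib qg)
  qed
qed


section \<open>The columns of the structure matrices\<close>

lemma sum_w_power:
  assumes "inj_on lam {1..n}" "m < n"
  shows "(\<Sum>j=1..n. w lam j * lam j ^ m) = (if m = n - 1 then 1 else 0)"
  using sum_bary_power[of "{1..n}" lam m] assms by auto

text \<open>\<psi>_n contributes c times the moment 1 minus the moment \<sigma>. For the parameters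
  \<sigma> + v + \<gamma> of b and \<sigma> + v of b^g this gives v + \<gamma> and v, the
  denominators in front of the beta terms of B, C and A.\<close>

lemma sum_w_\<psi>:
  assumes "inj_on lam {1..n}" "i \<in> {1..n}"
  shows "(\<Sum>j=1..n. w lam j * \<psi> c i (lam j)) = (if i = n then c - lamsum n lam else 0)"
proof (cases "i = n")
  case True
  have "(\<Sum>j=1..n. w lam j * \<psi> c i (lam j))
    = c * (\<Sum>j=1..n. w lam j * lam j ^ (n - 1)) - (\<Sum>j=1..n. w lam j * lam j ^ card {1..n})"
    unfolding sum_distrib_left sum_subtractf[symmetric] using True
    by (intro sum.cong) (simp_all add: \<psi>_def power_n algebra_simps)
  also have "\<dots> = c - lamsum n lam"
    using sum_w_power[OF assms(1), of "n - 1"] sum_bary_power_card[OF _ assms(1)] n_ge_2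
    by (simp add: lamsum_def)
  finally show ?thesis using True by simp
next
  case False
  then have "i - 1 < n" "i - 1 \<noteq> n - 1" using assms(2) by auto
  then show ?thesis using False sum_w_power[OF assms(1), of "i - 1"] by (simp add: \<psi>_def)
qed

text \<open>In its last argument \<open>pdd1 i k x\<close> has degree i - 2 \<le> n - 1. The weights
  extract the coefficient of y^(n-1), which is present only for i = n + 1.\<close>

lemma sum_w_pdd1:
  assumes "inj_on lam {1..n}" "1 \<le> k" "i \<le> Suc n" "k \<le> n"
  shows "(\<Sum>j=1..n. w lam j * pdd1 i k x (lam j)) = (if i = Suc n then x ^ (k - 1) else 0)"
proof -
  have "(\<Sum>j=1..n. w lam j * pdd1 i k x (lam j))
    = (\<Sum>m=1..i-k. x ^ (i - m - 1) * (\<Sum>j=1..n. w lam j * lam j ^ (k + m - 2)))"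
    unfolding pdd1_def sum_distrib_left by (subst sum.swap) (simp add: mult_ac)
  also have "\<dots> = (\<Sum>m=1..i-k. if m = Suc n - k then if i = Suc n then x ^ (k - 1) else 0 else 0)"
  proof (rule sum.cong[OF refl])
    fix m assume "m \<in> {1..i-k}"
    then have *: "k + m - 2 < n" "k + m - 2 = n - 1 \<longleftrightarrow> i = Suc n \<and> m = Suc n - k"
      using assms by auto
    then show "x ^ (i - m - 1) * (\<Sum>j=1..n. w lam j * lam j ^ (k + m - 2))
      = (if m = Suc n - k then if i = Suc n then x ^ (k - 1) else 0 else 0)"
      unfolding sum_w_power[OF assms(1) *(1)] using * by auto
  qed
  also have "\<dots> = (if i = Suc n then x ^ (k - 1) else 0)"
    using assms by (auto simp del: sum.delta simp add: sum.delta)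
  finally show ?thesis .
qed

lemma sum_w_pdd1':
  assumes "inj_on lam {1..n}" "1 \<le> i" "k \<le> Suc n" "i \<le> n"
  shows "(\<Sum>j=1..n. w lam j * pdd1 k i (lam j) x) = (if k = Suc n then x ^ (i - 1) else 0)"
proof -
  have "(\<Sum>j=1..n. w lam j * pdd1 k i (lam j) x)
    = (\<Sum>m=1..k-i. x ^ (i + m - 2) * (\<Sum>j=1..n. w lam j * lam j ^ (k - m - 1)))"
    unfolding pdd1_def sum_distrib_left by (subst sum.swap) (simp add: mult_ac)
  also have "\<dots> = (\<Sum>m=1..k-i. if m = 1 then if k = Suc n then x ^ (i - 1) else 0 else 0)"
  proof (rule sum.cong[OF refl])
    fix m assume "m \<in> {1..k-i}"
    then have *: "k - m - 1 < n" "k - m - 1 = n - 1 \<longleftrightarrow> k = Suc n \<and> m = 1"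
      using assms by auto
    then show "x ^ (i + m - 2) * (\<Sum>j=1..n. w lam j * lam j ^ (k - m - 1))
      = (if m = 1 then if k = Suc n then x ^ (i - 1) else 0 else 0)"
      unfolding sum_w_power[OF assms(1) *(1)] using * by (auto simp: numeral_2_eq_2)
  qed
  also have "\<dots> = (if k = Suc n then x ^ (i - 1) else 0)"
    using assms by (auto simp del: sum.delta simp add: sum.delta)
  finally show ?thesis .
qed

text \<open>As a polynomial in y the divided difference has degree at most n - 1, and the weights
  read off the coefficient of y^(n-1). It comes from the leading term -y^n of \<psi>_n(y) divided by
  the leading term -y of x - y. These are the terms that the beta parts of A have to cancel.\<close>

lemma sum_w_\<psi>dd:
  assumes "inj_on lam {1..n}" "i \<in> {1..n}" "k \<in> {1..n}"
  shows "(\<Sum>j=1..n. w lam j * \<psi>dd c d i k x (lam j))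
    = (if k = n then \<psi> c i x else 0) - (if i = n then \<psi> d k x else 0)"
proof -
  have pdd: "(\<Sum>j=1..n. w lam j * pdd i k x (lam j))
    = (if i = Suc n then x ^ (k - 1) else 0) - (if k = Suc n then x ^ (i - 1) else 0)"
    if ik: "1 \<le> i" "1 \<le> k" "i \<le> n \<and> k \<le> n \<or> i = Suc n \<and> k < n \<or> i < n \<and> k = Suc n" for i k
  proof -
    have "pdd1 k i y x = 0" if "k \<le> i" for y using that by (simp add: pdd1_def)
    moreover have "pdd1 i k x y = 0" if "i \<le> k" for y using that by (simp add: pdd1_def)
    moreover consider "i \<le> n" "k \<le> n" | "i = Suc n" "k < n" | "i < n" "k = Suc n"
      using ik by blast
    ultimately show ?thesis
      using sum_w_pdd1[OF assms(1), of k i x] sum_w_pdd1'[OF assms(1), of i k x] ik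
      unfolding pdd_def right_diff_distrib sum_subtractf
      by cases auto
  qed
  consider "i < n" "k < n" | "i = n" "k < n" | "i < n" "k = n" | "i = n" "k = n"
    using assms by fastforce
  then show ?thesis
  proof cases
    case 1
    then show ?thesis using assms pdd[of i k] by (simp add: \<psi>dd_def)
  next
    case 2
    have "(\<Sum>j=1..n. w lam j * \<psi>dd c d i k x (lam j))
      = c * (\<Sum>j=1..n. w lam j * pdd n k x (lam j)) - (\<Sum>j=1..n. w lam j * pdd (Suc n) k x (lam j))"
      unfolding sum_distrib_left sum_subtractf[symmetric] using 2
      by (intro sum.cong) (auto simp: \<psi>dd_def algebra_simps)
    then show ?thesis using 2 assms pdd[of n k] pdd[of "Suc n" k] by (simp add: \<psi>_def)
  next
    case 3
    have "(\<Sum>j=1..n. w lam j * \<psi>dd c d i k x (lam j))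
      = d * (\<Sum>j=1..n. w lam j * pdd i n x (lam j)) - (\<Sum>j=1..n. w lam j * pdd i (Suc n) x (lam j))"
      unfolding sum_distrib_left sum_subtractf[symmetric] using 3
      by (intro sum.cong) (auto simp: \<psi>dd_def algebra_simps)
    then show ?thesis using 3 assms pdd[of i n] pdd[of i "Suc n"] by (simp add: \<psi>_def)
  next
    case 4
    have "(\<Sum>j=1..n. w lam j * \<psi>dd c d i k x (lam j))
      = x ^ (n - 1) * (c - d) * (\<Sum>j=1..n. w lam j * lam j ^ (n - 1))"
      unfolding sum_distrib_left using 4
      by (intro sum.cong) (auto simp: \<psi>dd_def power_mult_distrib algebra_simps)
    then show ?thesis using 4 assms sum_w_power[OF assms(1), of "n - 1"] n_ge_2
      by (simp add: \<psi>_def algebra_simps)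
  qed
qed

lemma sum_remove1: "p \<in> {1..n} \<Longrightarrow> (\<Sum>j\<in>{1..n}-{p}. f j) = (\<Sum>j=1..n. f j) - (f p :: complex)"
  by (simp add: sum.remove)

lemma tensor_diff: "(M - N) \<otimes> K = M \<otimes> K - N \<otimes> K" "M \<otimes> (K - L) = M \<otimes> K - M \<otimes> L"
  by (simp_all add: tensor_def vec_eq_iff algebra_simps)

lemma sum_offdiag_delta:
  assumes "p \<in> {1..n}" "q \<in> {1..n}"
  shows "(\<Sum>i=1..n. \<Sum>j\<in>{1..n}-{i}. if p = i then if q = j then g i j else 0 else 0)
    = (if p = q then 0 else g p q :: complex)"
  using assms by (simp add: sum_if_const)

lemma colact_offdiag:
  assumes "p \<in> {1..n}" "q \<in> {1..n}"
  shows "colact (\<Sum>i=1..n. \<Sum>j\<in>{1..n}-{i}. c i j \<cdot> X i j) p q f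
    = (\<Sum>i=1..n. \<Sum>j\<in>{1..n}-{i}. c i j * colact (X i j) p q f)"
  by (simp add: colact_sum colact_linear)

lemma colact_acf_d:
  assumes "p \<in> {1..n}" "q \<in> {1..n}"
  shows "colact (acf_d n \<iota>) p q f = f q p"
proof -
  have "colact (acf_d n \<iota>) p q f = (\<Sum>i=1..n. \<Sum>j=1..n. if p = j then if q = i then f i j else 0 else 0)"
    unfolding acf_d_def colact_sum by (intro sum.cong refl colact_e) (use assms in auto)
  then show ?thesis using assms by simp
qed

lemma colact_acf_beta:
  assumes "p \<in> {1..n}" "q \<in> {1..n}"
  shows "colact (acf_beta n \<iota>) p q f = (if p = q then \<Sum>j=1..n. f p j else 0)"
proof -
  have "colact (acf_beta n \<iota>) p q f = (\<Sum>i=1..n. \<Sum>j=1..n. if p = i then if q = i then f i j else 0 else 0)"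
    unfolding acf_beta_def colact_sum by (intro sum.cong refl colact_e) (use assms in auto)
  then show ?thesis using assms by (simp add: sum_if_const)
qed

text \<open>Here and in the next two lemmas, a column (p, q) with p \<noteq> q meets only the rows
  (p, q) and (q, p). The diagonal columns of B and A carry a sum over all indices, and this is where
  the moment identities enter.\<close>

lemma colact_acf_Binf:
  assumes p: "p \<in> {1..n}" and q: "q \<in> {1..n}"
  shows "colact (acf_Binf n \<iota> \<gamma> lam) p q f = f p q +
    (if p = q then - (\<Sum>i\<in>{1..n}-{p}. \<gamma> / (lam i - lam p - \<gamma>) * f p i)
     else \<gamma> / (lam q - lam p - \<gamma>) * f p q)"
proof -
  have "(\<Sum>i=1..n. \<Sum>j\<in>{1..n}-{i}. \<gamma> / (lam i - lam j - \<gamma>) * colact (e j j \<otimes> (e i i - e i j)) p q f)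
    = (\<Sum>i=1..n. \<Sum>j\<in>{1..n}-{i}.
      (if q = i then if p = j then \<gamma> / (lam i - lam j - \<gamma>) * f j i else 0 else 0)
      - (if p = j then if p = q then \<gamma> / (lam i - lam p - \<gamma>) * f p i else 0 else 0))"
    using assms by (intro sum.cong refl) (auto simp: tensor_diff colact_linear colact_e)
  also have "\<dots> = (if p = q then 0 else \<gamma> / (lam q - lam p - \<gamma>) * f p q)
    - (\<Sum>i=1..n. if i \<noteq> p then if p = q then \<gamma> / (lam i - lam p - \<gamma>) * f p i else 0 else 0)"
    unfolding sum_subtractf using p q by (subst sum_offdiag_delta) (auto intro!: sum.cong)
  also have "(\<Sum>i=1..n. if i \<noteq> p then if p = q then \<gamma> / (lam i - lam p - \<gamma>) * f p i else 0 else 0)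
    = (if p = q then \<Sum>i\<in>{1..n}-{p}. \<gamma> / (lam i - lam p - \<gamma>) * f p i else 0)"
    by (cases "p = q") (auto intro!: sum.mono_neutral_cong_right cong: if_cong split: if_splits)
  finally show ?thesis
    unfolding acf_Binf_def colact_linear(1) colact_mat1[OF assms] colact_offdiag[OF assms] by simp
qed

lemma colact_acf_Dinf:
  assumes p: "p \<in> {1..n}" and q: "q \<in> {1..n}"
  shows "colact (acf_Dinf n \<iota> \<gamma> lam) p q f = f p q +
    (if p = q then 0 else \<gamma> / (lam q - lam p) * f q p - \<gamma> / (lam p - lam q) * f p q)"
proof -
  have "(\<Sum>i=1..n. \<Sum>j\<in>{1..n}-{i}. \<gamma> / (lam i - lam j) * colact (e i j \<otimes> e j i - e i i \<otimes> e j j) p q f)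
    = (\<Sum>i=1..n. \<Sum>j\<in>{1..n}-{i}.
      (if q = i then if p = j then \<gamma> / (lam i - lam j) * f i j else 0 else 0)
      - (if p = i then if q = j then \<gamma> / (lam i - lam j) * f i j else 0 else 0))"
    using assms by (intro sum.cong refl) (auto simp: colact_linear colact_e)
  also have "\<dots> = (if p = q then 0 else \<gamma> / (lam q - lam p) * f q p - \<gamma> / (lam p - lam q) * f p q)"
    unfolding sum_subtractf sum_offdiag_delta[OF p q] sum_offdiag_delta[OF q p] by auto
  finally show ?thesis
    unfolding acf_Dinf_def colact_linear(1) colact_mat1[OF assms] colact_offdiag[OF assms] by simp
qed

lemma colact_acf_Ainf:
  assumes p: "p \<in> {1..n}" and q: "q \<in> {1..n}"
  shows "colact (acf_Ainf n \<iota> \<gamma> lam) p q f = f p q +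
    (if p = q then - (\<Sum>j\<in>{1..n}-{p}. \<gamma> / (lam p - lam j) * (f p j - f j p))
     else \<gamma> / (lam q - lam p) * f q p + \<gamma> / (lam p - lam q) * f p q)"
proof -
  have "(\<Sum>i=1..n. \<Sum>j\<in>{1..n}-{i}. \<gamma> / (lam i - lam j) * colact ((e i i - e i j) \<otimes> (e j j - e j i)) p q f)
    = (\<Sum>i=1..n. \<Sum>j\<in>{1..n}-{i}.
      (if p = i then if q = j then \<gamma> / (lam i - lam j) * f i j else 0 else 0)
      + (if q = i then if p = j then \<gamma> / (lam i - lam j) * f i j else 0 else 0)
      - ((if p = i then if p = q then \<gamma> / (lam p - lam j) * f p j else 0 else 0)
      + (if p = j then if p = q then \<gamma> / (lam i - lam p) * f i p else 0 else 0)))"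
    using assms by (intro sum.cong refl) (auto simp: tensor_diff colact_linear colact_e algebra_simps)
  also have "\<dots> = (if p = q then 0 else \<gamma> / (lam q - lam p) * f q p + \<gamma> / (lam p - lam q) * f p q)
    - ((\<Sum>i=1..n. if p = i then \<Sum>j\<in>{1..n}-{i}. if p = q then \<gamma> / (lam p - lam j) * f p j else 0 else 0)
     + (\<Sum>i=1..n. if i \<noteq> p then if p = q then \<gamma> / (lam i - lam p) * f i p else 0 else 0))"
    unfolding sum_subtractf sum.distrib sum_offdiag_delta[OF p q] sum_offdiag_delta[OF q p] sum_if_const
    using p q by (auto intro!: sum.cong)
  also have "(\<Sum>i=1..n. if i \<noteq> p then if p = q then \<gamma> / (lam i - lam p) * f i p else 0 else 0)
    = (if p = q then \<Sum>j\<in>{1..n}-{p}. \<gamma> / (lam j - lam p) * f j p else 0)"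
    by (cases "p = q") (auto intro!: sum.mono_neutral_cong_right cong: if_cong split: if_splits)
  also have "(\<Sum>j\<in>{1..n}-{p}. \<gamma> / (lam j - lam p) * f j p) = - (\<Sum>j\<in>{1..n}-{p}. \<gamma> / (lam p - lam j) * f j p)"
    unfolding sum_negf[symmetric]
    by (intro sum.cong refl) (metis minus_diff_eq minus_divide_right mult_minus_left)
  finally show ?thesis
    unfolding acf_Ainf_def colact_linear(1) colact_mat1[OF assms] colact_offdiag[OF assms]
    using p by (simp add: right_diff_distrib sum_subtractf)
qed


section \<open>The intertwining relations for B, C, A and D\<close>

text \<open>The value at \<open>(x, y)\<close> of
  \<open>F + \<gamma> (F - F') / (x - y) + \<gamma> / (U - V) F'\<close>, where \<open>F(x, y) = \<psi>\<^sub>i(x) \<psi>\<^sub>k(y)\<close> with parameters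
  \<open>U + \<gamma>\<close> and \<open>V\<close>, and \<open>F'(x, y) = F(y, x)\<close>.\<close>

definition T :: "complex \<Rightarrow> complex \<Rightarrow> complex \<Rightarrow> nat \<Rightarrow> nat \<Rightarrow> complex \<Rightarrow> complex \<Rightarrow> complex" where
  "T \<gamma> U V i k x y = \<psi> (U + \<gamma>) i x * \<psi> V k y + \<gamma> * \<psi>dd (U + \<gamma>) V i k x y
      + \<gamma> / (U - V) * (\<psi> (U + \<gamma>) i y * \<psi> V k x)"

lemma in2_in1_nth:
  assumes "i \<in> {1..n}" "k \<in> {1..n}" "a \<in> {1..n}" "b \<in> {1..n}"
  shows "(in2 N ** in1 M) $ (\<iota> i, \<iota> k) $ (\<iota> a, \<iota> b) = M $ \<iota> i $ \<iota> a * N $ \<iota> k $ \<iota> b"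
proof -
  have "(in2 N ** in1 M) $ (\<iota> i, \<iota> k) $ (\<iota> a, \<iota> b)
    = (\<Sum>c=1..n. \<Sum>d=1..n. if i = c then if d = b then M $ \<iota> i $ \<iota> a * N $ \<iota> k $ \<iota> b else 0 else 0)"
    unfolding mult_nth_rowact rowact_def using assms by (intro sum.cong refl) auto
  then show ?thesis using assms by (simp add: sum_if_const)
qed

lemma in1_in2_nth:
  assumes "i \<in> {1..n}" "k \<in> {1..n}" "a \<in> {1..n}" "b \<in> {1..n}"
  shows "(in1 M ** in2 N) $ (\<iota> i, \<iota> k) $ (\<iota> a, \<iota> b) = M $ \<iota> i $ \<iota> a * N $ \<iota> k $ \<iota> b"
proof -
  have "(in1 M ** in2 N) $ (\<iota> i, \<iota> k) $ (\<iota> a, \<iota> b)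
    = (\<Sum>c=1..n. \<Sum>d=1..n. if c = a then if k = d then M $ \<iota> i $ \<iota> a * N $ \<iota> k $ \<iota> b else 0 else 0)"
    unfolding mult_nth_rowact rowact_def using assms by (intro sum.cong refl) auto
  then show ?thesis using assms by (simp add: sum_if_const)
qed

lemma in2_dyn1_nth:
  assumes "i \<in> {1..n}" "k \<in> {1..n}" "a \<in> {1..n}" "b \<in> {1..n}"
  shows "(in2 N ** dyn1 n \<iota> \<gamma> M lam) $ (\<iota> i, \<iota> k) $ (\<iota> a, \<iota> b)
    = M (lamshift \<gamma> lam b) $ \<iota> i $ \<iota> a * N $ \<iota> k $ \<iota> b"
proof -
  have "(in2 N ** dyn1 n \<iota> \<gamma> M lam) $ (\<iota> i, \<iota> k) $ (\<iota> a, \<iota> b)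
    = (\<Sum>c=1..n. \<Sum>d=1..n. if i = c then if d = b then M (lamshift \<gamma> lam b) $ \<iota> i $ \<iota> a * N $ \<iota> k $ \<iota> b else 0 else 0)"
    unfolding mult_nth_rowact rowact_def using assms by (intro sum.cong refl) auto
  then show ?thesis using assms by (simp add: sum_if_const)
qed

lemma in1_dyn2_nth:
  assumes "i \<in> {1..n}" "k \<in> {1..n}" "a \<in> {1..n}" "b \<in> {1..n}"
  shows "(in1 M ** dyn2 n \<iota> \<gamma> N lam) $ (\<iota> i, \<iota> k) $ (\<iota> a, \<iota> b)
    = M $ \<iota> i $ \<iota> a * N (lamshift \<gamma> lam a) $ \<iota> k $ \<iota> b"
proof -
  have "(in1 M ** dyn2 n \<iota> \<gamma> N lam) $ (\<iota> i, \<iota> k) $ (\<iota> a, \<iota> b)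
    = (\<Sum>c=1..n. \<Sum>d=1..n. if c = a then if k = d then M $ \<iota> i $ \<iota> a * N (lamshift \<gamma> lam a) $ \<iota> k $ \<iota> b else 0 else 0)"
    unfolding mult_nth_rowact rowact_def using assms by (intro sum.cong refl) auto
  then show ?thesis using assms by (simp add: sum_if_const)
qed

lemma acf_bg_nth:
  assumes "i \<in> {1..n}" "j \<in> {1..n}"
  shows "acf_bg n \<iota> \<gamma> f0 u lam $ \<iota> i $ \<iota> j
    = scale (1 / (lamsum n lam + u - \<gamma> + f0)) i * \<psi> (lamsum n lam + u) i (lam j) * w lam j"
  unfolding acf_bg_def acf_b_nth[OF assms] by (simp add: algebra_simps)

lemma lamsum_shift: "p \<in> {1..n} \<Longrightarrow> lamsum n (lamshift \<gamma> lam p) = lamsum n lam + \<gamma>"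
  unfolding lamsum_def lamshift_def by (subst (1 2) sum.remove[of _ p]) (auto intro!: sum.cong)

text \<open>The shift raises \<sigma> by \<gamma> and thus undoes the passage from u to u -
  \<gamma>: row factor and parameter are those of b(u; \<lambda>) again, and only nodes and weights
  differ.\<close>

lemma acf_bg_shift_nth:
  assumes "i \<in> {1..n}" "j \<in> {1..n}" "p \<in> {1..n}"
  shows "acf_bg n \<iota> \<gamma> f0 u (lamshift \<gamma> lam p) $ \<iota> i $ \<iota> j
    = scale (1 / (lamsum n lam + u + f0)) i * \<psi> (lamsum n lam + u + \<gamma>) i (lamshift \<gamma> lam p j)
      * w (lamshift \<gamma> lam p) j"
  unfolding acf_bg_nth[OF assms(1,2)] lamsum_shift[OF assms(3)] by (simp add: algebra_simps)

lemma w_shift_neq: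
  assumes "inj_on lam {1..n}" "nonres n \<gamma> lam" "p \<in> {1..n}" "q \<in> {1..n}" "p \<noteq> q"
  shows "w (lamshift \<gamma> lam p) q = w lam q * ((lam q - lam p) / (lam q - lam p - \<gamma>))"
proof -
  have "lam q - lam p \<noteq> 0" using inj_on_eq_iff[OF assms(1,4,3)] assms(5) by simp
  moreover have "(\<Prod>a\<in>{1..n} - {q} - {p}. lam q - lamshift \<gamma> lam p a) = (\<Prod>a\<in>{1..n} - {q} - {p}. lam q - lam a)"
    by (intro prod.cong) (auto simp: lamshift_def)
  ultimately show ?thesis
    unfolding bary_def using assms
    by (subst (1 2) prod.remove[of _ p]) (auto simp: lamshift_def diff_diff_eq)
qed

text \<open>Adjoin the node z = \<lambda>_p + \<gamma>. The divided difference of \<psi>_k, of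
  degree at most n, over the n + 1 nodes is its coefficient of x^n; solving for the term at z and
  multiplying by \<gamma> gives the claim. This is the partial fraction decomposition in the form
  needed for B.\<close>

lemma w_shift_same:
  assumes "inj_on lam {1..n}" "nonres n \<gamma> lam" "\<gamma> \<noteq> 0" "p \<in> {1..n}" "k \<in> {1..n}"
  shows "w (lamshift \<gamma> lam p) p * \<psi> c k (lam p + \<gamma>)
    = w lam p * \<psi> c k (lam p) - (\<Sum>j\<in>{1..n}-{p}. \<gamma> / (lam j - lam p - \<gamma>) * (w lam j * \<psi> c k (lam j)))
      - (if k = n then \<gamma> else 0)"
proof -
  define z where "z = lam p + \<gamma>"
  \<comment> \<open>The index 0 lies outside {1..n} and is free to carry the new node.\<close>
  define x where "x = lam(0 := z)"
  have nz: "z \<noteq> lam j" if "j \<in> {1..n}" for j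
  proof (cases "j = p")
    case False
    then have "lam j - lam p \<noteq> \<gamma>" using assms(2,4) that by (auto simp: nonres_def)
    then show ?thesis unfolding z_def by (metis add_diff_cancel_left')
  qed (simp add: z_def assms(3))
  have xj: "x 0 = z" "j \<in> {1..n} \<Longrightarrow> x j = lam j" for j by (auto simp: x_def)
  have inj: "inj_on x (insert 0 {1..n})"
  proof -
    have "inj_on x {1..n} = inj_on lam {1..n}" by (rule inj_on_cong) (simp add: x_def)
    moreover have "x 0 \<notin> x ` {1..n}"
    proof
      assume "x 0 \<in> x ` {1..n}"
      then obtain j where "j \<in> {1..n}" "x 0 = x j" by blast
      then show False using nz[of j] by (simp add: x_def split: if_splits)
    qed
    ultimately show ?thesis using assms(1) by simp
  qed
  have wj: "bary (insert 0 {1..n}) x j = w lam j / (lam j - z)" if "j \<in> {1..n}" for j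
  proof -
    have "bary (insert 0 {1..n}) x j * (lam j - z) = bary {1..n} x j"
      using bary_insert[of "{1..n}" j 0 x] that nz[OF that] by (auto simp: x_def)
    also have "\<dots> = w lam j" using that by (intro bary_cong) (auto simp: x_def)
    finally show ?thesis using nz[OF that] by (simp add: field_simps)
  qed
  \<comment> \<open>The product over all old nodes has the extra factor z - \<lambda>_p = \<gamma>
    compared with the weight of the shifted point.\<close>
  have w0: "bary (insert 0 {1..n}) x 0 = w (lamshift \<gamma> lam p) p / \<gamma>"
  proof -
    have "(\<Prod>a\<in>{1..n}. x 0 - x a) = (z - lam p) * (\<Prod>a\<in>{1..n}-{p}. z - lam a)"
      using assms(4) by (subst prod.remove[of _ p]) (auto simp: x_def intro!: prod.cong)
    moreover have "insert 0 {1..n} - {0} = {1..n}" by auto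
    moreover have "(\<Prod>a\<in>{1..n}-{p}. lamshift \<gamma> lam p p - lamshift \<gamma> lam p a) = (\<Prod>a\<in>{1..n}-{p}. z - lam a)"
      by (intro prod.cong) (auto simp: lamshift_def z_def)
    ultimately show ?thesis using assms(3) unfolding bary_def by (simp add: z_def)
  qed
  \<comment> \<open>The value -1 is the leading coefficient of \<psi>_n.\<close>
  have total: "(\<Sum>j\<in>insert 0 {1..n}. bary (insert 0 {1..n}) x j * \<psi> c k (x j)) = (if k = n then - 1 else 0)"
  proof -
    have card: "card (insert 0 {1..n}) = Suc n" by simp
    have pow: "(\<Sum>j\<in>insert 0 {1..n}. bary (insert 0 {1..n}) x j * x j ^ m) = (if m = n then 1 else 0)"
      if "m \<le> n" for m
      using sum_bary_power[OF _ inj, of m] that unfolding card by simp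
    show ?thesis
    proof (cases "k = n")
      case True
      have "(\<Sum>j\<in>insert 0 {1..n}. bary (insert 0 {1..n}) x j * \<psi> c k (x j))
        = c * (\<Sum>j\<in>insert 0 {1..n}. bary (insert 0 {1..n}) x j * x j ^ (n - 1))
          - (\<Sum>j\<in>insert 0 {1..n}. bary (insert 0 {1..n}) x j * x j ^ n)"
        unfolding sum_distrib_left sum_subtractf[symmetric] using True
        by (intro sum.cong) (simp_all add: \<psi>_def power_n algebra_simps)
      then show ?thesis using True pow[of "n-1"] pow[of n] n_ge_2 by simp
    next
      case False
      then show ?thesis using pow[of "k-1"] assms(5) by (auto simp: \<psi>_def)
    qed
  qed
  have "(\<Sum>j\<in>insert 0 {1..n}. bary (insert 0 {1..n}) x j * \<psi> c k (x j))
    = w (lamshift \<gamma> lam p) p / \<gamma> * \<psi> c k z + (\<Sum>j=1..n. w lam j / (lam j - z) * \<psi> c k (lam j))"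
  proof -
    have "(\<Sum>j=1..n. bary (insert 0 {1..n}) x j * \<psi> c k (x j)) = (\<Sum>j=1..n. w lam j / (lam j - z) * \<psi> c k (lam j))"
      by (intro sum.cong refl) (simp only: wj xj)
    then show ?thesis using w0 xj(1) by simp
  qed
  also have "(\<Sum>j=1..n. w lam j / (lam j - z) * \<psi> c k (lam j))
    = w lam p / (- \<gamma>) * \<psi> c k (lam p) + (\<Sum>j\<in>{1..n}-{p}. w lam j / (lam j - z) * \<psi> c k (lam j))"
    using assms(4) by (subst sum.remove[of _ p]) (auto simp: z_def)
  finally have "w (lamshift \<gamma> lam p) p / \<gamma> * \<psi> c k z
    = (if k = n then - 1 else 0) + w lam p / \<gamma> * \<psi> c k (lam p)
      - (\<Sum>j\<in>{1..n}-{p}. w lam j / (lam j - z) * \<psi> c k (lam j))"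
    unfolding total by (simp add: algebra_simps)
  then have "\<gamma> * (w (lamshift \<gamma> lam p) p / \<gamma> * \<psi> c k z)
    = \<gamma> * ((if k = n then - 1 else 0) + w lam p / \<gamma> * \<psi> c k (lam p)
      - (\<Sum>j\<in>{1..n}-{p}. w lam j / (lam j - z) * \<psi> c k (lam j)))" by simp
  moreover have "\<gamma> * (\<Sum>j\<in>{1..n}-{p}. w lam j / (lam j - z) * \<psi> c k (lam j))
    = (\<Sum>j\<in>{1..n}-{p}. \<gamma> / (lam j - lam p - \<gamma>) * (w lam j * \<psi> c k (lam j)))"
    unfolding sum_distrib_left by (intro sum.cong) (simp_all add: z_def diff_diff_eq)
  ultimately show ?thesis
    using assms(3) by (simp add: z_def algebra_simps)
qed

lemma in2_mult_nth:
  assumes "i \<in> {1..n}" "k \<in> {1..n}" "p \<in> {1..n}" "q \<in> {1..n}"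
  shows "(in2 N ** X) $ (\<iota> i, \<iota> k) $ (\<iota> p, \<iota> q)
    = colact X p q (\<lambda>a b. if i = a then N $ \<iota> k $ \<iota> b else 0)"
  unfolding mult_nth_colact using assms by (intro colact_cong) auto

text \<open>Off the diagonal, the coefficient 1 + \<gamma> / (\<lambda>_q - \<lambda>_p - \<gamma>)
  is the ratio of the shifted weight to the old one. On the diagonal, \<open>acf_Binf\<close>
  supplies the sum in \<open>w_shift_same\<close>, and the beta term supplies its correction
  -\<gamma> for k = n.\<close>

lemma in2_b_mult_B:
  assumes "inj_on lam {1..n}" "nonres n \<gamma> lam" "\<gamma> \<noteq> 0" "v + \<gamma> \<noteq> 0"
  shows "in2 (acf_b n \<iota> \<gamma> f0 v lam) ** acf_B n \<iota> \<gamma> v lam = dyn2 n \<iota> \<gamma> (acf_bg n \<iota> \<gamma> f0 v) lam"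
proof (rule mat2_eqI)
  fix i k p q assume ik: "i \<in> {1..n}" "k \<in> {1..n}" "p \<in> {1..n}" "q \<in> {1..n}"
  define \<sigma> where "\<sigma> = lamsum n lam"
  define s where "s = scale (1 / (\<sigma> + v + f0)) k"
  define F where "F b = w lam b * \<psi> (\<sigma> + v + \<gamma>) k (lam b)" for b
  have b: "acf_b n \<iota> \<gamma> f0 v lam $ \<iota> k $ \<iota> b = s * F b" if "b \<in> {1..n}" for b
    using acf_b_nth[OF ik(2) that] by (simp add: s_def F_def \<sigma>_def)
  have bs: "acf_bg n \<iota> \<gamma> f0 v (lamshift \<gamma> lam p) $ \<iota> k $ \<iota> q
      = s * (w (lamshift \<gamma> lam p) q * \<psi> (\<sigma> + v + \<gamma>) k (lamshift \<gamma> lam p q))"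
    using acf_bg_shift_nth[OF ik(2,4,3)] by (simp add: s_def \<sigma>_def)
  have "(in2 (acf_b n \<iota> \<gamma> f0 v lam) ** acf_B n \<iota> \<gamma> v lam) $ (\<iota> i, \<iota> k) $ (\<iota> p, \<iota> q)
    = colact (acf_B n \<iota> \<gamma> v lam) p q (\<lambda>a b. if i = a then s * F b else 0)"
    unfolding in2_mult_nth[OF ik] by (rule colact_cong) (simp add: b)
  also have "\<dots> = (if i = p then s * (if p = q
      then F p - (\<Sum>j\<in>{1..n}-{p}. \<gamma> / (lam j - lam p - \<gamma>) * F j) - \<gamma> / (v + \<gamma>) * (\<Sum>j=1..n. F j)
      else (1 + \<gamma> / (lam q - lam p - \<gamma>)) * F q) else 0)"
    unfolding acf_B_def colact_linear colact_acf_Binf[OF ik(3,4)] colact_acf_beta[OF ik(3,4)]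
    by (simp add: sum_distrib_left sum_divide_distrib algebra_simps)
  also have "\<dots> = (if i = p then acf_bg n \<iota> \<gamma> f0 v (lamshift \<gamma> lam p) $ \<iota> k $ \<iota> q else 0)"
  proof (cases "p = q")
    case True
    have "(\<Sum>j=1..n. F j) = (if k = n then v + \<gamma> else 0)"
      using sum_w_\<psi>[OF assms(1) ik(2), of "\<sigma> + v + \<gamma>"] by (simp add: F_def \<sigma>_def)
    then have "\<gamma> / (v + \<gamma>) * (\<Sum>j=1..n. F j) = (if k = n then \<gamma> else 0)"
      using assms(4) by simp
    moreover have "w (lamshift \<gamma> lam p) p * \<psi> (\<sigma> + v + \<gamma>) k (lamshift \<gamma> lam p p)
      = F p - (\<Sum>j\<in>{1..n}-{p}. \<gamma> / (lam j - lam p - \<gamma>) * F j) - (if k = n then \<gamma> else 0)"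
      using w_shift_same[OF assms(1-3) ik(3,2), of "\<sigma> + v + \<gamma>"] by (simp add: F_def lamshift_def)
    ultimately show ?thesis unfolding bs using True by simp
  next
    case False
    have "lam q - lam p - \<gamma> \<noteq> 0" using False ik assms(2) by (auto simp: nonres_def)
    then have "1 + \<gamma> / (lam q - lam p - \<gamma>) = (lam q - lam p) / (lam q - lam p - \<gamma>)"
      by (simp add: field_simps)
    moreover have "lamshift \<gamma> lam p q = lam q" using False by (simp add: lamshift_def)
    ultimately show ?thesis
      unfolding bs using False w_shift_neq[OF assms(1,2) ik(3,4) False] by (simp add: F_def)
  qed
  finally show "(in2 (acf_b n \<iota> \<gamma> f0 v lam) ** acf_B n \<iota> \<gamma> v lam) $ (\<iota> i, \<iota> k) $ (\<iota> p, \<iota> q)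
    = dyn2 n \<iota> \<gamma> (acf_bg n \<iota> \<gamma> f0 v) lam $ (\<iota> i, \<iota> k) $ (\<iota> p, \<iota> q)"
    using ik by simp
qed

lemma flip_nth: "flip X $ (a, b) $ (c, d) = X $ (b, a) $ (d, c)"
  by (simp add: flip_def)

lemma flip_mult:
  fixes X Y :: "complex^('n \<times> 'n)^('n \<times> 'n)"
  shows "flip (X ** Y) = flip X ** flip Y"
proof (rule mat2_eqI)
  fix i k p q
  show "flip (X ** Y) $ (\<iota> i, \<iota> k) $ (\<iota> p, \<iota> q) = (flip X ** flip Y) $ (\<iota> i, \<iota> k) $ (\<iota> p, \<iota> q)"
    unfolding flip_nth mult_nth_rowact rowact_def by (subst sum.swap) simp
qed

lemma flip_flip: "flip (flip X) = X"
  by (simp add: flip_def)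

lemma flip_in2: "flip (in2 M :: complex^('n \<times> 'n)^('n \<times> 'n)) = in1 M"
  by (rule mat2_eqI) (simp add: flip_nth)

lemma flip_dyn2: "flip (dyn2 n \<iota> \<gamma> M lam) = dyn1 n \<iota> \<gamma> M lam"
  by (rule mat2_eqI) (simp add: flip_nth)

lemma in1_b_mult_C:
  assumes "inj_on lam {1..n}" "nonres n \<gamma> lam" "\<gamma> \<noteq> 0" "u + \<gamma> \<noteq> 0"
  shows "in1 (acf_b n \<iota> \<gamma> f0 u lam) ** acf_C n \<iota> \<gamma> u lam = dyn1 n \<iota> \<gamma> (acf_bg n \<iota> \<gamma> f0 u) lam"
  unfolding acf_C_def flip_in2[symmetric] flip_dyn2[symmetric] flip_mult[symmetric] in2_b_mult_B[OF assms] ..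

text \<open>The row factors of b^g_1 and b_2 cancel the right scalings of R, and the left scalings
  of R are the row factors of b_1 and b^g_2, so f0 drops out. With x, y free and c, d in place of
  the weights, the formula serves A and D alike.\<close>

lemma rowact_R_\<psi>:
  assumes ik: "i \<in> {1..n}" "k \<in> {1..n}" and "u \<noteq> v"
    and nz: "lamsum n lam + u + f0 \<noteq> 0" "lamsum n lam + v - \<gamma> + f0 \<noteq> 0"
      "lamsum n lam + u - \<gamma> + f0 \<noteq> 0" "lamsum n lam + v + f0 \<noteq> 0"
  shows "rowact (acf_R n \<iota> \<gamma> f0 u v lam) i k (\<lambda>a b.
      (scale (1 / (lamsum n lam + u - \<gamma> + f0)) a * \<psi> (lamsum n lam + u) a x * c)
      * (scale (1 / (lamsum n lam + v + f0)) b * \<psi> (lamsum n lam + v + \<gamma>) b y * d))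
    = scale (1 / (lamsum n lam + u + f0)) i * scale (1 / (lamsum n lam + v - \<gamma> + f0)) k
      * (c * d) * T \<gamma> (lamsum n lam + u) (lamsum n lam + v) i k x y"
proof -
  define U V where UV: "U = lamsum n lam + u" "V = lamsum n lam + v"
  have "U \<noteq> V" "u - v = U - V" using \<open>u \<noteq> v\<close> by (auto simp: UV)
  have "scale s a * scale (1 / s) a = 1" if "s \<noteq> 0" for s a using that by (simp add: scale_def)
  note scale_inv = this[OF nz(3), folded UV] this[OF nz(4), folded UV]
  have "scale (U - \<gamma> + f0) a * scale (V + f0) b *
      ((scale (1 / (U - \<gamma> + f0)) a * \<psi> U a x * c) * (scale (1 / (V + f0)) b * \<psi> (V + \<gamma>) b y * d))
    = (scale (U - \<gamma> + f0) a * scale (1 / (U - \<gamma> + f0)) a) * (scale (V + f0) b * scale (1 / (V + f0)) b)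
      * ((c * d) * (\<psi> U a x * \<psi> (V + \<gamma>) b y))" for a b
    by (simp only: mult_ac)
  then have *: "scale (U - \<gamma> + f0) a * scale (V + f0) b *
      ((scale (1 / (U - \<gamma> + f0)) a * \<psi> U a x * c) * (scale (1 / (V + f0)) b * \<psi> (V + \<gamma>) b y * d))
    = (c * d) * (\<psi> U a x * \<psi> (V + \<gamma>) b y)" for a b
    unfolding scale_inv by simp
  show ?thesis
    unfolding rowact_acf_R[OF ik nz(1,2)] UV[symmetric] * rhat_mult \<open>u - v = U - V\<close>
      rhat_\<psi>[OF ik \<open>U \<noteq> V\<close>] T_def by simp
qed

text \<open>Up to row factors and weights both sides are T at (\<lambda>_p, \<lambda>_q). For p
  \<noteq> q the coefficients \<gamma> / (\<lambda>_p - \<lambda>_q) form the divided difference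
  directly. For p = q its confluent value has to emerge from a sum over j \<noteq> p.\<close>

lemma A_intertwines:
  assumes inj: "inj_on lam {1..n}" and "u \<noteq> v" "u + \<gamma> \<noteq> 0" "v \<noteq> 0"
    and nz: "lamsum n lam + u + f0 \<noteq> 0" "lamsum n lam + v - \<gamma> + f0 \<noteq> 0"
      "lamsum n lam + u - \<gamma> + f0 \<noteq> 0" "lamsum n lam + v + f0 \<noteq> 0"
  shows "in2 (acf_bg n \<iota> \<gamma> f0 v lam) ** in1 (acf_b n \<iota> \<gamma> f0 u lam) ** acf_A n \<iota> \<gamma> u v lam
    = acf_R n \<iota> \<gamma> f0 u v lam ** (in1 (acf_bg n \<iota> \<gamma> f0 u lam) ** in2 (acf_b n \<iota> \<gamma> f0 v lam))"
proof (rule mat2_eqI)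
  fix i k p q assume ik: "i \<in> {1..n}" "k \<in> {1..n}" and pq: "p \<in> {1..n}" "q \<in> {1..n}"
  define U V where UV: "U = lamsum n lam + u" "V = lamsum n lam + v"
  define s where "s = scale (1 / (U + f0)) i * scale (1 / (V - \<gamma> + f0)) k"
  define F where "F x y = \<psi> (U + \<gamma>) i x * \<psi> V k y" for x y
  define Q where "Q x y = \<psi>dd (U + \<gamma>) V i k x y" for x y
  define f where "f a b = F (lam a) (lam b) * (w lam a * w lam b)" for a b
  have uv: "u - v = U - V" by (simp add: UV)
  have Q: "(x - y) * Q x y = F x y - F y x" for x y
    unfolding Q_def F_def by (rule \<psi>dd_eq[OF ik])
  have "(in2 (acf_bg n \<iota> \<gamma> f0 v lam) ** in1 (acf_b n \<iota> \<gamma> f0 u lam) ** acf_A n \<iota> \<gamma> u v lam)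
      $ (\<iota> i, \<iota> k) $ (\<iota> p, \<iota> q)
    = colact (acf_A n \<iota> \<gamma> u v lam) p q (\<lambda>a b. s * f a b)"
    unfolding mult_nth_colact[of _ "acf_A n \<iota> \<gamma> u v lam"]
    using ik by (intro colact_cong) (simp add: in2_in1_nth acf_b_nth acf_bg_nth s_def f_def F_def UV mult_ac)
  also have "\<dots> = s * colact (acf_A n \<iota> \<gamma> u v lam) p q f"
    unfolding colact_def by (simp add: sum_distrib_left mult_ac)
  also have "colact (acf_A n \<iota> \<gamma> u v lam) p q f = w lam p * w lam q * T \<gamma> U V i k (lam p) (lam q)"
  proof (cases "p = q")
    case False
    then have "lam p \<noteq> lam q" using inj_on_eq_iff[OF inj pq] False by simp
    then have Q': "Q (lam p) (lam q) = (F (lam p) (lam q) - F (lam q) (lam p)) / (lam p - lam q)"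
      using Q[of "lam p" "lam q"] by (simp add: field_simps)
    have neg: "\<gamma> / (lam q - lam p) = - (\<gamma> / (lam p - lam q))"
      by (metis minus_diff_eq minus_divide_right)
    show ?thesis
      unfolding acf_A_def colact_linear colact_flip colact_acf_Ainf[OF pq] colact_acf_d[OF pq]
        colact_acf_beta[OF pq] colact_acf_beta[OF pq(2,1)] T_def F_def[symmetric] Q_def[symmetric] uv Q' neg
      using False by (simp add: f_def algebra_simps diff_divide_distrib add_divide_distrib)
  next
    case True
    \<comment> \<open>The numerator is divisible by \<lambda>_p - \<lambda>_j, and the quotient also
      makes sense at j = p. So the sum is the full one, known from \<open>sum_w_\<psi>dd\<close>,
      minus the value of Q at (\<lambda>_p, \<lambda>_p), which is the value wanted.\<close>
    have "(\<Sum>j\<in>{1..n}-{p}. \<gamma> / (lam p - lam j) * (f p j - f j p))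
      = (\<Sum>j\<in>{1..n}-{p}. \<gamma> * w lam p * (w lam j * Q (lam p) (lam j)))"
    proof (rule sum.cong[OF refl])
      fix j assume "j \<in> {1..n} - {p}"
      then have "lam p - lam j \<noteq> 0" using inj_on_eq_iff[OF inj pq(1), of j] by auto
      moreover have "f p j - f j p = w lam p * w lam j * ((lam p - lam j) * Q (lam p) (lam j))"
        unfolding Q by (simp add: f_def algebra_simps)
      ultimately show "\<gamma> / (lam p - lam j) * (f p j - f j p) = \<gamma> * w lam p * (w lam j * Q (lam p) (lam j))"
        by simp
    qed
    also have "\<dots> = \<gamma> * w lam p * ((\<Sum>j=1..n. w lam j * Q (lam p) (lam j)) - w lam p * Q (lam p) (lam p))"
      unfolding sum_distrib_left[symmetric] sum_remove1[OF pq(1)] ..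
    also have "(\<Sum>j=1..n. w lam j * Q (lam p) (lam j))
      = (if k = n then \<psi> (U + \<gamma>) i (lam p) else 0) - (if i = n then \<psi> V k (lam p) else 0)"
      unfolding Q_def by (rule sum_w_\<psi>dd[OF inj ik])
    finally have offdiag: "(\<Sum>j\<in>{1..n}-{p}. \<gamma> / (lam p - lam j) * (f p j - f j p))
      = \<gamma> * w lam p * ((if k = n then \<psi> (U + \<gamma>) i (lam p) else 0) - (if i = n then \<psi> V k (lam p) else 0)
         - w lam p * Q (lam p) (lam p))" .
    \<comment> \<open>The two beta terms of A; they cancel the contributions of the full sum for k =
      n and i = n.\<close>
    have "(\<Sum>j=1..n. f p j) = w lam p * \<psi> (U + \<gamma>) i (lam p) * (\<Sum>j=1..n. w lam j * \<psi> V k (lam j))"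
      by (simp add: f_def F_def sum_distrib_left mult_ac)
    then have row: "\<gamma> / v * (\<Sum>j=1..n. f p j) = \<gamma> * w lam p * (if k = n then \<psi> (U + \<gamma>) i (lam p) else 0)"
      using sum_w_\<psi>[OF inj ik(2), of V] \<open>v \<noteq> 0\<close> by (simp add: UV)
    have "(\<Sum>j=1..n. f j p) = w lam p * \<psi> V k (lam p) * (\<Sum>j=1..n. w lam j * \<psi> (U + \<gamma>) i (lam j))"
      by (simp add: f_def F_def sum_distrib_left mult_ac)
    then have col: "\<gamma> / (u + \<gamma>) * (\<Sum>j=1..n. f j p) = \<gamma> * w lam p * (if i = n then \<psi> V k (lam p) else 0)"
      using sum_w_\<psi>[OF inj ik(1), of "U + \<gamma>"] \<open>u + \<gamma> \<noteq> 0\<close> by (simp add: UV)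
    show ?thesis
      unfolding acf_A_def colact_linear colact_flip colact_acf_Ainf[OF pq] colact_acf_d[OF pq]
        colact_acf_beta[OF pq] colact_acf_beta[OF pq(2,1)] T_def F_def[symmetric] Q_def[symmetric] uv
      unfolding True[symmetric] by (simp only: refl if_True offdiag row col) (simp add: f_def algebra_simps)
  qed
  also have "s * (w lam p * w lam q * T \<gamma> U V i k (lam p) (lam q))
    = (acf_R n \<iota> \<gamma> f0 u v lam ** (in1 (acf_bg n \<iota> \<gamma> f0 u lam) ** in2 (acf_b n \<iota> \<gamma> f0 v lam)))
      $ (\<iota> i, \<iota> k) $ (\<iota> p, \<iota> q)"
  proof -
    have "(acf_R n \<iota> \<gamma> f0 u v lam ** (in1 (acf_bg n \<iota> \<gamma> f0 u lam) ** in2 (acf_b n \<iota> \<gamma> f0 v lam)))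
      $ (\<iota> i, \<iota> k) $ (\<iota> p, \<iota> q) = rowact (acf_R n \<iota> \<gamma> f0 u v lam) i k (\<lambda>a b.
      (scale (1 / (lamsum n lam + u - \<gamma> + f0)) a * \<psi> (lamsum n lam + u) a (lam p) * w lam p)
      * (scale (1 / (lamsum n lam + v + f0)) b * \<psi> (lamsum n lam + v + \<gamma>) b (lam q) * w lam q))"
      unfolding mult_nth_rowact[of "acf_R n \<iota> \<gamma> f0 u v lam"]
      using pq by (intro rowact_cong) (simp add: in1_in2_nth acf_b_nth acf_bg_nth)
    then show ?thesis
      unfolding rowact_R_\<psi>[OF ik \<open>u \<noteq> v\<close> nz] s_def UV by (simp add: mult_ac)
  qed
  finally show "(in2 (acf_bg n \<iota> \<gamma> f0 v lam) ** in1 (acf_b n \<iota> \<gamma> f0 u lam) ** acf_A n \<iota> \<gamma> u v lam)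
      $ (\<iota> i, \<iota> k) $ (\<iota> p, \<iota> q)
    = (acf_R n \<iota> \<gamma> f0 u v lam ** (in1 (acf_bg n \<iota> \<gamma> f0 u lam) ** in2 (acf_b n \<iota> \<gamma> f0 v lam)))
      $ (\<iota> i, \<iota> k) $ (\<iota> p, \<iota> q)" .
qed


text \<open>Now T is evaluated at (\<lambda>_p, \<lambda>_q) for p \<noteq> q and at (\<lambda>_p,
  \<lambda>_p + \<gamma>) for p = q. At the latter pair x - y = -\<gamma>, so the coefficient 1 +
  \<gamma> / (x - y) of F(x, y) vanishes and only F(y, x) survives, which explains the single entry
  in a diagonal column of D.\<close>

lemma D_intertwines:
  assumes inj: "inj_on lam {1..n}" and nonres: "nonres n \<gamma> lam" and "\<gamma> \<noteq> 0" "u \<noteq> v"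
    and nz: "lamsum n lam + u + f0 \<noteq> 0" "lamsum n lam + v - \<gamma> + f0 \<noteq> 0"
      "lamsum n lam + u - \<gamma> + f0 \<noteq> 0" "lamsum n lam + v + f0 \<noteq> 0"
  shows "in2 (acf_bg n \<iota> \<gamma> f0 v lam) ** dyn1 n \<iota> \<gamma> (acf_bg n \<iota> \<gamma> f0 u) lam ** acf_D n \<iota> \<gamma> (u - v) lam
    = acf_R n \<iota> \<gamma> f0 u v lam ** (in1 (acf_bg n \<iota> \<gamma> f0 u lam) ** dyn2 n \<iota> \<gamma> (acf_bg n \<iota> \<gamma> f0 v) lam)"
proof (rule mat2_eqI)
  fix i k p q assume ik: "i \<in> {1..n}" "k \<in> {1..n}" and pq: "p \<in> {1..n}" "q \<in> {1..n}"
  define U V where UV: "U = lamsum n lam + u" "V = lamsum n lam + v"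
  define s where "s = scale (1 / (U + f0)) i * scale (1 / (V - \<gamma> + f0)) k"
  define F where "F x y = \<psi> (U + \<gamma>) i x * \<psi> V k y" for x y
  define Q where "Q x y = \<psi>dd (U + \<gamma>) V i k x y" for x y
  define f where "f a b = F (lamshift \<gamma> lam b a) (lam b) * (w (lamshift \<gamma> lam b) a * w lam b)" for a b
  have uv: "u - v = U - V" "U - V \<noteq> 0" using \<open>u \<noteq> v\<close> by (simp_all add: UV)
  have Q: "(x - y) * Q x y = F x y - F y x" for x y
    unfolding Q_def F_def by (rule \<psi>dd_eq[OF ik])
  have "(in2 (acf_bg n \<iota> \<gamma> f0 v lam) ** dyn1 n \<iota> \<gamma> (acf_bg n \<iota> \<gamma> f0 u) lam ** acf_D n \<iota> \<gamma> (u - v) lam)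
      $ (\<iota> i, \<iota> k) $ (\<iota> p, \<iota> q)
    = colact (acf_D n \<iota> \<gamma> (u - v) lam) p q (\<lambda>a b. s * f a b)"
    unfolding mult_nth_colact[of _ "acf_D n \<iota> \<gamma> (u - v) lam"]
    using ik by (intro colact_cong)
      (simp add: in2_dyn1_nth acf_bg_shift_nth, simp add: acf_bg_nth s_def f_def F_def UV mult_ac)
  also have "\<dots> = s * colact (acf_D n \<iota> \<gamma> (u - v) lam) p q f"
    unfolding colact_def by (simp add: sum_distrib_left mult_ac)
  also have "colact (acf_D n \<iota> \<gamma> (u - v) lam) p q f
    = w lam p * w (lamshift \<gamma> lam p) q * T \<gamma> U V i k (lam p) (lamshift \<gamma> lam p q)"
  proof (cases "p = q")
    case False
    have shifts: "lamshift \<gamma> lam p q = lam q" "lamshift \<gamma> lam q p = lam p"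
      using False by (auto simp: lamshift_def)
    define x y where xy: "x = lam p" "y = lam q"
    have "x - y \<noteq> 0" using inj_on_eq_iff[OF inj pq] False by (simp add: xy)
    have "y - x - \<gamma> \<noteq> 0" "x - y - \<gamma> \<noteq> 0" using nonres pq False by (auto simp: nonres_def xy)
    then have d: "y - x - \<gamma> \<noteq> 0" "y - x + \<gamma> \<noteq> 0" by (auto simp: algebra_simps)
    define t1 t2 where t: "t1 = (y - x) / (y - x + \<gamma>)" "t2 = (y - x) / (y - x - \<gamma>)"
    define g g' where g: "g = \<gamma> / (x - y)" "g' = \<gamma> / (U - V)"
    have neg: "\<gamma> / (y - x) = - g" unfolding g by (metis minus_diff_eq minus_divide_right)
    have w1: "w (lamshift \<gamma> lam p) q = w lam q * t2"
      using w_shift_neq[OF inj nonres pq False] by (simp add: t xy)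
    have "(x - y) / (x - y - \<gamma>) = t1"
      unfolding t using minus_divide_divide[of "y - x" "y - x + \<gamma>"] by (simp add: algebra_simps)
    then have w2: "w (lamshift \<gamma> lam q) p = w lam p * t1"
      using w_shift_neq[OF inj nonres pq(2,1)] False by (simp add: xy)
    have gQ: "\<gamma> * Q x y = g * (F x y - F y x)"
      using Q[of x y, symmetric] \<open>x - y \<noteq> 0\<close> by (simp add: g)
    \<comment> \<open>t1 and t2 are the factors by which the shifts change the weights. The
      coefficient of F(x, y) is thus 1 on the side of D and on the side of T, and F(y, x) carries
      the same t2 on both.\<close>
    have 1: "t1 * (1 - g) = 1" "t2 * (1 + g) = 1"
      using \<open>x - y \<noteq> 0\<close> d unfolding t g by (simp_all add: divide_simps) (simp_all add: algebra_simps)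
    have "colact (acf_D n \<iota> \<gamma> (u - v) lam) p q f
      = w lam p * w lam q * (F x y * (t1 * (1 - g)) + F y x * t2 * (g' - g))"
      unfolding acf_D_def colact_linear colact_acf_Dinf[OF pq] colact_acf_d[OF pq] uv f_def shifts w1 w2
      using False by (simp add: xy[symmetric] g[symmetric] neg algebra_simps)
    also have "\<dots> = w lam p * w lam q * (F x y * (t2 * (1 + g)) + F y x * t2 * (g' - g))"
      unfolding 1 ..
    also have "\<dots> = w lam p * (w lam q * t2) * (F x y + \<gamma> * Q x y + g' * F y x)"
      unfolding gQ by (simp add: algebra_simps)
    finally show ?thesis
      unfolding w1 shifts T_def F_def[symmetric] Q_def[symmetric] by (simp add: xy[symmetric] g)
  next
    case True
    have sh: "lamshift \<gamma> lam p p = lam p + \<gamma>" by (simp add: lamshift_def)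
    have "\<gamma> * Q (lam p) (lam p + \<gamma>) = F (lam p + \<gamma>) (lam p) - F (lam p) (lam p + \<gamma>)"
      using Q[of "lam p" "lam p + \<gamma>"] by (simp add: algebra_simps)
    then show ?thesis
      unfolding acf_D_def colact_linear colact_acf_Dinf[OF pq] colact_acf_d[OF pq] uv T_def
        F_def[symmetric] Q_def[symmetric]
      unfolding True[symmetric]
      by (simp add: f_def sh algebra_simps)
  qed
  also have "s * (w lam p * w (lamshift \<gamma> lam p) q * T \<gamma> U V i k (lam p) (lamshift \<gamma> lam p q))
    = (acf_R n \<iota> \<gamma> f0 u v lam ** (in1 (acf_bg n \<iota> \<gamma> f0 u lam) ** dyn2 n \<iota> \<gamma> (acf_bg n \<iota> \<gamma> f0 v) lam))
      $ (\<iota> i, \<iota> k) $ (\<iota> p, \<iota> q)"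
  proof -
    have "(acf_R n \<iota> \<gamma> f0 u v lam ** (in1 (acf_bg n \<iota> \<gamma> f0 u lam) ** dyn2 n \<iota> \<gamma> (acf_bg n \<iota> \<gamma> f0 v) lam))
      $ (\<iota> i, \<iota> k) $ (\<iota> p, \<iota> q) = rowact (acf_R n \<iota> \<gamma> f0 u v lam) i k (\<lambda>a b.
      (scale (1 / (lamsum n lam + u - \<gamma> + f0)) a * \<psi> (lamsum n lam + u) a (lam p) * w lam p)
      * (scale (1 / (lamsum n lam + v + f0)) b * \<psi> (lamsum n lam + v + \<gamma>) b (lamshift \<gamma> lam p q)
         * w (lamshift \<gamma> lam p) q))"
      unfolding mult_nth_rowact[of "acf_R n \<iota> \<gamma> f0 u v lam"]
      using pq by (intro rowact_cong) (simp add: in1_dyn2_nth acf_bg_shift_nth, simp add: acf_bg_nth)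
    then show ?thesis
      unfolding rowact_R_\<psi>[OF ik \<open>u \<noteq> v\<close> nz] s_def UV by (simp add: mult_ac)
  qed
  finally show "(in2 (acf_bg n \<iota> \<gamma> f0 v lam) ** dyn1 n \<iota> \<gamma> (acf_bg n \<iota> \<gamma> f0 u) lam ** acf_D n \<iota> \<gamma> (u - v) lam)
      $ (\<iota> i, \<iota> k) $ (\<iota> p, \<iota> q)
    = (acf_R n \<iota> \<gamma> f0 u v lam ** (in1 (acf_bg n \<iota> \<gamma> f0 u lam) ** dyn2 n \<iota> \<gamma> (acf_bg n \<iota> \<gamma> f0 v) lam))
      $ (\<iota> i, \<iota> k) $ (\<iota> p, \<iota> q)" .
qed


section \<open>Invertibility of b and passage to inverses\<close>

text \<open>The weights annihilate every \<psi>_i except \<psi>_n, so a_n (c - \<sigma>) = 0. What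
  remains is a polynomial of degree at most n - 2 with n distinct roots.\<close>

lemma sum_\<psi>_zero_imp:
  assumes inj: "inj_on lam {1..n}" and "c \<noteq> lamsum n lam"
    and zero: "\<And>j. j \<in> {1..n} \<Longrightarrow> (\<Sum>i=1..n. a i * \<psi> c i (lam j)) = 0"
    and "i \<in> {1..n}"
  shows "a i = (0::complex)"
proof -
  have "0 = (\<Sum>j=1..n. w lam j * (\<Sum>i=1..n. a i * \<psi> c i (lam j)))"
    using zero by simp
  also have "\<dots> = (\<Sum>i=1..n. a i * (\<Sum>j=1..n. w lam j * \<psi> c i (lam j)))"
    unfolding sum_distrib_left by (subst sum.swap) (simp add: mult_ac)
  also have "\<dots> = (\<Sum>i=1..n. if i = n then a n * (c - lamsum n lam) else 0)"
    using sum_w_\<psi>[OF inj] by (intro sum.cong) auto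
  finally have an: "a n = 0" using assms(2) n_ge_2 by simp
  define d where "d m = a (Suc m)" for m
  have "(\<Sum>m\<le>n-2. d m * lam j ^ m) = 0" if "j \<in> {1..n}" for j
  proof -
    have "(\<Sum>i=1..n. a i * \<psi> c i (lam j)) = (\<Sum>i=1..n-1. a i * \<psi> c i (lam j))"
    proof -
      have "{1..n} = insert n {1..n-1}" using n_ge_2 by auto
      then show ?thesis using an n_ge_2 by simp
    qed
    also have "\<dots> = (\<Sum>m\<le>n-2. d m * lam j ^ m)"
      unfolding d_def using n_ge_2
      by (intro sum.reindex_bij_witness[of _ Suc "\<lambda>i. i - 1"]) (auto simp: \<psi>_def)
    finally show ?thesis using zero[OF that] by simp
  qed
  then have sub: "lam ` {1..n} \<subseteq> {z. (\<Sum>m\<le>n-2. d m * z ^ m) = 0}" by auto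
  have "d m = 0" if "m \<le> n - 2" for m
  proof (rule ccontr)
    assume "d m \<noteq> 0"
    then have "\<exists>k\<le>n - 2. d k \<noteq> 0" using that by blast
    from polyfun_rootbound[where c = d, OF this] have "card (lam ` {1..n}) \<le> n - 2"
      using card_mono[OF _ sub] by simp
    then show False using card_image[OF inj] n_ge_2 by simp
  qed
  from this[of "i - 1"] show ?thesis
    using an assms(4) by (cases "i = n") (auto simp: d_def)
qed

lemma bary_nonzero: "inj_on x I \<Longrightarrow> finite I \<Longrightarrow> j \<in> I \<Longrightarrow> bary I x j \<noteq> 0"
  by (auto simp: bary_def dest: inj_onD)

text \<open>A linear relation between the rows, divided by the weights, is a combination of the
  \<psi>_i vanishing at all \<lambda>_j; u + \<gamma> \<noteq> 0 says that their parameter is not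
  \<sigma>.\<close>

lemma invertible_acf_b:
  assumes inj: "inj_on lam {1..n}" and nz: "lamsum n lam + u + f0 \<noteq> 0" "u + \<gamma> \<noteq> 0"
  shows "invertible (acf_b n \<iota> \<gamma> f0 u lam)"
  unfolding invertible_right_inverse matrix_right_invertible_independent_rows
proof (intro allI impI)
  fix c :: "'n \<Rightarrow> complex" and x
  let ?b = "acf_b n \<iota> \<gamma> f0 u lam" and ?s = "scale (1 / (lamsum n lam + u + f0))"
  assume c: "(\<Sum>i\<in>UNIV. c i *s row i ?b) = 0"
  have "(\<Sum>i=1..n. c (\<iota> i) * ?s i * \<psi> (lamsum n lam + u + \<gamma>) i (lam j)) = 0" if j: "j \<in> {1..n}" for j
  proof -
    have "0 = (\<Sum>i\<in>UNIV. c i *s row i ?b) $ \<iota> j" using c by simp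
    also have "\<dots> = (\<Sum>i=1..n. c (\<iota> i) * ?b $ \<iota> i $ \<iota> j)"
      by (simp add: sum_component row_def sum_UNIV)
    also have "\<dots> = (\<Sum>i=1..n. c (\<iota> i) * ?s i * \<psi> (lamsum n lam + u + \<gamma>) i (lam j)) * w lam j"
      unfolding sum_distrib_right using j by (intro sum.cong) (simp_all add: acf_b_nth)
    finally show ?thesis using bary_nonzero[OF inj _ j] by simp
  qed
  moreover obtain i where i: "i \<in> {1..n}" "x = \<iota> i" using label_cases .
  ultimately have "c (\<iota> i) * ?s i = 0"
    using sum_\<psi>_zero_imp[OF inj, of "lamsum n lam + u + \<gamma>" "\<lambda>i. c (\<iota> i) * ?s i" i] nz by (simp add: add.assoc)
  then show "c x = 0" using nz i by (simp add: scale_def split: if_splits)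
qed

lemma invertible_acf_bg:
  assumes "inj_on lam {1..n}" "lamsum n lam + u - \<gamma> + f0 \<noteq> 0" "u \<noteq> 0"
  shows "invertible (acf_bg n \<iota> \<gamma> f0 u lam)"
  unfolding acf_bg_def using assms by (intro invertible_acf_b) (auto simp: algebra_simps)

lemma matrix_inv_left_mult:
  fixes M :: "complex^'m^'m"
  assumes "invertible M"
  shows "matrix_inv M ** M = mat 1"
  using assms unfolding invertible_def matrix_inv_def by (rule someI2_ex) simp

lemma in1_mult: "in1 (M ** N) = in1 M ** (in1 N :: complex^('n \<times> 'n)^('n \<times> 'n))"
proof (rule mat2_eqI)
  fix i k p q assume *: "i \<in> {1..n}" "k \<in> {1..n}" "p \<in> {1..n}" "q \<in> {1..n}"
  have "rowact (in1 M) i k (\<lambda>a b. in1 N $ (\<iota> a, \<iota> b) $ (\<iota> p, \<iota> q))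
    = (\<Sum>a=1..n. \<Sum>b=1..n. if k = b then if k = q then M $ \<iota> i $ \<iota> a * N $ \<iota> a $ \<iota> p else 0 else 0)"
    unfolding rowact_def using * by (intro sum.cong refl) auto
  then show "in1 (M ** N) $ (\<iota> i, \<iota> k) $ (\<iota> p, \<iota> q) = (in1 M ** in1 N) $ (\<iota> i, \<iota> k) $ (\<iota> p, \<iota> q)"
    unfolding mult_nth_rowact using * by (simp add: sum_if_const matrix_matrix_mult_def sum_UNIV)
qed

lemma in2_mult: "in2 (M ** N) = in2 M ** (in2 N :: complex^('n \<times> 'n)^('n \<times> 'n))"
  by (metis flip_flip flip_in2 flip_mult in1_mult)

lemma in1_mat_1: "in1 (mat 1) = (mat 1 :: complex^('n \<times> 'n)^('n \<times> 'n))"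
  by (auto simp: in1_def tensor_def mat_def vec_eq_iff)

lemma in2_mat_1: "in2 (mat 1) = (mat 1 :: complex^('n \<times> 'n)^('n \<times> 'n))"
  by (auto simp: in2_def tensor_def mat_def vec_eq_iff)

lemma invertible_in1: "invertible M \<Longrightarrow> invertible (in1 M :: complex^('n \<times> 'n)^('n \<times> 'n))"
  unfolding invertible_def by (metis in1_mult in1_mat_1)

lemma invertible_in2: "invertible M \<Longrightarrow> invertible (in2 M :: complex^('n \<times> 'n)^('n \<times> 'n))"
  unfolding invertible_def by (metis in2_mult in2_mat_1)

lemma eq_inv_mult:
  fixes M :: "complex^'m^'m"
  assumes "invertible M" "M ** X = Y"
  shows "X = matrix_inv M ** Y"
  using matrix_inv_left_mult[OF assms(1)] assms(2) by (metis matrix_mul_assoc matrix_mul_lid)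

text \<open>\<open>dyn1\<close> is block diagonal in the second space, so inverting M before the
  shift, as in the formula for D, inverts it block by block.\<close>

lemma dyn1_inv_mult:
  assumes "\<And>j. j \<in> {1..n} \<Longrightarrow> invertible (M (lamshift \<gamma> lam j))"
  shows "dyn1 n \<iota> \<gamma> (\<lambda>l. matrix_inv (M l)) lam ** dyn1 n \<iota> \<gamma> M lam = mat 1"
proof (rule mat2_eqI)
  fix i k p q assume *: "i \<in> {1..n}" "k \<in> {1..n}" "p \<in> {1..n}" "q \<in> {1..n}"
  let ?M = "M (lamshift \<gamma> lam k)"
  have "(dyn1 n \<iota> \<gamma> (\<lambda>l. matrix_inv (M l)) lam ** dyn1 n \<iota> \<gamma> M lam) $ (\<iota> i, \<iota> k) $ (\<iota> p, \<iota> q)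
    = (\<Sum>a=1..n. \<Sum>b=1..n. if k = b then if k = q then matrix_inv ?M $ \<iota> i $ \<iota> a * ?M $ \<iota> a $ \<iota> p else 0 else 0)"
    unfolding mult_nth_rowact rowact_def using * by (intro sum.cong refl) auto
  also have "\<dots> = (if k = q then (matrix_inv ?M ** ?M) $ \<iota> i $ \<iota> p else 0)"
    using * by (simp add: sum_if_const matrix_matrix_mult_def sum_UNIV)
  also have "\<dots> = mat 1 $ (\<iota> i, \<iota> k) $ (\<iota> p, \<iota> q)"
    unfolding matrix_inv_left_mult[OF assms[OF *(2)]] using * by (simp add: mat_def)
  finally show "(dyn1 n \<iota> \<gamma> (\<lambda>l. matrix_inv (M l)) lam ** dyn1 n \<iota> \<gamma> M lam) $ (\<iota> i, \<iota> k) $ (\<iota> p, \<iota> q)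
    = mat 1 $ (\<iota> i, \<iota> k) $ (\<iota> p, \<iota> q)" .
qed

lemma inj_on_lamshift:
  assumes "inj_on lam {1..n}" "nonres n \<gamma> lam" "p \<in> {1..n}"
  shows "inj_on (lamshift \<gamma> lam p) {1..n}"
proof (rule inj_onI)
  fix i j assume ij: "i \<in> {1..n}" "j \<in> {1..n}" "lamshift \<gamma> lam p i = lamshift \<gamma> lam p j"
  have "lam j \<noteq> lam p + \<gamma>" if "j \<in> {1..n}" "j \<noteq> p" for j
  proof -
    have "lam j - lam p \<noteq> \<gamma>" using assms(2,3) that by (auto simp: nonres_def)
    then show ?thesis by (metis add_diff_cancel_left')
  qed
  then show "i = j"
    using ij inj_on_eq_iff[OF assms(1) ij(1,2)] by (auto simp: lamshift_def split: if_splits)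
qed

lemma acf_A_eq:
  assumes "inj_on lam {1..n}" "u \<noteq> v" "u + \<gamma> \<noteq> 0" "v \<noteq> 0"
    and "lamsum n lam + u + f0 \<noteq> 0" "lamsum n lam + u - \<gamma> + f0 \<noteq> 0"
      "lamsum n lam + v + f0 \<noteq> 0" "lamsum n lam + v - \<gamma> + f0 \<noteq> 0"
  shows "acf_A n \<iota> \<gamma> u v lam
    = matrix_inv (in1 (acf_b n \<iota> \<gamma> f0 u lam)) ** matrix_inv (in2 (acf_bg n \<iota> \<gamma> f0 v lam))
      ** acf_R n \<iota> \<gamma> f0 u v lam ** in1 (acf_bg n \<iota> \<gamma> f0 u lam) ** in2 (acf_b n \<iota> \<gamma> f0 v lam)"
proof -
  have "in2 (acf_bg n \<iota> \<gamma> f0 v lam) ** (in1 (acf_b n \<iota> \<gamma> f0 u lam) ** acf_A n \<iota> \<gamma> u v lam)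
    = acf_R n \<iota> \<gamma> f0 u v lam ** (in1 (acf_bg n \<iota> \<gamma> f0 u lam) ** in2 (acf_b n \<iota> \<gamma> f0 v lam))"
    using A_intertwines[OF assms(1-5,8,6,7)] by (simp only: matrix_mul_assoc)
  note eq_inv_mult[OF invertible_in2[OF invertible_acf_bg[OF assms(1,8,4)]] this]
  from eq_inv_mult[OF invertible_in1[OF invertible_acf_b[OF assms(1,5,3)]] this]
  show ?thesis by (simp only: matrix_mul_assoc)
qed

lemma acf_D_eq:
  assumes "inj_on lam {1..n}" "nonres n \<gamma> lam" "\<gamma> \<noteq> 0" "u \<noteq> v" "u \<noteq> 0" "v \<noteq> 0"
    and "lamsum n lam + u + f0 \<noteq> 0" "lamsum n lam + u - \<gamma> + f0 \<noteq> 0"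
      "lamsum n lam + v + f0 \<noteq> 0" "lamsum n lam + v - \<gamma> + f0 \<noteq> 0"
  shows "acf_D n \<iota> \<gamma> (u - v) lam
    = dyn1 n \<iota> \<gamma> (\<lambda>l. matrix_inv (acf_bg n \<iota> \<gamma> f0 u l)) lam ** matrix_inv (in2 (acf_bg n \<iota> \<gamma> f0 v lam))
      ** acf_R n \<iota> \<gamma> f0 u v lam ** in1 (acf_bg n \<iota> \<gamma> f0 u lam) ** dyn2 n \<iota> \<gamma> (acf_bg n \<iota> \<gamma> f0 v) lam"
proof -
  have "in2 (acf_bg n \<iota> \<gamma> f0 v lam) ** (dyn1 n \<iota> \<gamma> (acf_bg n \<iota> \<gamma> f0 u) lam ** acf_D n \<iota> \<gamma> (u - v) lam)
    = acf_R n \<iota> \<gamma> f0 u v lam ** (in1 (acf_bg n \<iota> \<gamma> f0 u lam) ** dyn2 n \<iota> \<gamma> (acf_bg n \<iota> \<gamma> f0 v) lam)"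
    using D_intertwines[OF assms(1-4,7,10,8,9)] by (simp only: matrix_mul_assoc)
  note 1 = eq_inv_mult[OF invertible_in2[OF invertible_acf_bg[OF assms(1,10,6)]] this]
  have "invertible (acf_bg n \<iota> \<gamma> f0 u (lamshift \<gamma> lam j))" if "j \<in> {1..n}" for j
    using inj_on_lamshift[OF assms(1,2) that] assms(5,7) lamsum_shift[OF that, of \<gamma> lam]
    by (intro invertible_acf_bg) (auto simp: algebra_simps)
  then have "dyn1 n \<iota> \<gamma> (\<lambda>l. matrix_inv (acf_bg n \<iota> \<gamma> f0 u l)) lam ** dyn1 n \<iota> \<gamma> (acf_bg n \<iota> \<gamma> f0 u) lam = mat 1"
    by (rule dyn1_inv_mult)
  then have "acf_D n \<iota> \<gamma> (u - v) lam = dyn1 n \<iota> \<gamma> (\<lambda>l. matrix_inv (acf_bg n \<iota> \<gamma> f0 u l)) lam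
    ** (dyn1 n \<iota> \<gamma> (acf_bg n \<iota> \<gamma> f0 u) lam ** acf_D n \<iota> \<gamma> (u - v) lam)"
    by (simp add: matrix_mul_assoc)
  then show ?thesis unfolding 1 by (simp only: matrix_mul_assoc)
qed

text \<open>For f0 = \<gamma> the factors (U + \<gamma>) / (U + f0) and V / (V - \<gamma> + f0)
  become 1, and the two sums they multiply are the missing part i = n of the triangular sum.\<close>

lemma acf_R_eq_R0:
  assumes "lamsum n lam + u + \<gamma> \<noteq> 0" "lamsum n lam + v \<noteq> 0"
  shows "acf_R n \<iota> \<gamma> \<gamma> u v lam = acf_R0 n \<iota> \<gamma> (u + lamsum n lam) (v + lamsum n lam)"
proof -
  have top: "(\<Sum>i=1..n. \<Sum>k=1..i-1. \<Sum>j=1..i-k.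
       e i (i - k) \<otimes> e j (j + k - 1) - e j (j + k - 1) \<otimes> e i (i - k))
    = (\<Sum>i=1..n-1. \<Sum>k=1..i-1. \<Sum>j=1..i-k.
       e i (i - k) \<otimes> e j (j + k - 1) - e j (j + k - 1) \<otimes> e i (i - k))
      + (\<Sum>k=1..n-1. \<Sum>j=1..n-k. e n (n - k) \<otimes> e j (j + k - 1))
      - (\<Sum>k=1..n-1. \<Sum>j=1..n-k. e j (j + k - 1) \<otimes> e n (n - k))" (is "?l = ?m + ?x - ?y")
  proof -
    obtain N where "n = Suc N" using n_ge_2 by (cases n) auto
    then show ?thesis by (simp add: sum_subtractf)
  qed
  have cmul_add: "c \<cdot> (X + Y - Z) = c \<cdot> X + c \<cdot> Y - c \<cdot> Z" for c and X Y Z :: "complex^('n \<times> 'n)^('n \<times> 'n)"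
    by (simp add: cmul_def vec_eq_iff algebra_simps)
  have coeffs: "(\<gamma> * ((lamsum n lam + u + \<gamma>) / (lamsum n lam + u + \<gamma>))) = \<gamma>"
    "(\<gamma> * ((lamsum n lam + v) / (lamsum n lam + v - \<gamma> + \<gamma>))) = \<gamma>"
    using assms by simp_all
  show ?thesis
    unfolding acf_R_def acf_R0_def Let_def top cmul_add coeffs
    by (simp add: add_ac mult_ac)
qed


section \<open>The shifted Yang-Baxter equation\<close>

abbreviation (input) P :: "complex \<Rightarrow> complex \<Rightarrow> complex \<Rightarrow> nat \<Rightarrow> nat \<Rightarrow> (nat \<Rightarrow> nat \<Rightarrow> complex) \<Rightarrow> complex" where
  "P \<gamma> u v \<equiv> rhat \<gamma> (\<gamma> / (u - v)) u v"

text \<open>R depends on \<lambda> only through \<sigma>. Taking \<lambda> = 0 makes U = u and V =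
  v, so the row formula for R specializes to R0.\<close>

lemma rowact_R0:
  assumes "r \<in> {1..n}" "s \<in> {1..n}" "u + \<gamma> \<noteq> 0" "v \<noteq> 0"
  shows "rowact (acf_R0 n \<iota> \<gamma> u v) r s f = scale (1 / (u + \<gamma>)) r * scale (1 / v) s
    * P \<gamma> u v r s (\<lambda>a b. scale u a * scale (v + \<gamma>) b * f a b)"
  using rowact_acf_R[OF assms(1,2), of "\<lambda>_. 0" u \<gamma> v \<gamma> f] acf_R_eq_R0[of "\<lambda>_. 0" u \<gamma> v] assms(3,4)
  by (simp add: lamsum_def)

text \<open>At distinct points T is a combination of F(x, y) and F(y, x) with coefficients depending
  on x - y and u - v alone, as in a scalar Yang-Baxter problem.\<close>

lemma rhat_\<psi>_distinct:
  assumes "i \<in> {1..n}" "k \<in> {1..n}" "u \<noteq> v" "x \<noteq> y"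
  shows "P \<gamma> u v i k (\<lambda>a b. \<psi> u a x * \<psi> (v + \<gamma>) b y)
    = (1 + \<gamma> / (x - y)) * (\<psi> (u + \<gamma>) i x * \<psi> v k y)
      + (\<gamma> / (u - v) - \<gamma> / (x - y)) * (\<psi> (u + \<gamma>) i y * \<psi> v k x)"
proof -
  have dd: "\<psi>dd (u + \<gamma>) v i k x y = (\<psi> (u + \<gamma>) i x * \<psi> v k y - \<psi> (u + \<gamma>) i y * \<psi> v k x) / (x - y)"
    using \<psi>dd_eq[OF assms(1,2), of x y "u + \<gamma>" v] assms(4) by (simp add: field_simps)
  show ?thesis
    unfolding rhat_\<psi>[OF assms(1-3)] dd by (simp add: algebra_simps diff_divide_distrib)
qed

text \<open>The two sides of the shifted Yang-Baxter equation for the gauged matrices, acting on a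
  function of the column index.\<close>

definition ybl :: "complex \<Rightarrow> complex \<Rightarrow> complex \<Rightarrow> complex \<Rightarrow> nat \<Rightarrow> nat \<Rightarrow> nat \<Rightarrow> (nat \<Rightarrow> nat \<Rightarrow> nat \<Rightarrow> complex) \<Rightarrow> complex" where
  "ybl \<gamma> u1 u2 u3 i k l F = P \<gamma> u1 u2 i k (\<lambda>a b. P \<gamma> (u1 - \<gamma>) (u3 - \<gamma>) a l (\<lambda>a' c. P \<gamma> u2 u3 b c (\<lambda>b' c'. F a' b' c')))"

definition ybr :: "complex \<Rightarrow> complex \<Rightarrow> complex \<Rightarrow> complex \<Rightarrow> nat \<Rightarrow> nat \<Rightarrow> nat \<Rightarrow> (nat \<Rightarrow> nat \<Rightarrow> nat \<Rightarrow> complex) \<Rightarrow> complex" where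
  "ybr \<gamma> u1 u2 u3 i k l F = P \<gamma> (u2 - \<gamma>) (u3 - \<gamma>) k l (\<lambda>b c. P \<gamma> u1 u3 i c (\<lambda>a c'. P \<gamma> (u1 - \<gamma>) (u2 - \<gamma>) a b (\<lambda>a' b'. F a' b' c')))"

lemma ybl_cong:
  assumes "i \<in> {1..n}" "k \<in> {1..n}" "l \<in> {1..n}"
    and "\<And>a b c. \<lbrakk>a \<in> {1..n}; b \<in> {1..n}; c \<in> {1..n}\<rbrakk> \<Longrightarrow> F a b c = G a b c"
  shows "ybl \<gamma> u1 u2 u3 i k l F = ybl \<gamma> u1 u2 u3 i k l G"
  unfolding ybl_def by (intro rhat_cong assms)

lemma ybr_cong:
  assumes "i \<in> {1..n}" "k \<in> {1..n}" "l \<in> {1..n}"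
    and "\<And>a b c. \<lbrakk>a \<in> {1..n}; b \<in> {1..n}; c \<in> {1..n}\<rbrakk> \<Longrightarrow> F a b c = G a b c"
  shows "ybr \<gamma> u1 u2 u3 i k l F = ybr \<gamma> u1 u2 u3 i k l G"
  unfolding ybr_def by (intro rhat_cong assms)

lemma ybl_linear:
  "ybl \<gamma> u1 u2 u3 i k l (\<lambda>a b c. \<Sum>t\<in>S. G t a b c) = (\<Sum>t\<in>S. ybl \<gamma> u1 u2 u3 i k l (G t))"
  "ybl \<gamma> u1 u2 u3 i k l (\<lambda>a b c. d * F a b c) = d * ybl \<gamma> u1 u2 u3 i k l F"
  unfolding ybl_def rhat_sum rhat_mult by simp_all

lemma ybr_linear:
  "ybr \<gamma> u1 u2 u3 i k l (\<lambda>a b c. \<Sum>t\<in>S. G t a b c) = (\<Sum>t\<in>S. ybr \<gamma> u1 u2 u3 i k l (G t))"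
  "ybr \<gamma> u1 u2 u3 i k l (\<lambda>a b c. d * F a b c) = d * ybr \<gamma> u1 u2 u3 i k l F"
  unfolding ybr_def rhat_sum rhat_mult by simp_all

text \<open>The parameters fit at every step. The first goes u1 - \<gamma>, u1, u1 + \<gamma> and
  the third u3 + \<gamma>, u3, u3 - \<gamma>; the second goes u2, u2 + \<gamma>, u2 on the left and
  u2, u2 - \<gamma>, u2 on the right. Both sides end in the six permutations of x, y, z in
  G.\<close>

lemma ybl_eq_ybr_\<psi>:
  assumes ikl: "i \<in> {1..n}" "k \<in> {1..n}" "l \<in> {1..n}"
    and u: "u1 \<noteq> u2" "u1 \<noteq> u3" "u2 \<noteq> u3" and xyz: "x \<noteq> y" "x \<noteq> z" "y \<noteq> z"
  shows "ybl \<gamma> u1 u2 u3 i k l (\<lambda>a b c. \<psi> (u1 - \<gamma>) a x * (\<psi> u2 b y * \<psi> (u3 + \<gamma>) c z))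
    = ybr \<gamma> u1 u2 u3 i k l (\<lambda>a b c. \<psi> (u1 - \<gamma>) a x * (\<psi> u2 b y * \<psi> (u3 + \<gamma>) c z))"
proof -
  define A where "A x y = 1 + \<gamma> / (x - y)" for x y
  define C where "C u v x y = \<gamma> / (u - v) - \<gamma> / (x - y)" for u v x y
  define G where "G x y z = \<psi> (u1 + \<gamma>) i x * \<psi> u2 k y * \<psi> (u3 - \<gamma>) l z" for x y z
  \<comment> \<open>Subtracting \<gamma> from both spectral parameters leaves the coefficients
    alone; it only adjusts the parameters of \<psi>.\<close>
  have C_shift: "C (u - \<gamma>) (v - \<gamma>) x y = C u v x y" for u v x y by (simp add: C_def)
  have P: "P \<gamma> u v i k (\<lambda>a b. \<psi> u a x * \<psi> c b y)
    = A x y * (\<psi> c' i x * \<psi> v k y) + C u v x y * (\<psi> c' i y * \<psi> v k x)"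
    if "i \<in> {1..n}" "k \<in> {1..n}" "u \<noteq> v" "x \<noteq> y" "c = v + \<gamma>" "c' = u + \<gamma>" for u v i k x y c c'
    using rhat_\<psi>_distinct[OF that(1-4)] unfolding that(5,6) A_def C_def .
  have L12: "P \<gamma> u1 u2 i k (\<lambda>a b. \<psi> u1 a x * \<psi> (u2 + \<gamma>) b y)
    = A x y * (\<psi> (u1 + \<gamma>) i x * \<psi> u2 k y) + C u1 u2 x y * (\<psi> (u1 + \<gamma>) i y * \<psi> u2 k x)"
    if "x \<noteq> y" for x y using P[OF ikl(1,2) u(1) that] by simp
  have L13: "P \<gamma> (u1 - \<gamma>) (u3 - \<gamma>) a l (\<lambda>a c. \<psi> (u1 - \<gamma>) a x * \<psi> u3 c y)
    = A x y * (\<psi> u1 a x * \<psi> (u3 - \<gamma>) l y) + C u1 u3 x y * (\<psi> u1 a y * \<psi> (u3 - \<gamma>) l x)"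
    if "x \<noteq> y" "a \<in> {1..n}" for x y a
    using P[OF that(2) ikl(3) _ that(1), of "u1 - \<gamma>" "u3 - \<gamma>"] u by (simp add: C_shift)
  have L23: "P \<gamma> u2 u3 b c (\<lambda>b c. \<psi> u2 b x * \<psi> (u3 + \<gamma>) c y)
    = A x y * (\<psi> (u2 + \<gamma>) b x * \<psi> u3 c y) + C u2 u3 x y * (\<psi> (u2 + \<gamma>) b y * \<psi> u3 c x)"
    if "x \<noteq> y" "b \<in> {1..n}" "c \<in> {1..n}" for x y b c using P[OF that(2,3) u(3) that(1)] by simp
  have R12: "P \<gamma> (u1 - \<gamma>) (u2 - \<gamma>) a b (\<lambda>a b. \<psi> (u1 - \<gamma>) a x * \<psi> u2 b y)
    = A x y * (\<psi> u1 a x * \<psi> (u2 - \<gamma>) b y) + C u1 u2 x y * (\<psi> u1 a y * \<psi> (u2 - \<gamma>) b x)"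
    if "x \<noteq> y" "a \<in> {1..n}" "b \<in> {1..n}" for x y a b
    using P[OF that(2,3) _ that(1), of "u1 - \<gamma>" "u2 - \<gamma>"] u by (simp add: C_shift)
  have R13: "P \<gamma> u1 u3 i c (\<lambda>a c. \<psi> u1 a x * \<psi> (u3 + \<gamma>) c y)
    = A x y * (\<psi> (u1 + \<gamma>) i x * \<psi> u3 c y) + C u1 u3 x y * (\<psi> (u1 + \<gamma>) i y * \<psi> u3 c x)"
    if "x \<noteq> y" "c \<in> {1..n}" for x y c using P[OF ikl(1) that(2) u(2) that(1)] by simp
  have R23: "P \<gamma> (u2 - \<gamma>) (u3 - \<gamma>) k l (\<lambda>b c. \<psi> (u2 - \<gamma>) b x * \<psi> u3 c y)
    = A x y * (\<psi> u2 k x * \<psi> (u3 - \<gamma>) l y) + C u2 u3 x y * (\<psi> u2 k y * \<psi> (u3 - \<gamma>) l x)"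
    if "x \<noteq> y" for x y
    using P[OF ikl(2,3) _ that(1), of "u2 - \<gamma>" "u3 - \<gamma>"] u by (simp add: C_shift)
  let ?F = "\<lambda>a b c. \<psi> (u1 - \<gamma>) a x * (\<psi> u2 b y * \<psi> (u3 + \<gamma>) c z)"
  have "ybl \<gamma> u1 u2 u3 i k l ?F
    = P \<gamma> u1 u2 i k (\<lambda>a b. P \<gamma> (u1 - \<gamma>) (u3 - \<gamma>) a l (\<lambda>a c.
        A y z * \<psi> (u2 + \<gamma>) b y * (\<psi> (u1 - \<gamma>) a x * \<psi> u3 c z)
        + C u2 u3 y z * \<psi> (u2 + \<gamma>) b z * (\<psi> (u1 - \<gamma>) a x * \<psi> u3 c y)))"
    unfolding ybl_def rhat_mult
    by (intro rhat_cong ikl) (assumption, simp only: L23[OF xyz(3)], simp add: algebra_simps)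
  also have "\<dots> = P \<gamma> u1 u2 i k (\<lambda>a b.
        A y z * A x z * \<psi> (u3 - \<gamma>) l z * (\<psi> u1 a x * \<psi> (u2 + \<gamma>) b y)
        + A y z * C u1 u3 x z * \<psi> (u3 - \<gamma>) l x * (\<psi> u1 a z * \<psi> (u2 + \<gamma>) b y)
        + (C u2 u3 y z * A x y * \<psi> (u3 - \<gamma>) l y * (\<psi> u1 a x * \<psi> (u2 + \<gamma>) b z)
        + C u2 u3 y z * C u1 u3 x y * \<psi> (u3 - \<gamma>) l x * (\<psi> u1 a y * \<psi> (u2 + \<gamma>) b z)))"
    by (intro rhat_cong ikl) (unfold rhat_add rhat_mult, simp only: L13[OF xyz(1)] L13[OF xyz(2)], simp add: algebra_simps)
  also have "\<dots> = A y z * A x z * (A x y * G x y z + C u1 u2 x y * G y x z)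
    + A y z * C u1 u3 x z * (A z y * G z y x + C u1 u2 z y * G y z x)
    + C u2 u3 y z * A x y * (A x z * G x z y + C u1 u2 x z * G z x y)
    + C u2 u3 y z * C u1 u3 x y * (A y z * G y z x + C u1 u2 y z * G z y x)"
    unfolding rhat_add rhat_mult L12[OF xyz(1)] L12[OF xyz(2)] L12[OF xyz(3)] L12[OF xyz(3)[symmetric]] G_def
    by (simp add: algebra_simps)
  finally have L: "ybl \<gamma> u1 u2 u3 i k l ?F = \<dots>" .
  have "ybr \<gamma> u1 u2 u3 i k l ?F
    = P \<gamma> (u2 - \<gamma>) (u3 - \<gamma>) k l (\<lambda>b c. P \<gamma> u1 u3 i c (\<lambda>a c.
        A x y * \<psi> (u2 - \<gamma>) b y * (\<psi> u1 a x * \<psi> (u3 + \<gamma>) c z)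
        + C u1 u2 x y * \<psi> (u2 - \<gamma>) b x * (\<psi> u1 a y * \<psi> (u3 + \<gamma>) c z)))"
  proof -
    have "P \<gamma> (u1 - \<gamma>) (u2 - \<gamma>) a b (\<lambda>a b. ?F a b c) =
      \<psi> (u3 + \<gamma>) c z * P \<gamma> (u1 - \<gamma>) (u2 - \<gamma>) a b (\<lambda>a b. \<psi> (u1 - \<gamma>) a x * \<psi> u2 b y)" for a b c
      unfolding rhat_mult[symmetric] by (simp only: mult_ac)
    then show ?thesis
      unfolding ybr_def by (intro rhat_cong ikl) (assumption, simp only: R12[OF xyz(1)], simp add: algebra_simps)
  qed
  also have "\<dots> = P \<gamma> (u2 - \<gamma>) (u3 - \<gamma>) k l (\<lambda>b c.
        A x y * A x z * \<psi> (u1 + \<gamma>) i x * (\<psi> (u2 - \<gamma>) b y * \<psi> u3 c z)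
        + A x y * C u1 u3 x z * \<psi> (u1 + \<gamma>) i z * (\<psi> (u2 - \<gamma>) b y * \<psi> u3 c x)
        + (C u1 u2 x y * A y z * \<psi> (u1 + \<gamma>) i y * (\<psi> (u2 - \<gamma>) b x * \<psi> u3 c z)
        + C u1 u2 x y * C u1 u3 y z * \<psi> (u1 + \<gamma>) i z * (\<psi> (u2 - \<gamma>) b x * \<psi> u3 c y)))"
    by (intro rhat_cong ikl) (unfold rhat_add rhat_mult, simp only: R13[OF xyz(2)] R13[OF xyz(3)], simp add: algebra_simps)
  also have "\<dots> = A x y * A x z * (A y z * G x y z + C u2 u3 y z * G x z y)
    + A x y * C u1 u3 x z * (A y x * G z y x + C u2 u3 y x * G z x y)
    + C u1 u2 x y * A y z * (A x z * G y x z + C u2 u3 x z * G y z x)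
    + C u1 u2 x y * C u1 u3 y z * (A x y * G z x y + C u2 u3 x y * G z y x)"
    unfolding rhat_add rhat_mult R23[OF xyz(1)] R23[OF xyz(2)] R23[OF xyz(3)] R23[OF xyz(1)[symmetric]] G_def
    by (simp add: algebra_simps)
  finally have R: "ybr \<gamma> u1 u2 u3 i k l ?F = \<dots>" .
  define p q X Y where pq: "p = u1 - u2" "q = u2 - u3" "X = x - y" "Y = y - z"
  have nz: "p \<noteq> 0" "q \<noteq> 0" "p + q \<noteq> 0" "X \<noteq> 0" "Y \<noteq> 0" "X + Y \<noteq> 0"
    using u xyz by (auto simp: pq)
  have d: "u1 - u2 = p" "u2 - u3 = q" "u1 - u3 = p + q" "x - y = X" "y - z = Y" "x - z = X + Y"
    "y - x = - X" "z - y = - Y"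
    by (simp_all add: pq)
  \<comment> \<open>The coefficients of G x y z, G y x z and G x z y agree as they stand. The other
    three permutations give rational identities in the four differences p, q, X, Y.\<close>
  have zyx: "A y z * C u1 u3 x z * A z y + C u2 u3 y z * C u1 u3 x y * C u1 u2 y z
    = A x y * C u1 u3 x z * A y x + C u1 u2 x y * C u1 u3 y z * C u2 u3 x y"
    unfolding A_def C_def d using nz by (simp add: divide_simps) (simp add: algebra_simps)
  have yzx: "C u1 u3 x z * C u1 u2 z y + C u2 u3 y z * C u1 u3 x y = C u1 u2 x y * C u2 u3 x z"
    unfolding A_def C_def d using nz by (simp add: divide_simps) (simp add: algebra_simps)
  have zxy: "C u2 u3 y z * C u1 u2 x z = C u1 u3 x z * C u2 u3 y x + C u1 u2 x y * C u1 u3 y z"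
    unfolding A_def C_def d using nz by (simp add: divide_simps) (simp add: algebra_simps)
  have "ybl \<gamma> u1 u2 u3 i k l ?F - ybr \<gamma> u1 u2 u3 i k l ?F
    = G z y x * ((A y z * C u1 u3 x z * A z y + C u2 u3 y z * C u1 u3 x y * C u1 u2 y z)
        - (A x y * C u1 u3 x z * A y x + C u1 u2 x y * C u1 u3 y z * C u2 u3 x y))
    + G y z x * A y z * ((C u1 u3 x z * C u1 u2 z y + C u2 u3 y z * C u1 u3 x y) - C u1 u2 x y * C u2 u3 x z)
    + G z x y * A x y * (C u2 u3 y z * C u1 u2 x z - (C u1 u3 x z * C u2 u3 y x + C u1 u2 x y * C u1 u3 y z))"
    unfolding L R by (simp add: algebra_simps)
  then show ?thesis unfolding zyx yzx zxy by simp
qed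

text \<open>\<open>n + 1\<close> points instead of \<open>n\<close>: this works for every \<open>C\<close>, whereas evaluation at \<open>n\<close> points
  is singular when their sum is \<open>C\<close>.\<close>

lemma \<psi>_span:
  assumes "finite X" "card X = Suc n"
  obtains c where "\<And>a. a \<in> {1..n} \<Longrightarrow> (\<Sum>x\<in>X. c x * \<psi> C a x) = f a"
proof -
  obtain c where c: "\<And>m. m \<le> n \<Longrightarrow> (\<Sum>x\<in>X. c x * x ^ m)
      = (if m = n then - f n else if m = n - 1 then 0 else f (Suc m))"
    using moments_surjective[OF assms(1), of "\<lambda>m. if m = n then - f n else if m = n - 1 then 0 else f (Suc m)"] assms(2)
    by (auto simp: less_Suc_eq_le)
  have "(\<Sum>x\<in>X. c x * \<psi> C a x) = f a" if a: "a \<in> {1..n}" for a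
  proof (cases "a = n")
    case True
    have "(\<Sum>x\<in>X. c x * \<psi> C a x) = C * (\<Sum>x\<in>X. c x * x ^ (n - 1)) - (\<Sum>x\<in>X. c x * x ^ n)"
      unfolding sum_distrib_left sum_subtractf[symmetric] using True
      by (intro sum.cong) (simp_all add: \<psi>_def power_n algebra_simps)
    then show ?thesis using c[of n] c[of "n - 1"] True n_ge_2 by simp
  next
    case False
    then show ?thesis using c[of "a - 1"] a by (auto simp: \<psi>_def)
  qed
  then show ?thesis using that by blast
qed

text \<open>The three factors are expanded in \<psi> over disjoint sets of n + 1 points each, so
  every triple (x, y, z) that occurs has distinct entries.\<close>

lemma ybl_eq_ybr:
  assumes ikl: "i \<in> {1..n}" "k \<in> {1..n}" "l \<in> {1..n}" and u: "u1 \<noteq> u2" "u1 \<noteq> u3" "u2 \<noteq> u3"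
  shows "ybl \<gamma> u1 u2 u3 i k l (\<lambda>a b c. f a * (g b * h c)) = ybr \<gamma> u1 u2 u3 i k l (\<lambda>a b c. f a * (g b * h c))"
proof -
  define X Y Z :: "complex set" where XYZ: "X = of_nat ` {0..n}" "Y = of_nat ` {Suc n..2 * n + 1}"
    "Z = of_nat ` {2 * n + 2..3 * n + 2}"
  have fin: "finite X" "finite Y" "finite Z" by (simp_all add: XYZ)
  have card: "card X = Suc n" "card Y = Suc n" "card Z = Suc n"
    by (simp_all add: XYZ card_image inj_on_def)
  have disj: "x \<noteq> y" "x \<noteq> z" "y \<noteq> z" if "x \<in> X" "y \<in> Y" "z \<in> Z" for x y z
    using that by (auto simp: XYZ)
  obtain cf where cf: "\<And>a. a \<in> {1..n} \<Longrightarrow> (\<Sum>x\<in>X. cf x * \<psi> (u1 - \<gamma>) a x) = f a"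
    using \<psi>_span[OF fin(1) card(1)] by metis
  obtain cg where cg: "\<And>a. a \<in> {1..n} \<Longrightarrow> (\<Sum>x\<in>Y. cg x * \<psi> u2 a x) = g a"
    using \<psi>_span[OF fin(2) card(2)] by metis
  obtain ch where ch: "\<And>a. a \<in> {1..n} \<Longrightarrow> (\<Sum>x\<in>Z. ch x * \<psi> (u3 + \<gamma>) a x) = h a"
    using \<psi>_span[OF fin(3) card(3)] by metis
  let ?F = "\<lambda>a b c. \<Sum>x\<in>X. \<Sum>y\<in>Y. \<Sum>z\<in>Z. (cf x * (cg y * ch z))
    * (\<psi> (u1 - \<gamma>) a x * (\<psi> u2 b y * \<psi> (u3 + \<gamma>) c z))"
  have F: "f a * (g b * h c) = ?F a b c" if "a \<in> {1..n}" "b \<in> {1..n}" "c \<in> {1..n}" for a b c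
    unfolding cf[OF that(1), symmetric] cg[OF that(2), symmetric] ch[OF that(3), symmetric] sum_product
    unfolding sum_distrib_left by (intro sum.cong refl) (simp only: mult_ac)
  have "ybl \<gamma> u1 u2 u3 i k l (\<lambda>a b c. f a * (g b * h c)) = ybl \<gamma> u1 u2 u3 i k l ?F"
    by (rule ybl_cong[OF ikl F])
  also have "\<dots> = ybr \<gamma> u1 u2 u3 i k l ?F"
    unfolding ybl_linear ybr_linear
    by (intro sum.cong refl arg_cong2[where f = "(*)"] ybl_eq_ybr_\<psi>[OF ikl u] disj)
  also have "\<dots> = ybr \<gamma> u1 u2 u3 i k l (\<lambda>a b c. f a * (g b * h c))"
    by (rule ybr_cong[OF ikl F[symmetric]])
  finally show ?thesis .
qed

section \<open>From index functions to matrices on the tensor cube\<close>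

lemma sum_UNIV3: "(\<Sum>p\<in>UNIV. f p) = (\<Sum>a=1..n. \<Sum>b=1..n. \<Sum>c=1..n. f (\<iota> a, \<iota> b, \<iota> c))"
proof -
  have "(\<Sum>p\<in>UNIV. f p) = (\<Sum>x\<in>UNIV. \<Sum>y\<in>UNIV. f (x, y))"
    by (simp add: sum.cartesian_product)
  then show ?thesis by (simp add: sum_UNIV sum_UNIV2)
qed

definition rowact3 :: "complex^('n \<times> 'n \<times> 'n)^('n \<times> 'n \<times> 'n) \<Rightarrow> nat \<Rightarrow> nat \<Rightarrow> nat \<Rightarrow> (nat \<Rightarrow> nat \<Rightarrow> nat \<Rightarrow> complex) \<Rightarrow> complex" where
  "rowact3 X i k l f = (\<Sum>a=1..n. \<Sum>b=1..n. \<Sum>c=1..n. X $ (\<iota> i, \<iota> k, \<iota> l) $ (\<iota> a, \<iota> b, \<iota> c) * f a b c)"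

lemma mult_nth_rowact3:
  "(X ** Y) $ (\<iota> i, \<iota> k, \<iota> l) $ s = rowact3 X i k l (\<lambda>a b c. Y $ (\<iota> a, \<iota> b, \<iota> c) $ s)"
  by (simp add: matrix_matrix_mult_def rowact3_def sum_UNIV3)

lemma rowact3_leg12:
  assumes "l \<in> {1..n}"
  shows "rowact3 (leg12 X) i k l f = rowact X i k (\<lambda>a b. f a b l)"
proof -
  have "rowact3 (leg12 X) i k l f = (\<Sum>a=1..n. \<Sum>b=1..n. \<Sum>c=1..n.
      if l = c then X $ (\<iota> i, \<iota> k) $ (\<iota> a, \<iota> b) * f a b l else 0)"
    unfolding rowact3_def leg12_def using assms by (intro sum.cong refl) auto
  then show ?thesis using assms by (simp add: rowact_def)
qed

lemma rowact3_leg13: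
  assumes "k \<in> {1..n}"
  shows "rowact3 (leg13 X) i k l f = rowact X i l (\<lambda>a c. f a k c)"
proof -
  have "rowact3 (leg13 X) i k l f = (\<Sum>a=1..n. \<Sum>b=1..n. if k = b then
      \<Sum>c=1..n. X $ (\<iota> i, \<iota> l) $ (\<iota> a, \<iota> c) * f a k c else 0)"
    unfolding rowact3_def leg13_def using assms by (intro sum.cong refl) (auto intro!: sum.neutral)
  then show ?thesis using assms by (simp add: rowact_def)
qed

lemma rowact3_leg23:
  assumes "i \<in> {1..n}"
  shows "rowact3 (leg23 X) i k l f = rowact X k l (\<lambda>b c. f i b c)"
proof -
  have "rowact3 (leg23 X) i k l f = (\<Sum>a=1..n. if i = a then
      \<Sum>b=1..n. \<Sum>c=1..n. X $ (\<iota> k, \<iota> l) $ (\<iota> b, \<iota> c) * f i b c else 0)"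
    unfolding rowact3_def leg23_def using assms by (intro sum.cong refl) (auto intro!: sum.neutral)
  then show ?thesis using assms by (simp add: rowact_def)
qed

lemma rowact3_cong:
  assumes "\<And>a b c. a \<in> {1..n} \<Longrightarrow> b \<in> {1..n} \<Longrightarrow> c \<in> {1..n} \<Longrightarrow> f a b c = g a b c"
  shows "rowact3 X i k l f = rowact3 X i k l g"
  unfolding rowact3_def using assms by (intro sum.cong) auto

lemma mat3_eqI:
  assumes "\<And>i k l p q r. \<lbrakk>i \<in> {1..n}; k \<in> {1..n}; l \<in> {1..n}; p \<in> {1..n}; q \<in> {1..n}; r \<in> {1..n}\<rbrakk>
    \<Longrightarrow> X $ (\<iota> i, \<iota> k, \<iota> l) $ (\<iota> p, \<iota> q, \<iota> r) = Y $ (\<iota> i, \<iota> k, \<iota> l) $ (\<iota> p, \<iota> q, \<iota> r)"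
  shows "X = Y"
proof -
  have "X $ r $ s = Y $ r $ s" for r s
    using assms by (metis label_cases surj_pair)
  then show ?thesis by (simp add: vec_eq_iff)
qed

lemma shifted_yang_baxter:
  assumes u: "u1 \<noteq> u2" "u1 \<noteq> u3" "u2 \<noteq> u3"
    and nz: "u1 \<noteq> 0" "u1 + \<gamma> \<noteq> 0" "u2 \<noteq> 0" "u2 + \<gamma> \<noteq> 0" "u2 - \<gamma> \<noteq> 0" "u3 \<noteq> 0" "u3 - \<gamma> \<noteq> 0"
  shows "leg12 (acf_R0 n \<iota> \<gamma> u1 u2) ** leg13 (acf_R0 n \<iota> \<gamma> (u1 - \<gamma>) (u3 - \<gamma>)) ** leg23 (acf_R0 n \<iota> \<gamma> u2 u3)
    = leg23 (acf_R0 n \<iota> \<gamma> (u2 - \<gamma>) (u3 - \<gamma>)) ** leg13 (acf_R0 n \<iota> \<gamma> u1 u3)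
      ** leg12 (acf_R0 n \<iota> \<gamma> (u1 - \<gamma>) (u2 - \<gamma>))" (is "?A ** ?B ** ?C = ?D ** ?E ** ?F")
proof (rule mat3_eqI)
  fix i k l p q r
  assume ikl: "i \<in> {1..n}" "k \<in> {1..n}" "l \<in> {1..n}" and pqr: "p \<in> {1..n}" "q \<in> {1..n}" "r \<in> {1..n}"
  \<comment> \<open>A column of the identity is a product of three Kronecker deltas, the kind of
    function to which \<open>ybl_eq_ybr\<close> applies.\<close>
  define f g h :: "nat \<Rightarrow> complex" where fgh: "f a = (if a = p then 1 else 0)"
    "g a = (if a = q then 1 else 0)" "h a = (if a = r then 1 else 0)" for a
  \<comment> \<open>\<open>?H\<close> also absorbs the innermost scalings, which are those at u1 -
    \<gamma>, u2 and u3 + \<gamma> on both sides.\<close>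
  let ?s = "(\<iota> p, \<iota> q, \<iota> r)" and ?pre = "scale (1 / (u1 + \<gamma>)) i * scale (1 / u2) k * scale (1 / (u3 - \<gamma>)) l"
  let ?H = "\<lambda>a b c. (scale (u1 - \<gamma>) a * f a) * ((scale u2 b * g b) * (scale (u3 + \<gamma>) c * h c))"
  have one: "mat 1 $ (\<iota> a, \<iota> b, \<iota> c) $ ?s = f a * (g b * h c)"
    if "a \<in> {1..n}" "b \<in> {1..n}" "c \<in> {1..n}" for a b c
    using that pqr by (auto simp: mat_def fgh)
  txt \<open>Each \<open>acf_R0\<close> is the gauged matrix \<open>P\<close> between two diagonal scalings; between neighbouring
    factors the scalings cancel, and the same outer ones remain on both sides.\<close>
  have scale_cancel: "scale c a * (x * (scale (1 / c) a * y)) = x * y" if "c \<noteq> 0" for c a x y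
    using that by (simp add: scale_def)

  have scale_cancel2: "scale c a * scale d b * (scale (1 / d) b * (scale (1 / c) a * y)) = y"
    if "c \<noteq> 0" "d \<noteq> 0" for c d a b y
    using that by (simp add: scale_def)

  have l23: "scale (u1 - \<gamma>) a * rowact (acf_R0 n \<iota> \<gamma> u2 u3) b c (\<lambda>b c. f a * (g b * h c))
    = scale (1 / (u2 + \<gamma>)) b * (scale (1 / u3) c * P \<gamma> u2 u3 b c (\<lambda>b c. ?H a b c))"
    if "b \<in> {1..n}" "c \<in> {1..n}" for a b c
    unfolding rowact_R0[OF that nz(4,6)] rhat_mult[symmetric] by (simp only: mult_ac)
  have l13: "rowact (acf_R0 n \<iota> \<gamma> (u1 - \<gamma>) (u3 - \<gamma>)) a l
      (\<lambda>a c. rowact (acf_R0 n \<iota> \<gamma> u2 u3) b c (\<lambda>b c. f a * (g b * h c)))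
    = scale (1 / u1) a * (scale (1 / (u2 + \<gamma>)) b * (scale (1 / (u3 - \<gamma>)) l
      * P \<gamma> (u1 - \<gamma>) (u3 - \<gamma>) a l (\<lambda>a c. P \<gamma> u2 u3 b c (\<lambda>b c. ?H a b c))))"
    if "a \<in> {1..n}" "b \<in> {1..n}" for a b
  proof -
    have "P \<gamma> (u1 - \<gamma>) (u3 - \<gamma>) a l (\<lambda>a c. scale (u1 - \<gamma>) a * scale u3 c
        * rowact (acf_R0 n \<iota> \<gamma> u2 u3) b c (\<lambda>b c. f a * (g b * h c)))
      = P \<gamma> (u1 - \<gamma>) (u3 - \<gamma>) a l (\<lambda>a c. scale (1 / (u2 + \<gamma>)) b * P \<gamma> u2 u3 b c (\<lambda>b c. ?H a b c))"
    proof (intro rhat_cong that ikl)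
      fix a c assume "c \<in> {1..n}"
      have "scale (u1 - \<gamma>) a * scale u3 c * rowact (acf_R0 n \<iota> \<gamma> u2 u3) b c (\<lambda>b c. f a * (g b * h c))
        = scale u3 c * (scale (u1 - \<gamma>) a * rowact (acf_R0 n \<iota> \<gamma> u2 u3) b c (\<lambda>b c. f a * (g b * h c)))"
        by (simp only: mult_ac)
      then show "scale (u1 - \<gamma>) a * scale u3 c * rowact (acf_R0 n \<iota> \<gamma> u2 u3) b c (\<lambda>b c. f a * (g b * h c))
        = scale (1 / (u2 + \<gamma>)) b * P \<gamma> u2 u3 b c (\<lambda>b c. ?H a b c)"
        unfolding l23[OF that(2) \<open>c \<in> {1..n}\<close>] scale_cancel[OF nz(6)] .
    qed
    then show ?thesis
      using rowact_R0[OF that(1) ikl(3), of "u1 - \<gamma>" \<gamma> "u3 - \<gamma>"] nz unfolding rhat_mult by simp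
  qed
  have l12: "rowact (acf_R0 n \<iota> \<gamma> u1 u2) i k (\<lambda>a b. rowact (acf_R0 n \<iota> \<gamma> (u1 - \<gamma>) (u3 - \<gamma>)) a l
      (\<lambda>a c. rowact (acf_R0 n \<iota> \<gamma> u2 u3) b c (\<lambda>b c. f a * (g b * h c))))
    = ?pre * ybl \<gamma> u1 u2 u3 i k l ?H"
  proof -
    have "P \<gamma> u1 u2 i k (\<lambda>a b. scale u1 a * scale (u2 + \<gamma>) b
        * rowact (acf_R0 n \<iota> \<gamma> (u1 - \<gamma>) (u3 - \<gamma>)) a l
            (\<lambda>a c. rowact (acf_R0 n \<iota> \<gamma> u2 u3) b c (\<lambda>b c. f a * (g b * h c))))
      = P \<gamma> u1 u2 i k (\<lambda>a b. scale (1 / (u3 - \<gamma>)) l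
        * P \<gamma> (u1 - \<gamma>) (u3 - \<gamma>) a l (\<lambda>a c. P \<gamma> u2 u3 b c (\<lambda>b c. ?H a b c)))"
    proof (intro rhat_cong ikl)
      fix a b assume ab: "a \<in> {1..n}" "b \<in> {1..n}"
      show "scale u1 a * scale (u2 + \<gamma>) b
        * rowact (acf_R0 n \<iota> \<gamma> (u1 - \<gamma>) (u3 - \<gamma>)) a l
            (\<lambda>a c. rowact (acf_R0 n \<iota> \<gamma> u2 u3) b c (\<lambda>b c. f a * (g b * h c)))
        = scale (1 / (u3 - \<gamma>)) l
          * P \<gamma> (u1 - \<gamma>) (u3 - \<gamma>) a l (\<lambda>a c. P \<gamma> u2 u3 b c (\<lambda>b c. ?H a b c))"
        unfolding l13[OF ab] mult.assoc[of "scale u1 a"] scale_cancel[OF nz(1)]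
        using scale_cancel[OF nz(1), of a "scale (u2 + \<gamma>) b"] scale_cancel[OF nz(4), of b 1]
        by (simp add: mult.left_commute)
    qed
    then show ?thesis
      unfolding rowact_R0[OF ikl(1,2) nz(2,3)] ybl_def rhat_mult by (simp add: mult_ac)
  qed

  have r12: "scale (u3 + \<gamma>) c * rowact (acf_R0 n \<iota> \<gamma> (u1 - \<gamma>) (u2 - \<gamma>)) a b (\<lambda>a b. f a * (g b * h c))
    = scale (1 / u1) a * (scale (1 / (u2 - \<gamma>)) b
      * P \<gamma> (u1 - \<gamma>) (u2 - \<gamma>) a b (\<lambda>a b. ?H a b c))"
    if "a \<in> {1..n}" "b \<in> {1..n}" for a b c
    using rowact_R0[OF that, of "u1 - \<gamma>" \<gamma> "u2 - \<gamma>" "\<lambda>a b. f a * (g b * h c)"] nz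
    unfolding rhat_mult[symmetric] by (simp add: rhat_mult[symmetric] mult_ac)
  have r13: "rowact (acf_R0 n \<iota> \<gamma> u1 u3) i c
      (\<lambda>a c. rowact (acf_R0 n \<iota> \<gamma> (u1 - \<gamma>) (u2 - \<gamma>)) a b (\<lambda>a b. f a * (g b * h c)))
    = scale (1 / u3) c * (scale (1 / (u2 - \<gamma>)) b * (scale (1 / (u1 + \<gamma>)) i
      * P \<gamma> u1 u3 i c (\<lambda>a c. P \<gamma> (u1 - \<gamma>) (u2 - \<gamma>) a b (\<lambda>a b. ?H a b c))))"
    if "c \<in> {1..n}" "b \<in> {1..n}" for b c
  proof -
    have "P \<gamma> u1 u3 i c (\<lambda>a c. scale u1 a * scale (u3 + \<gamma>) c
        * rowact (acf_R0 n \<iota> \<gamma> (u1 - \<gamma>) (u2 - \<gamma>)) a b (\<lambda>a b. f a * (g b * h c)))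
      = P \<gamma> u1 u3 i c (\<lambda>a c. scale (1 / (u2 - \<gamma>)) b * P \<gamma> (u1 - \<gamma>) (u2 - \<gamma>) a b (\<lambda>a b. ?H a b c))"
    proof (intro rhat_cong that ikl)
      fix a c assume "a \<in> {1..n}"
      show "scale u1 a * scale (u3 + \<gamma>) c
        * rowact (acf_R0 n \<iota> \<gamma> (u1 - \<gamma>) (u2 - \<gamma>)) a b (\<lambda>a b. f a * (g b * h c))
        = scale (1 / (u2 - \<gamma>)) b * P \<gamma> (u1 - \<gamma>) (u2 - \<gamma>) a b (\<lambda>a b. ?H a b c)"
        unfolding mult.assoc[of "scale u1 a"] r12[OF \<open>a \<in> {1..n}\<close> that(2)]
        using scale_cancel[OF nz(1), of a 1] by simp
    qed
    then show ?thesis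
      unfolding rowact_R0[OF ikl(1) that(1) nz(2,6)] rhat_mult by (simp add: mult_ac)
  qed
  have r23: "rowact (acf_R0 n \<iota> \<gamma> (u2 - \<gamma>) (u3 - \<gamma>)) k l (\<lambda>b c. rowact (acf_R0 n \<iota> \<gamma> u1 u3) i c
      (\<lambda>a c. rowact (acf_R0 n \<iota> \<gamma> (u1 - \<gamma>) (u2 - \<gamma>)) a b (\<lambda>a b. f a * (g b * h c))))
    = ?pre * ybr \<gamma> u1 u2 u3 i k l ?H"
  proof -
    have "P \<gamma> (u2 - \<gamma>) (u3 - \<gamma>) k l (\<lambda>b c. scale (u2 - \<gamma>) b * scale u3 c
        * rowact (acf_R0 n \<iota> \<gamma> u1 u3) i c
            (\<lambda>a c. rowact (acf_R0 n \<iota> \<gamma> (u1 - \<gamma>) (u2 - \<gamma>)) a b (\<lambda>a b. f a * (g b * h c))))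
      = P \<gamma> (u2 - \<gamma>) (u3 - \<gamma>) k l (\<lambda>b c. scale (1 / (u1 + \<gamma>)) i
        * P \<gamma> u1 u3 i c (\<lambda>a c. P \<gamma> (u1 - \<gamma>) (u2 - \<gamma>) a b (\<lambda>a b. ?H a b c)))"
    proof (intro rhat_cong ikl)
      fix b c assume bc: "b \<in> {1..n}" "c \<in> {1..n}"
      show "scale (u2 - \<gamma>) b * scale u3 c
        * rowact (acf_R0 n \<iota> \<gamma> u1 u3) i c
            (\<lambda>a c. rowact (acf_R0 n \<iota> \<gamma> (u1 - \<gamma>) (u2 - \<gamma>)) a b (\<lambda>a b. f a * (g b * h c)))
        = scale (1 / (u1 + \<gamma>)) i
          * P \<gamma> u1 u3 i c (\<lambda>a c. P \<gamma> (u1 - \<gamma>) (u2 - \<gamma>) a b (\<lambda>a b. ?H a b c))"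
        unfolding r13[OF bc(2,1)] by (rule scale_cancel2[OF nz(5,6)])
    qed
    then show ?thesis
      using rowact_R0[OF ikl(2,3), of "u2 - \<gamma>" \<gamma> "u3 - \<gamma>"] nz
      unfolding ybr_def rhat_mult by (simp add: mult_ac)
  qed

  \<comment> \<open>The appended identity matrix turns each entry into three nested row functionals
    acting on the deltas.\<close>
  have "(?A ** (?B ** (?C ** mat 1))) $ (\<iota> i, \<iota> k, \<iota> l) $ ?s
    = rowact3 ?A i k l (\<lambda>a b c. rowact3 ?B a b c (\<lambda>a b c. rowact3 ?C a b c (\<lambda>a b c. f a * (g b * h c))))"
    unfolding mult_nth_rowact3 by (intro rowact3_cong one)
  also have "\<dots> = ?pre * ybl \<gamma> u1 u2 u3 i k l ?H"
    unfolding l12[symmetric] rowact3_leg12[OF ikl(3)]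
    by (intro rowact_cong, subst rowact3_leg13, assumption, intro rowact_cong rowact3_leg23)
  also have "\<dots> = ?pre * ybr \<gamma> u1 u2 u3 i k l ?H"
    by (simp only: ybl_eq_ybr[OF ikl u])
  also have "\<dots> = rowact3 ?D i k l (\<lambda>a b c. rowact3 ?E a b c (\<lambda>a b c. rowact3 ?F a b c (\<lambda>a b c. f a * (g b * h c))))"
    unfolding r23[symmetric] rowact3_leg23[OF ikl(1)]
    by (rule sym, intro rowact_cong, subst rowact3_leg13, assumption, intro rowact_cong rowact3_leg12)
  also have "\<dots> = (?D ** (?E ** (?F ** mat 1))) $ (\<iota> i, \<iota> k, \<iota> l) $ ?s"
    unfolding mult_nth_rowact3 by (rule sym, intro rowact3_cong one)
  finally show "(?A ** ?B ** ?C) $ (\<iota> i, \<iota> k, \<iota> l) $ ?s = (?D ** ?E ** ?F) $ (\<iota> i, \<iota> k, \<iota> l) $ ?s"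
    by (simp add: matrix_mul_assoc)
qed

end

text \<open>Identities of meromorphic functions are read pointwise away from poles and singular
  gauge matrices. The first conjunct ensures that the occurrences of \<open>matrix_inv\<close> in
  the others are genuine inverses; for b^g it is used at u - \<gamma>.\<close>

theorem mainTheorem3:
  fixes n :: nat and \<iota> :: "nat \<Rightarrow> 'n::finite" and \<gamma> f0 :: complex
  assumes "n \<ge> 2" and "bij_betw \<iota> {1..n} (UNIV :: 'n set)" and "\<gamma> \<noteq> 0"
  shows
   "(\<forall>u lam. inj_on lam {1..n} \<and> lamsum n lam + u + f0 \<noteq> 0 \<and> u + \<gamma> \<noteq> 0 \<longrightarrow>
       invertible (acf_b n \<iota> \<gamma> f0 u lam))
  \<and> (\<forall>v lam. inj_on lam {1..n} \<and> nonres n \<gamma> lam \<and> lamsum n lam + v + f0 \<noteq> 0 \<and> v + \<gamma> \<noteq> 0 \<longrightarrow>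
       acf_B n \<iota> \<gamma> v lam
         = matrix_inv (in2 (acf_b n \<iota> \<gamma> f0 v lam)) ** dyn2 n \<iota> \<gamma> (acf_bg n \<iota> \<gamma> f0 v) lam)
  \<and> (\<forall>u lam. inj_on lam {1..n} \<and> nonres n \<gamma> lam \<and> lamsum n lam + u + f0 \<noteq> 0 \<and> u + \<gamma> \<noteq> 0 \<longrightarrow>
       acf_C n \<iota> \<gamma> u lam
         = matrix_inv (in1 (acf_b n \<iota> \<gamma> f0 u lam)) ** dyn1 n \<iota> \<gamma> (acf_bg n \<iota> \<gamma> f0 u) lam)
  \<and> (\<forall>u v lam. inj_on lam {1..n} \<and> u \<noteq> v \<and> u + \<gamma> \<noteq> 0 \<and> v \<noteq> 0
       \<and> lamsum n lam + u + f0 \<noteq> 0 \<and> lamsum n lam + u - \<gamma> + f0 \<noteq> 0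
       \<and> lamsum n lam + v + f0 \<noteq> 0 \<and> lamsum n lam + v - \<gamma> + f0 \<noteq> 0 \<longrightarrow>
       acf_A n \<iota> \<gamma> u v lam
         = matrix_inv (in1 (acf_b n \<iota> \<gamma> f0 u lam)) ** matrix_inv (in2 (acf_bg n \<iota> \<gamma> f0 v lam))
           ** acf_R n \<iota> \<gamma> f0 u v lam
           ** in1 (acf_bg n \<iota> \<gamma> f0 u lam) ** in2 (acf_b n \<iota> \<gamma> f0 v lam))
  \<and> (\<forall>u v lam. inj_on lam {1..n} \<and> nonres n \<gamma> lam \<and> u \<noteq> v \<and> u \<noteq> 0 \<and> v \<noteq> 0
       \<and> lamsum n lam + u + f0 \<noteq> 0 \<and> lamsum n lam + u - \<gamma> + f0 \<noteq> 0
       \<and> lamsum n lam + v + f0 \<noteq> 0 \<and> lamsum n lam + v - \<gamma> + f0 \<noteq> 0 \<longrightarrow>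
       acf_D n \<iota> \<gamma> (u - v) lam
         = dyn1 n \<iota> \<gamma> (\<lambda>l. matrix_inv (acf_bg n \<iota> \<gamma> f0 u l)) lam
           ** matrix_inv (in2 (acf_bg n \<iota> \<gamma> f0 v lam))
           ** acf_R n \<iota> \<gamma> f0 u v lam
           ** in1 (acf_bg n \<iota> \<gamma> f0 u lam) ** dyn2 n \<iota> \<gamma> (acf_bg n \<iota> \<gamma> f0 v) lam)
  \<and> (f0 = \<gamma> \<longrightarrow>
      (\<forall>u v lam. u \<noteq> v \<and> lamsum n lam + u + \<gamma> \<noteq> 0 \<and> lamsum n lam + v \<noteq> 0 \<longrightarrow>
         acf_R n \<iota> \<gamma> f0 u v lam
           = acf_R0 n \<iota> \<gamma> (u + lamsum n lam) (v + lamsum n lam)))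
  \<and> (\<forall>u1 u2 u3. u1 \<noteq> u2 \<and> u1 \<noteq> u3 \<and> u2 \<noteq> u3 \<and> u1 \<noteq> 0 \<and> u1 + \<gamma> \<noteq> 0
       \<and> u2 \<noteq> 0 \<and> u2 + \<gamma> \<noteq> 0 \<and> u2 - \<gamma> \<noteq> 0 \<and> u3 \<noteq> 0 \<and> u3 - \<gamma> \<noteq> 0 \<longrightarrow>
       leg12 (acf_R0 n \<iota> \<gamma> u1 u2) ** leg13 (acf_R0 n \<iota> \<gamma> (u1 - \<gamma>) (u3 - \<gamma>))
         ** leg23 (acf_R0 n \<iota> \<gamma> u2 u3)
       = leg23 (acf_R0 n \<iota> \<gamma> (u2 - \<gamma>) (u3 - \<gamma>)) ** leg13 (acf_R0 n \<iota> \<gamma> u1 u3)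
         ** leg12 (acf_R0 n \<iota> \<gamma> (u1 - \<gamma>) (u2 - \<gamma>)))"
proof -
  interpret labelling n \<iota> using assms(1,2) by unfold_locales
  show ?thesis
  proof (intro conjI allI impI)
    fix u lam
    assume "inj_on lam {1..n} \<and> lamsum n lam + u + f0 \<noteq> 0 \<and> u + \<gamma> \<noteq> 0"
    then show "invertible (acf_b n \<iota> \<gamma> f0 u lam)"
      using invertible_acf_b by blast
  next
    fix v lam
    assume "inj_on lam {1..n} \<and> nonres n \<gamma> lam \<and> lamsum n lam + v + f0 \<noteq> 0 \<and> v + \<gamma> \<noteq> 0"
    then show "acf_B n \<iota> \<gamma> v lam
        = matrix_inv (in2 (acf_b n \<iota> \<gamma> f0 v lam)) ** dyn2 n \<iota> \<gamma> (acf_bg n \<iota> \<gamma> f0 v) lam"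
      by (intro eq_inv_mult invertible_in2 invertible_acf_b in2_b_mult_B assms(3)) auto
  next
    fix u lam
    assume "inj_on lam {1..n} \<and> nonres n \<gamma> lam \<and> lamsum n lam + u + f0 \<noteq> 0 \<and> u + \<gamma> \<noteq> 0"
    then show "acf_C n \<iota> \<gamma> u lam
        = matrix_inv (in1 (acf_b n \<iota> \<gamma> f0 u lam)) ** dyn1 n \<iota> \<gamma> (acf_bg n \<iota> \<gamma> f0 u) lam"
      by (intro eq_inv_mult invertible_in1 invertible_acf_b in1_b_mult_C assms(3)) auto
  next
    fix u v lam
    assume "inj_on lam {1..n} \<and> u \<noteq> v \<and> u + \<gamma> \<noteq> 0 \<and> v \<noteq> 0
       \<and> lamsum n lam + u + f0 \<noteq> 0 \<and> lamsum n lam + u - \<gamma> + f0 \<noteq> 0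
       \<and> lamsum n lam + v + f0 \<noteq> 0 \<and> lamsum n lam + v - \<gamma> + f0 \<noteq> 0"
    then show "acf_A n \<iota> \<gamma> u v lam
        = matrix_inv (in1 (acf_b n \<iota> \<gamma> f0 u lam)) ** matrix_inv (in2 (acf_bg n \<iota> \<gamma> f0 v lam))
           ** acf_R n \<iota> \<gamma> f0 u v lam
           ** in1 (acf_bg n \<iota> \<gamma> f0 u lam) ** in2 (acf_b n \<iota> \<gamma> f0 v lam)"
      by (elim conjE) (rule acf_A_eq)
  next
    fix u v lam
    assume "inj_on lam {1..n} \<and> nonres n \<gamma> lam \<and> u \<noteq> v \<and> u \<noteq> 0 \<and> v \<noteq> 0
       \<and> lamsum n lam + u + f0 \<noteq> 0 \<and> lamsum n lam + u - \<gamma> + f0 \<noteq> 0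
       \<and> lamsum n lam + v + f0 \<noteq> 0 \<and> lamsum n lam + v - \<gamma> + f0 \<noteq> 0"
    then show "acf_D n \<iota> \<gamma> (u - v) lam
         = dyn1 n \<iota> \<gamma> (\<lambda>l. matrix_inv (acf_bg n \<iota> \<gamma> f0 u l)) lam
           ** matrix_inv (in2 (acf_bg n \<iota> \<gamma> f0 v lam))
           ** acf_R n \<iota> \<gamma> f0 u v lam
           ** in1 (acf_bg n \<iota> \<gamma> f0 u lam) ** dyn2 n \<iota> \<gamma> (acf_bg n \<iota> \<gamma> f0 v) lam"
      using assms(3) by (elim conjE) (rule acf_D_eq)
  next
    fix u v lam
    assume "f0 = \<gamma>" and "u \<noteq> v \<and> lamsum n lam + u + \<gamma> \<noteq> 0 \<and> lamsum n lam + v \<noteq> 0"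
    then show "acf_R n \<iota> \<gamma> f0 u v lam
           = acf_R0 n \<iota> \<gamma> (u + lamsum n lam) (v + lamsum n lam)"
      by (auto intro!: acf_R_eq_R0)
  qed (elim conjE, rule shifted_yang_baxter)
qed

end
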